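(* Let $d, m\in\mathbb{N}$, $T\in(0,\infty)$, $a\in\mathbb{R}$, $b\in(a,\infty)$, let $\mu\colon\mathbb{R}^d\to\mathbb{R}^d$ and $\sigma\colon\mathbb{R}^d\to\mathbb{R}^{d\times m}$ be globally Lipschitz continuous functions, let $\varphi\colon\mathbb{R}^d\to\mathbb{R}$ be a function, let $u=(u(t,x))_{(t,x)\in[0,T]\times\mathbb{R}^d}\in C^{1,2}([0,T]\times\mathbb{R}^d,\mathbb{R})$ be a function with at most polynomially growing partial derivatives which satisfies for every $t\in[0,T]$, $x\in\mathbb{R}^d$ that $u(0,x)=\varphi(x)$ and $$\tfrac{\partial u}{\partial t}(t,x)=\tfrac12\operatorname{Trace}_{\mathbb{R}^d}\big(\sigma(x)[\sigma(x)]^{*}(\operatorname{Hess}_x u)(t,x)\big)+\langle\mu(x),(\nabla_x u)(t,x)\rangle_{\mathbb{R}^d},$$ let $(\Omega,\mathcal{F},\mathbb{P})$ be a probability space with a normal filtration $(\mathbb{F}_t)_{t\in[0,T]}$, let $W\colon[0,T]\times\Omega\to\mathbb{R}^m$ be a standard $(\mathbb{F}_t)_{t\in[0,T]}$-Brownian motion, let $\xi\colon\Omega\to[a,b]^d$ be a continuous uniformly distributed $\mathbb{F}_0/\mathcal{B}([a,b]^d)$-measurable random variable, and let $\mathbb{X}=(\mathbb{X}_t)_{t\in[0,T]}\colon[0,T]\times\Omega\to\mathbb{R}^d$ be an $(\mathbb{F}_t)_{t\in[0,T]}$-adapted stochastic process with continuous sample paths which satisfies that for every $t\in[0,T]$ it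 holds $\mathbb{P}$-a.s. that $$\mathbb{X}_t=\xi+\int_0^t\mu(\mathbb{X}_s)\,ds+\int_0^t\sigma(\mathbb{X}_s)\,dW_s.$$ Then (i) the function $\varphi\colon\mathbb{R}^d\to\mathbb{R}$ is twice continuously differentiable with at most polynomially growing derivatives, (ii) there exists a unique continuous function $U\colon[a,b]^d\to\mathbb{R}$ such that $$\mathbb{E}\big[|\varphi(\mathbb{X}_T)-U(\xi)|^2\big]=\inf_{v\in C([a,b]^d,\mathbb{R})}\mathbb{E}\big[|\varphi(\mathbb{X}_T)-v(\xi)|^2\big],$$ and (iii) for every $x\in[a,b]^d$ it holds that $U(x)=u(T,x)$.
   Context: $\mathcal{B}(E)$ denotes the Borel sigma-algebra of a topological space $E$, and $C(E,F)$ the set of continuous functions from $E$ to $F$. $C^{1,2}([0,T]\times\mathbb{R}^d,\mathbb{R})$ is the set of functions $u(t,x)$ that are once continuously differentiable in $t$ and twice continuously differentiable in $x$, with $u$, $\frac{\partial u}{\partial t}$, $\nabla_x u$, $\operatorname{Hess}_x u$ continuous on $[0,T]\times\mathbb{R}^d$ (one-sided time derivatives at $t=0$ and $t=T$). "At most polynomially growing partial derivatives" means that there is a constant $c\in[1,\infty)$ such that the partial derivatives $\frac{\partial u}{\partial t}$, $\nabla_x u$, $\operatorname{Hess}_x u$ are bounded in norm at every $(t,x)\in[0,T]\times\mathbb{R}^d$ by $c(1+\|x\|_{\mathbb{R}^d})^c$; analogously for the first and second order derivatives of $\varphi$. $\nabla_x$ and $\operatorname{Hess}_x$ are gradient and Hessian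 in $x$, $[\cdot]^*$ is the matrix transpose, and $\langle\cdot,\cdot\rangle_{\mathbb{R}^d}$ and $\|\cdot\|_{\mathbb{R}^d}$ are the standard scalar product and Euclidean norm. A normal filtration is a right-continuous filtration such that $\mathbb{F}_0$ contains all $\mathbb{P}$-null sets of $\mathcal{F}$. A standard $(\mathbb{F}_t)$-Brownian motion is a standard Brownian motion (with continuous sample paths) that is adapted to $(\mathbb{F}_t)$ and whose increments $W_t-W_s$ are independent of $\mathbb{F}_s$ for $s\le t$. "Continuous uniformly distributed on $[a,b]^d$" means that the law is normalized Lebesgue measure on $[a,b]^d$. *)

theory Defs
  imports "HOL-Probability.Probability"
begin

section \<open>Smoothness and polynomial growth\<close>

definition grad :: "(real^'d \<Rightarrow> real) \<Rightarrow> real^'d \<Rightarrow> real^'d" where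
  "grad f x = (\<chi> i. frechet_derivative f (at x) (axis i 1))"

definition hess :: "(real^'d \<Rightarrow> real) \<Rightarrow> real^'d \<Rightarrow> real^'d^'d" where
  "hess f x = jacobian (grad f) (at x)"

text \<open>The derivative within \<open>{0..T}\<close> is one-sided at both endpoints.\<close>

definition time_deriv :: "real \<Rightarrow> (real \<Rightarrow> real^'d \<Rightarrow> real) \<Rightarrow> real \<Rightarrow> real^'d \<Rightarrow> real" where
  "time_deriv T u t x = vector_derivative (\<lambda>s. u s x) (at t within {0..T})"

definition C2 :: "(real^'d \<Rightarrow> real) \<Rightarrow> bool" where
  "C2 f \<longleftrightarrow>
     (\<forall>x. f differentiable (at x) \<and> grad f differentiable (at x)) \<and>
     continuous_on UNIV f \<and> continuous_on UNIV (grad f) \<and> continuous_on UNIV (hess f)"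

definition C12 :: "real \<Rightarrow> (real \<Rightarrow> real^'d \<Rightarrow> real) \<Rightarrow> bool" where
  "C12 T u \<longleftrightarrow>
     (\<forall>t\<in>{0..T}. \<forall>x. (\<lambda>s. u s x) differentiable (at t within {0..T}) \<and>
        u t differentiable (at x) \<and> grad (u t) differentiable (at x)) \<and>
     continuous_on ({0..T} \<times> UNIV) (\<lambda>(t, x). u t x) \<and>
     continuous_on ({0..T} \<times> UNIV) (\<lambda>(t, x). time_deriv T u t x) \<and>
     continuous_on ({0..T} \<times> UNIV) (\<lambda>(t, x). grad (u t) x) \<and>
     continuous_on ({0..T} \<times> UNIV) (\<lambda>(t, x). hess (u t) x)"

definition poly_growing_derivs :: "(real^'d \<Rightarrow> real) \<Rightarrow> bool" where
  "poly_growing_derivs f \<longleftrightarrow>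
     (\<exists>c::real. 1 \<le> c \<and> (\<forall>x.
        norm (grad f x) \<le> c * (1 + norm x) powr c \<and>
        norm (hess f x) \<le> c * (1 + norm x) powr c))"

definition poly_growing_partial_derivs :: "real \<Rightarrow> (real \<Rightarrow> real^'d \<Rightarrow> real) \<Rightarrow> bool" where
  "poly_growing_partial_derivs T u \<longleftrightarrow>
     (\<exists>c::real. 1 \<le> c \<and> (\<forall>t\<in>{0..T}. \<forall>x.
        \<bar>time_deriv T u t x\<bar> \<le> c * (1 + norm x) powr c \<and>
        norm (grad (u t) x) \<le> c * (1 + norm x) powr c \<and>
        norm (hess (u t) x) \<le> c * (1 + norm x) powr c))"

text \<open>Functions on \<open>S\<close> are represented by extensional functions, so that equality of
  elements of \<open>C_fun S\<close> is equality on \<open>S\<close>.\<close>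

definition C_fun :: "'a::topological_space set \<Rightarrow> ('a \<Rightarrow> real) set" where
  "C_fun S = {v \<in> extensional S. continuous_on S v}"

section \<open>Filtrations, Brownian motion and the It\^o integral\<close>

text \<open>Stochastic processes indexed by \<open>[0,T]\<close> are functions on \<open>real\<close> whose values outside
  \<open>{0..T}\<close> are irrelevant. Note that \<open>null_sets M\<close> consists of the measurable sets of
  measure zero; the probability space need not be complete.\<close>

definition normal_filtration :: "'w measure \<Rightarrow> real \<Rightarrow> (real \<Rightarrow> 'w measure) \<Rightarrow> bool" where
  "normal_filtration M T F \<longleftrightarrow>
     (\<forall>t\<in>{0..T}. subalgebra M (F t)) \<and>
     (\<forall>s\<in>{0..T}. \<forall>t\<in>{s..T}. sets (F s) \<subseteq> sets (F t)) \<and>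
     (\<forall>t\<in>{0..<T}. sets (F t) = (\<Inter>s\<in>{t<..T}. sets (F s))) \<and>
     null_sets M \<subseteq> sets (F 0)"

definition adapted_process ::
  "real \<Rightarrow> (real \<Rightarrow> 'w measure) \<Rightarrow> (real \<Rightarrow> 'w \<Rightarrow> 'e::topological_space) \<Rightarrow> bool" where
  "adapted_process T F X \<longleftrightarrow> (\<forall>t\<in>{0..T}. X t \<in> borel_measurable (F t))"

definition continuous_paths ::
  "'w measure \<Rightarrow> real \<Rightarrow> (real \<Rightarrow> 'w \<Rightarrow> 'e::topological_space) \<Rightarrow> bool" where
  "continuous_paths M T X \<longleftrightarrow> (\<forall>\<omega>\<in>space M. continuous_on {0..T} (\<lambda>t. X t \<omega>))"

text \<open>The law of \<open>W t - W s\<close> is \<open>N(0, (t - s) I)\<close>, given by its density; the second argument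
  of \<open>normal_density\<close> is the standard deviation. Mutual independence of the increments
  over disjoint intervals follows from adaptedness and independence of the past.\<close>

definition brownian_motion ::
  "'w measure \<Rightarrow> real \<Rightarrow> (real \<Rightarrow> 'w measure) \<Rightarrow> (real \<Rightarrow> 'w \<Rightarrow> real^'m) \<Rightarrow> bool" where
  "brownian_motion M T F W \<longleftrightarrow>
     adapted_process T F W \<and> continuous_paths M T W \<and>
     (AE \<omega> in M. W 0 \<omega> = 0) \<and>
     (\<forall>s t. 0 \<le> s \<and> s < t \<and> t \<le> T \<longrightarrow>
        distributed M lborel (\<lambda>\<omega>. W t \<omega> - W s \<omega>)
          (\<lambda>x. ennreal (\<Prod>i\<in>UNIV. normal_density 0 (sqrt (t - s)) (x $ i)))) \<and>
     (\<forall>s t. 0 \<le> s \<and> s \<le> t \<and> t \<le> T \<longrightarrow>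
        prob_space.indep_set M (sets (F s))
          (sets (vimage_algebra (space M) (\<lambda>\<omega>. W t \<omega> - W s \<omega>) borel)))"

definition tendsto_in_prob ::
  "'w measure \<Rightarrow> (nat \<Rightarrow> 'w \<Rightarrow> 'e::metric_space) \<Rightarrow> ('w \<Rightarrow> 'e) \<Rightarrow> bool" where
  "tendsto_in_prob M X Y \<longleftrightarrow>
     (\<forall>\<epsilon>>0. (\<lambda>k. measure M {\<omega>\<in>space M. \<epsilon> \<le> dist (X k \<omega>) (Y \<omega>)}) \<longlonglongrightarrow> 0)"

definition progressive ::
  "real \<Rightarrow> (real \<Rightarrow> 'w measure) \<Rightarrow> (real \<Rightarrow> 'w \<Rightarrow> 'e::topological_space) \<Rightarrow> bool" where
  "progressive T F X \<longleftrightarrow>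
     (\<forall>t\<in>{0..T}. (\<lambda>(s, \<omega>). X s \<omega>) \<in> borel_measurable (restrict_space borel {0..t} \<Otimes>\<^sub>M F t))"

text \<open>The data \<open>n, \<tau>, h\<close> represent the simple process equal to the bounded,
  \<open>F (\<tau> i)\<close>-measurable random matrix \<open>h i\<close> on the interval \<open>(\<tau> i, \<tau> (i + 1)]\<close>, for
  \<open>i < n\<close>, and equal to \<open>0\<close> elsewhere.\<close>

definition simple_process ::
  "'w measure \<Rightarrow> real \<Rightarrow> (real \<Rightarrow> 'w measure) \<Rightarrow> nat \<Rightarrow> (nat \<Rightarrow> real) \<Rightarrow>
   (nat \<Rightarrow> 'w \<Rightarrow> real^'m^'d) \<Rightarrow> bool" where
  "simple_process M T F n \<tau> h \<longleftrightarrow>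
     0 \<le> \<tau> 0 \<and> (\<forall>i<n. \<tau> i \<le> \<tau> (Suc i)) \<and> \<tau> n \<le> T \<and>
     (\<forall>i<n. h i \<in> borel_measurable (F (\<tau> i)) \<and> (\<exists>C. \<forall>\<omega>\<in>space M. norm (h i \<omega>) \<le> C))"

definition simple_value ::
  "nat \<Rightarrow> (nat \<Rightarrow> real) \<Rightarrow> (nat \<Rightarrow> 'w \<Rightarrow> real^'m^'d) \<Rightarrow> real \<Rightarrow> 'w \<Rightarrow> real^'m^'d" where
  "simple_value n \<tau> h s \<omega> = (\<Sum>i<n. indicator {\<tau> i<..\<tau> (Suc i)} s *\<^sub>R h i \<omega>)"

definition simple_integral_dW ::
  "(real \<Rightarrow> 'w \<Rightarrow> real^'m) \<Rightarrow> nat \<Rightarrow> (nat \<Rightarrow> real) \<Rightarrow> (nat \<Rightarrow> 'w \<Rightarrow> real^'m^'d) \<Rightarrow> 'w \<Rightarrow> real^'d" where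
  "simple_integral_dW W n \<tau> h \<omega> = (\<Sum>i<n. h i \<omega> *v (W (\<tau> (Suc i)) \<omega> - W (\<tau> i) \<omega>))"

text \<open>\<open>is_ito_integral M F W t H I\<close> means that the random variable \<open>I\<close> is a version of
  \<open>\<integral>\<^sub>0\<^sup>t H\<^sub>s dW\<^sub>s\<close>. As usual, the integral is defined for progressively measurable integrands with
  almost surely square integrable paths on \<open>[0,t]\<close>, as the limit in probability of the integrals
  of simple processes approximating \<open>H\<close> in \<open>L\<^sup>2([0,t])\<close> in probability; the limit is unique up
  to null sets. The norm on \<open>real^'m^'d\<close> is the Hilbert-Schmidt norm.\<close>

definition is_ito_integral ::
  "'w measure \<Rightarrow> (real \<Rightarrow> 'w measure) \<Rightarrow> (real \<Rightarrow> 'w \<Rightarrow> real^'m) \<Rightarrow> real \<Rightarrow>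
   (real \<Rightarrow> 'w \<Rightarrow> real^'m^'d) \<Rightarrow> ('w \<Rightarrow> real^'d) \<Rightarrow> bool" where
  "is_ito_integral M F W t H I \<longleftrightarrow>
     progressive t F H \<and>
     (AE \<omega> in M. set_integrable lborel {0..t} (\<lambda>s. (norm (H s \<omega>))\<^sup>2)) \<and>
     I \<in> borel_measurable M \<and>
     (\<exists>n \<tau> h.
        (\<forall>k. simple_process M t F (n k) (\<tau> k) (h k)) \<and>
        tendsto_in_prob M
          (\<lambda>k \<omega>. LINT s:{0..t}|lborel. (norm (simple_value (n k) (\<tau> k) (h k) s \<omega> - H s \<omega>))\<^sup>2)
          (\<lambda>\<omega>. 0) \<and>
        tendsto_in_prob M (\<lambda>k. simple_integral_dW W (n k) (\<tau> k) (h k)) I)"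

text \<open>The equation \<open>X\<^sub>t = \<xi> + \<integral>\<^sub>0\<^sup>t \<mu>(X\<^sub>s) ds + \<integral>\<^sub>0\<^sup>t \<sigma>(X\<^sub>s) dW\<^sub>s\<close>, almost surely for each
  \<open>t \<in> [0,T]\<close>; the null set may depend on \<open>t\<close>.\<close>

definition solves_SDE ::
  "'w measure \<Rightarrow> real \<Rightarrow> (real \<Rightarrow> 'w measure) \<Rightarrow> (real \<Rightarrow> 'w \<Rightarrow> real^'m) \<Rightarrow>
   (real^'d \<Rightarrow> real^'d) \<Rightarrow> (real^'d \<Rightarrow> real^'m^'d) \<Rightarrow> ('w \<Rightarrow> real^'d) \<Rightarrow>
   (real \<Rightarrow> 'w \<Rightarrow> real^'d) \<Rightarrow> bool" where
  "solves_SDE M T F W \<mu> \<sigma> \<xi> X \<longleftrightarrow>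
     (\<forall>t\<in>{0..T}. \<exists>I. is_ito_integral M F W t (\<lambda>s \<omega>. \<sigma> (X s \<omega>)) I \<and>
        (AE \<omega> in M. X t \<omega> = \<xi> \<omega> + (LINT s:{0..t}|lborel. \<mu> (X s \<omega>)) + I \<omega>))"

text \<open>The mean squared error \<open>E |Y - v(\<xi>)|\<^sup>2\<close> as an element of \<open>[0,\<infinity>]\<close>.\<close>

definition mean_sq_error ::
  "'w measure \<Rightarrow> ('w \<Rightarrow> real) \<Rightarrow> ('w \<Rightarrow> 'a) \<Rightarrow> ('a \<Rightarrow> real) \<Rightarrow> ennreal" where
  "mean_sq_error M Y \<xi> v = (\<integral>\<^sup>+ \<omega>. ennreal (\<bar>Y \<omega> - v (\<xi> \<omega>)\<bar>\<^sup>2) \<partial>M)"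

end

theory Submission
  imports Defs
begin

text \<open>Since \<open>\<xi>\<close> has full support on the cube, everything follows by orthogonality from the
  Feynman--Kac identity \<open>E[\<phi>(X\<^sub>T) | F\<^sub>0] = u(T, \<xi>)\<close> and \<open>\<phi>(X\<^sub>T) \<in> L\<^sup>2\<close>: the mean squared error of
  \<open>v\<close> is \<open>E |\<phi>(X\<^sub>T) - u(T, \<xi>)|\<^sup>2 + E |u(T, \<xi>) - v(\<xi>)|\<^sup>2\<close>.

  It\^o's formula is replaced by the Euler scheme \<open>Y\<close> on dyadic grids. Its moments are bounded uniformly
  in the step size, and telescoping \<open>E[G u(T - t, Y\<^sub>t)]\<close> along the grid, with the
  Kolmogorov equation killing the first order term of each step, gives
  \<open>E[G \<phi>(Y\<^sub>T)] \<rightarrow> E[G u(T, \<xi>)]\<close> for bounded \<open>F\<^sub>0\<close>-measurable \<open>G\<close>. On the other hand \<open>Y\<^sub>T \<rightarrow> X\<^sub>T\<close> in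
  probability: the stochastic integrals in the equation for \<open>X\<close> are, uniformly over grid points,
  limits of Riemann sums, and Gronwall's argument applies to the error stopped when the accumulated
  Riemann sum defect becomes large. The uniform moment bounds then carry both the square integrability
  and the identity over to \<open>X\<^sub>T\<close>.\<close>

section \<open>Gaussian increments and independence\<close>

text \<open>The definition of the stochastic integral gives, at each fixed time, one random variable
  and one unspecified approximating sequence converging in probability. It comes with no isometry,
  no path in time and no moments of \<open>X\<close>. Estimates on \<open>X\<close> are therefore
  made in probability, and the isometry is replaced by \<open>simple_integral_maximal\<close>, which
  creates square integrability by truncating the integrand. Until the final passage to the limit,
  second moments are taken only of explicit quantities (Brownian increments, Euler scheme) and of
  truncated or frozen ones. The derivatives of \<open>u\<close> are merely continuous with
  polynomial growth, so one Taylor step has no rate. The modulus takes the form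
  \<open>\<epsilon> + C * h\<close>, with the power of the growth factor fixed before \<epsilon>.
  Summed over the grid, the first part contributes a multiple of \<epsilon> and the second vanishes
  with the step size.\<close>

lemma continuous_on_matrix_vector_mult[continuous_intros]:
  fixes f :: "'a::topological_space \<Rightarrow> real^'m^'n"
  assumes "continuous_on S f" "continuous_on S g"
  shows "continuous_on S (\<lambda>x. f x *v g x)"
  unfolding matrix_vector_mult_def
  by (intro continuous_intros assms)

lemma continuous_on_matrix_matrix_mult[continuous_intros]:
  fixes f :: "'a::topological_space \<Rightarrow> real^'m^'n" and g :: "'a \<Rightarrow> real^'k^'m"
  assumes "continuous_on S f" "continuous_on S g"
  shows "continuous_on S (\<lambda>x. f x ** g x)"
  unfolding matrix_matrix_mult_def
  by (intro continuous_intros assms)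

lemma borel_measurable_matrix_vector_mult[measurable (raw)]:
  fixes f :: "'a \<Rightarrow> real^'m^'n"
  assumes "f \<in> borel_measurable M" "g \<in> borel_measurable M"
  shows "(\<lambda>x. f x *v g x) \<in> borel_measurable M"
proof -
  have "continuous_on UNIV (\<lambda>x::(real^'m^'n) \<times> (real^'m). fst x *v snd x)"
    by (intro continuous_intros)
  from borel_measurable_continuous_Pair[OF assms, of "\<lambda>A v. A *v v"] this
  show ?thesis by (simp add: case_prod_beta)
qed

lemma borel_measurable_matrix_matrix_mult[measurable (raw)]:
  fixes f :: "'a \<Rightarrow> real^'m^'n" and g :: "'a \<Rightarrow> real^'k^'m"
  assumes "f \<in> borel_measurable M" "g \<in> borel_measurable M"
  shows "(\<lambda>x. f x ** g x) \<in> borel_measurable M"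
proof -
  have "continuous_on UNIV (\<lambda>x::(real^'m^'n) \<times> (real^'k^'m). fst x ** snd x)"
    by (intro continuous_intros)
  from borel_measurable_continuous_Pair[OF assms, of "\<lambda>A v. A ** v"] this
  show ?thesis by (simp add: case_prod_beta)
qed

lemma borel_measurable_transpose[measurable (raw)]:
  fixes f :: "'a \<Rightarrow> real^'m^'n"
  assumes "f \<in> borel_measurable M"
  shows "(\<lambda>x. transpose (f x)) \<in> borel_measurable M"
proof -
  have "continuous_on UNIV (transpose :: real^'m^'n \<Rightarrow> _)"
    unfolding transpose_def by (intro continuous_intros)
  from measurable_compose[OF assms borel_measurable_continuous_onI[OF this]] show ?thesis .
qed

lemma borel_measurable_vec_nth[measurable (raw)]:
  fixes f :: "'a \<Rightarrow> 'b::real_normed_vector^'n"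
  assumes "f \<in> borel_measurable M"
  shows "(\<lambda>x. f x $ i) \<in> borel_measurable M"
  by (rule measurable_compose[OF assms borel_measurable_continuous_onI]) (intro continuous_intros)

section \<open>Hilbert-Schmidt norms of matrices\<close>

lemma power2_norm_vec: "(norm (x::'a::real_normed_vector^'n))\<^sup>2 = (\<Sum>i\<in>UNIV. (norm (x $ i))\<^sup>2)"
  by (simp add: norm_vec_def L2_set_def sum_nonneg)

text \<open>Cauchy-Schwarz in each row: the norm on matrices is the Hilbert-Schmidt norm, which
  dominates the operator norm.\<close>

lemma norm_matrix_vector_mult_le: "norm (A *v x) \<le> norm (A::real^'m^'n) * norm x"
proof -
  have "(norm (A *v x))\<^sup>2 = (\<Sum>i\<in>UNIV. (A $ i \<bullet> x)\<^sup>2)"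
    by (simp add: power2_norm_vec matrix_vector_mul_component)
  also have "\<dots> \<le> (\<Sum>i\<in>UNIV. (norm (A $ i))\<^sup>2 * (norm x)\<^sup>2)"
  proof (intro sum_mono)
    fix i
    have "\<bar>A $ i \<bullet> x\<bar>\<^sup>2 \<le> (norm (A $ i) * norm x)\<^sup>2"
      by (intro power_mono Cauchy_Schwarz_ineq2) simp
    then show "(A $ i \<bullet> x)\<^sup>2 \<le> (norm (A $ i))\<^sup>2 * (norm x)\<^sup>2"
      by (simp add: power_mult_distrib)
  qed
  also have "\<dots> = (norm A * norm x)\<^sup>2"
    by (simp add: power2_norm_vec[of A] sum_distrib_right power_mult_distrib)
  finally show ?thesis by (rule power2_le_imp_le) simp
qed

lemma abs_nth_le_norm: "\<bar>A $ i $ j\<bar> \<le> norm (A::real^'m^'n)"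
  using component_le_norm_cart[of "A $ i" j] Finite_Cartesian_Product.norm_nth_le[of A i] by linarith

lemma norm_transpose: "norm (transpose A) = norm (A::real^'m^'n)"
proof -
  have "(norm (transpose A))\<^sup>2 = (norm A)\<^sup>2"
    unfolding power2_norm_vec by (simp add: transpose_def, rule sum.swap)
  then show ?thesis by simp
qed

text \<open>The columns of the product are \<open>A\<close> applied to the columns of
  \<open>B\<close>; transposing turns columns into the rows over which the norm is summed.\<close>

lemma norm_matrix_matrix_mult_le: "norm (A ** B) \<le> norm (A::real^'m^'n) * norm (B::real^'k^'m)"
proof -
  have "(norm (A ** B))\<^sup>2 = (norm (transpose (A ** B)))\<^sup>2" by (simp add: norm_transpose)
  also have "\<dots> = (\<Sum>k\<in>UNIV. (norm (A *v column k B))\<^sup>2)"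
    unfolding power2_norm_vec[of "transpose (A ** B)"]
    by (intro sum.cong refl arg_cong[where f="\<lambda>x. (norm x)\<^sup>2"])
       (simp add: vec_eq_iff transpose_def matrix_matrix_mult_def matrix_vector_mult_def column_def)
  also have "\<dots> \<le> (\<Sum>k\<in>UNIV. (norm A)\<^sup>2 * (norm (transpose B $ k))\<^sup>2)"
  proof (intro sum_mono)
    fix k
    have "transpose B $ k = column k B" by (simp add: vec_eq_iff transpose_def column_def)
    then show "(norm (A *v column k B))\<^sup>2 \<le> (norm A)\<^sup>2 * (norm (transpose B $ k))\<^sup>2"
      using power_mono[OF norm_matrix_vector_mult_le[of A "column k B"], of 2] by (simp add: power_mult_distrib)
  qed
  also have "\<dots> = (norm A * norm B)\<^sup>2"
    unfolding sum_distrib_left[symmetric] power2_norm_vec[of "transpose B", symmetric]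
    by (simp add: norm_transpose power_mult_distrib)
  finally show ?thesis by (rule power2_le_imp_le) simp
qed

text \<open>Turns the trace in the mean of a quadratic form of an increment into the squared norm of
  the isometry.\<close>

lemma trace_transpose_mult: "trace (transpose A ** A) = (norm (A::real^'m^'n))\<^sup>2"
proof -
  have "trace (transpose A ** A) = (\<Sum>i\<in>UNIV. \<Sum>k\<in>UNIV. (A $ k $ i)\<^sup>2)"
    by (simp add: trace_def matrix_matrix_mult_def transpose_def power2_eq_square)
  also have "\<dots> = (\<Sum>k\<in>UNIV. \<Sum>i\<in>UNIV. (A $ k $ i)\<^sup>2)" by (rule sum.swap)
  finally show ?thesis by (simp add: power2_norm_vec)
qed

text \<open>\<open>P\<close> and \<open>Q \<circ> w\<close> generate sub-sigma-algebras of the two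
  independent ones. This passes from the set form in \<open>brownian_motion\<close> to random
  variables, whose expectations factor.\<close>

lemma (in prob_space) indep_var_of_indep_set:
  assumes ind: "indep_set (sets N) (sets (vimage_algebra (space M) w borel))"
    and [measurable]: "random_variable borel w"
    and sub: "subalgebra M N"
    and P: "P \<in> N \<rightarrow>\<^sub>M S" and Q: "Q \<in> borel \<rightarrow>\<^sub>M S'"
  shows "indep_var S P S' (\<lambda>x. Q (w x))"
proof -
  have spN: "space N = space M" and sN: "sets N \<subseteq> sets M" using sub by (auto simp: subalgebra_def)
  have PM: "random_variable S P" using measurable_from_subalg[OF sub P] .
  have QM: "random_variable S' (\<lambda>x. Q (w x))" using Q by measurable
  have a: "sigma_sets (space M) {P -` A \<inter> space M |A. A \<in> sets S} \<subseteq> sets N"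
    unfolding spN[symmetric]
    by (rule sets.sigma_sets_subset) (use P in \<open>auto simp: measurable_sets\<close>)
  have wv: "w \<in> vimage_algebra (space M) w borel \<rightarrow>\<^sub>M borel"
    by (rule measurable_vimage_algebra1) auto
  have b: "sigma_sets (space M) {(\<lambda>x. Q (w x)) -` A \<inter> space M |A. A \<in> sets S'}
      \<subseteq> sets (vimage_algebra (space M) w borel)"
    using measurable_sets[OF measurable_compose[OF wv Q]]
      sets.sigma_sets_subset[of "{(\<lambda>x. Q (w x)) -` A \<inter> space M |A. A \<in> sets S'}"
         "vimage_algebra (space M) w borel"]
    by auto
  show ?thesis
    unfolding indep_var_eq indep_set_def
    using PM QM indep_sets_mono_sets[OF ind[unfolded indep_set_def]] a b
    by (auto split: bool.split intro!: indep_sets_mono_sets[OF ind[unfolded indep_set_def]])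
qed

section \<open>Law of Brownian increments and their independence of the past\<close>

locale bm_space = prob_space M for M :: "'w measure" +
  fixes T :: real and F :: "real \<Rightarrow> 'w measure" and W :: "real \<Rightarrow> 'w \<Rightarrow> real^'m"
  assumes T_pos: "0 < T" and filt: "normal_filtration M T F" and bm: "brownian_motion M T F W"
begin

lemma subalg_F: "t \<in> {0..T} \<Longrightarrow> subalgebra M (F t)"
  using filt by (auto simp: normal_filtration_def)

lemma F_mono: "0 \<le> s \<Longrightarrow> s \<le> t \<Longrightarrow> t \<le> T \<Longrightarrow> f \<in> measurable (F s) N \<Longrightarrow> f \<in> measurable (F t) N"
proof (rule measurable_from_subalg)
  assume st: "0 \<le> s" "s \<le> t" "t \<le> T"
  then have "sets (F s) \<subseteq> sets (F t)"
    using filt by (auto simp: normal_filtration_def)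
  moreover have "space (F s) = space (F t)"
    using subalg_F[of s] subalg_F[of t] st by (auto simp: subalgebra_def)
  ultimately show "subalgebra (F t) (F s)" by (auto simp: subalgebra_def)
qed

lemma F_meas_M: "0 \<le> s \<Longrightarrow> s \<le> T \<Longrightarrow> f \<in> measurable (F s) N \<Longrightarrow> f \<in> measurable M N"
  using measurable_from_subalg[OF subalg_F[of s]] by auto

lemma space_F: "0 \<le> s \<Longrightarrow> s \<le> T \<Longrightarrow> space (F s) = space M"
  using subalg_F[of s] by (auto simp: subalgebra_def)

lemma W_adapted: "0 \<le> t \<Longrightarrow> t \<le> T \<Longrightarrow> W t \<in> borel_measurable (F t)"
  using bm by (auto simp: brownian_motion_def adapted_process_def)

lemma W_meas: "0 \<le> t \<Longrightarrow> t \<le> T \<Longrightarrow> W t \<in> borel_measurable M"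
  using W_adapted F_meas_M by blast

lemma indep_increment:
  assumes "0 \<le> s" "s \<le> t" "t \<le> T" "P \<in> F s \<rightarrow>\<^sub>M S" "Q \<in> borel \<rightarrow>\<^sub>M S'"
  shows "indep_var S P S' (\<lambda>\<omega>. Q (W t \<omega> - W s \<omega>))"
proof (rule indep_var_of_indep_set[of "F s"])
  show "indep_set (sets (F s)) (sets (vimage_algebra (space M) (\<lambda>\<omega>. W t \<omega> - W s \<omega>) borel))"
    using bm assms unfolding brownian_motion_def by blast
  have "W t \<in> borel_measurable M" "W s \<in> borel_measurable M" using W_meas assms by auto
  then show "random_variable borel (\<lambda>\<omega>. W t \<omega> - W s \<omega>)" by simp
qed (use assms subalg_F in auto)

text \<open>The only form in which independence of the past is used from here on.\<close>

lemma
  fixes P :: "'w \<Rightarrow> real" and Q :: "real^'m \<Rightarrow> real"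
  assumes st: "0 \<le> s" "s \<le> t" "t \<le> T" and P: "P \<in> borel_measurable (F s)" "integrable M P"
    and Q: "Q \<in> borel_measurable borel" "integrable M (\<lambda>\<omega>. Q (W t \<omega> - W s \<omega>))"
  shows integrable_mult_increment: "integrable M (\<lambda>\<omega>. P \<omega> * Q (W t \<omega> - W s \<omega>))"
    and expectation_mult_increment: "expectation (\<lambda>\<omega>. P \<omega> * Q (W t \<omega> - W s \<omega>)) =
      expectation P * expectation (\<lambda>\<omega>. Q (W t \<omega> - W s \<omega>))"
  using indep_var_integrable[OF indep_increment[OF st P(1) Q(1)] P(2) Q(2)]
    indep_var_lebesgue_integral[OF indep_increment[OF st P(1) Q(1)] P(2) Q(2)] by auto

text \<open>The density is a product and Lebesgue measure factors over coordinates, so Tonelli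
  applies. Both the marginal laws and the independence of distinct coordinates are read off from
  this formula.\<close>

lemma increment_prob:
  assumes st: "0 \<le> s" "s < t" "t \<le> T" and A: "\<And>i. A i \<in> sets (borel::real measure)"
  shows "emeasure M {\<omega>\<in>space M. \<forall>i. (W t \<omega> - W s \<omega>) $ i \<in> A i} =
    (\<Prod>i\<in>UNIV. emeasure (density lborel (\<lambda>x. ennreal (normal_density 0 (sqrt (t - s)) x))) (A i))"
proof -
  define w where "w = (\<lambda>\<omega>. W t \<omega> - W s \<omega>)"
  define n where "n = normal_density 0 (sqrt (t - s))"
  have D: "distributed M lborel w (\<lambda>x. ennreal (\<Prod>i\<in>UNIV. n (x $ i)))"
    using bm st unfolding brownian_motion_def w_def n_def by blast
  have [measurable]: "n \<in> borel_measurable borel" by (simp add: n_def)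
  have n0: "0 \<le> n x" for x by (simp add: n_def)
  note [measurable] = A
  have S[measurable]: "{x::real^'m. \<forall>i. x $ i \<in> A i} \<in> sets borel" by measurable
  \<comment> \<open>The product formula for \<open>lborel\<close> runs over \<open>Basis\<close>, so
    the factors are indexed by basis vectors; \<open>THE\<close> recovers the coordinate from the
    vector.\<close>
  define f where "f b x = ennreal (n x) * indicator (A (THE i. b = (axis i 1::real^'m))) x" for b x
  have the: "(THE j. axis i 1 = (axis j 1::real^'m)) = i" for i by (auto simp: axis_eq_axis)
  have inj: "inj (\<lambda>i. axis i 1 :: real^'m)" by (auto simp: inj_def axis_eq_axis)
  have B: "(Basis :: (real^'m) set) = range (\<lambda>i. axis i 1)" by (auto simp: Basis_vec_def)
  have [measurable]: "f b \<in> borel_measurable borel" for b unfolding f_def by measurable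
  have "emeasure M {\<omega>\<in>space M. \<forall>i. (W t \<omega> - W s \<omega>) $ i \<in> A i} =
      emeasure (distr M lborel w) {x. \<forall>i. x $ i \<in> A i}"
    using distributed_measurable[OF D]
    by (subst emeasure_distr) (auto simp: w_def intro!: arg_cong2[where f=emeasure])
  also have "distr M lborel w = density lborel (\<lambda>x. ennreal (\<Prod>i\<in>UNIV. n (x $ i)))"
    using distributed_distr_eq_density[OF D] .
  also have "emeasure \<dots> {x. \<forall>i. x $ i \<in> A i} =
      (\<integral>\<^sup>+x. ennreal (\<Prod>i\<in>UNIV. n (x $ i)) * indicator {x. \<forall>i. x $ i \<in> A i} x \<partial>lborel)"
    by (subst emeasure_density) auto
  also have "\<dots> = (\<integral>\<^sup>+x. (\<Prod>b\<in>Basis. f b (x \<bullet> b)) \<partial>lborel)"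
  proof (intro nn_integral_cong)
    fix x :: "real^'m"
    have "(\<Prod>b\<in>Basis. f b (x \<bullet> b)) = (\<Prod>i\<in>UNIV. ennreal (n (x $ i)) * indicator (A i) (x $ i))"
      unfolding B by (subst prod.reindex[OF inj]) (simp add: f_def the inner_axis)
    also have "\<dots> = (\<Prod>i\<in>UNIV. ennreal (n (x $ i))) * (\<Prod>i\<in>UNIV. indicator (A i) (x $ i))"
      by (rule prod.distrib)
    also have "(\<Prod>i\<in>UNIV. indicator (A i) (x $ i)) = (indicator {x. \<forall>i. x $ i \<in> A i} x :: ennreal)"
      by (auto simp: indicator_def)
    finally show "ennreal (\<Prod>i\<in>UNIV. n (x $ i)) * indicator {x. \<forall>i. x $ i \<in> A i} x =
        (\<Prod>b\<in>Basis. f b (x \<bullet> b))"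
      by (simp add: prod_ennreal n0)
  qed
  also have "\<dots> = (\<Prod>b\<in>Basis. \<integral>\<^sup>+x. f b x \<partial>lborel)"
    by (rule nn_integral_lborel_prod) auto
  also have "\<dots> = (\<Prod>i\<in>UNIV. \<integral>\<^sup>+x. ennreal (n x) * indicator (A i) x \<partial>lborel)"
    unfolding B by (subst prod.reindex[OF inj]) (simp add: f_def[abs_def] the)
  finally show ?thesis by (simp add: emeasure_density n_def)
qed


text \<open>All coordinates other than \<open>k\<close> are left free, and a free coordinate
  contributes the factor 1.\<close>

lemma increment_component_distr:
  assumes st: "0 \<le> s" "s < t" "t \<le> T"
  shows "distr M borel (\<lambda>\<omega>. (W t \<omega> - W s \<omega>) $ k) =
    density lborel (\<lambda>x. ennreal (normal_density 0 (sqrt (t - s)) x))" (is "_ = ?N")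
proof (rule measure_eqI)
  have [measurable]: "W t \<in> borel_measurable M" "W s \<in> borel_measurable M" using W_meas st by auto
  interpret N: prob_space ?N using st by (intro prob_space_normal_density) auto
  fix A assume "A \<in> sets (distr M borel (\<lambda>\<omega>. (W t \<omega> - W s \<omega>) $ k))"
  then have [measurable]: "A \<in> sets borel" by simp
  define A' where "A' = (\<lambda>i. if i = k then A else UNIV)"
  have "emeasure (distr M borel (\<lambda>\<omega>. (W t \<omega> - W s \<omega>) $ k)) A =
      emeasure M {\<omega>\<in>space M. \<forall>i. (W t \<omega> - W s \<omega>) $ i \<in> A' i}"
    by (subst emeasure_distr) (auto simp: A'_def intro!: arg_cong2[where f=emeasure])
  also have "\<dots> = (\<Prod>i\<in>UNIV. emeasure ?N (A' i))"
    by (rule increment_prob[OF st]) (auto simp: A'_def)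
  also have "\<dots> = (\<Prod>i\<in>UNIV. if i = k then emeasure ?N A else 1)"
    using N.emeasure_space_1 by (intro prod.cong) (auto simp: A'_def)
  also have "\<dots> = emeasure ?N A" by (simp add: prod.delta)
  finally show "emeasure (distr M borel (\<lambda>\<omega>. (W t \<omega> - W s \<omega>) $ k)) A = emeasure ?N A" .
qed simp

lemma increment_component_integral:
  fixes g :: "real \<Rightarrow> real"
  assumes st: "0 \<le> s" "s < t" "t \<le> T" and [measurable]: "g \<in> borel_measurable borel"
    and g: "has_bochner_integral lborel (\<lambda>x. normal_density 0 (sqrt (t - s)) x * g x) I"
  shows "has_bochner_integral M (\<lambda>\<omega>. g ((W t \<omega> - W s \<omega>) $ k)) I"
proof -
  have [measurable]: "W t \<in> borel_measurable M" "W s \<in> borel_measurable M" using W_meas st by auto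
  have "has_bochner_integral (density lborel (\<lambda>x. ennreal (normal_density 0 (sqrt (t - s)) x))) g I"
    by (rule has_bochner_integral_density) (use g in auto)
  then show ?thesis
    unfolding increment_component_distr[OF st, symmetric, of k]
    by (subst (asm) has_bochner_integral_iff)
       (auto simp: has_bochner_integral_iff integrable_distr_eq integral_distr simp del: vector_minus_component)
qed

end

text \<open>The constant is (2k)!/(2^k k!) for \<open>p = 2 * k\<close> and 2^k k! sqrt(2/pi) for
  \<open>p = 2 * k + 1\<close>; only the scaling \<open>\<sigma> ^ p\<close> matters later.\<close>

lemma normal_abs_moment:
  "\<exists>K\<ge>0. \<forall>\<sigma>>0. has_bochner_integral lborel (\<lambda>x. normal_density 0 \<sigma> x * \<bar>x\<bar> ^ p) (K * \<sigma> ^ p)"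
proof (cases "even p")
  case True
  then obtain k where p: "p = 2 * k" by (elim evenE)
  have "has_bochner_integral lborel (\<lambda>x. normal_density 0 \<sigma> x * \<bar>x\<bar> ^ p)
      (fact (2 * k) / (2 ^ k * fact k) * \<sigma> ^ p)" if "\<sigma> > 0" for \<sigma>
  proof -
    have "\<bar>x\<bar> ^ p = x ^ (2 * k)" for x :: real by (simp add: p power_even_abs)
    moreover have "fact (2 * k) / ((2 / \<sigma>\<^sup>2) ^ k * fact k) = fact (2 * k) / (2 ^ k * fact k) * \<sigma> ^ p"
      using that by (simp add: p power_divide power_even_eq power_commuting_commutes power_mult[symmetric] mult.commute)
    ultimately show ?thesis using normal_moment_even[OF that, of 0 k] by simp
  qed
  then show ?thesis by (intro exI[of _ "fact (2 * k) / (2 ^ k * fact k)"]) auto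
next
  case False
  then obtain k where p: "p = 2 * k + 1" by (elim oddE)
  have "has_bochner_integral lborel (\<lambda>x. normal_density 0 \<sigma> x * \<bar>x\<bar> ^ p)
      (2 ^ k * fact k * sqrt (2 / pi) * \<sigma> ^ p)" if "\<sigma> > 0" for \<sigma>
    using normal_moment_abs_odd[OF that, of 0 k] unfolding p by (simp add: mult_ac)
  then show ?thesis by (intro exI[of _ "2 ^ k * fact k * sqrt (2 / pi)"]) auto
qed

text \<open>The coordinate of largest modulus controls the l1 norm, hence the Euclidean norm, up to
  the dimension.\<close>

lemma norm_power_le_sum: "norm (x::real^'n) ^ p \<le> real CARD('n) ^ p * (\<Sum>i\<in>UNIV. \<bar>x $ i\<bar> ^ p)"
proof -
  obtain i where i: "\<And>j. \<bar>x $ j\<bar> \<le> \<bar>x $ i\<bar>"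
  proof -
    have "Max (range (\<lambda>j. \<bar>x $ j\<bar>)) \<in> range (\<lambda>j. \<bar>x $ j\<bar>)" by (intro Max_in) auto
    then obtain i where "Max (range (\<lambda>j. \<bar>x $ j\<bar>)) = \<bar>x $ i\<bar>" by blast
    moreover have "\<bar>x $ j\<bar> \<le> Max (range (\<lambda>j. \<bar>x $ j\<bar>))" for j by (rule Max_ge) auto
    ultimately show ?thesis using that[of i] by simp
  qed
  have "norm x \<le> (\<Sum>j\<in>UNIV. \<bar>x $ j\<bar>)" by (rule norm_le_l1_cart)
  also have "\<dots> \<le> (\<Sum>j\<in>(UNIV::'n set). \<bar>x $ i\<bar>)" by (intro sum_mono i)
  finally have "norm x ^ p \<le> (real CARD('n) * \<bar>x $ i\<bar>) ^ p" by (intro power_mono) auto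
  also have "\<dots> \<le> real CARD('n) ^ p * (\<Sum>i\<in>UNIV. \<bar>x $ i\<bar> ^ p)"
    unfolding power_mult_distrib by (intro mult_left_mono member_le_sum) auto
  finally show ?thesis .
qed

lemma power_add_le: "0 \<le> a \<Longrightarrow> 0 \<le> b \<Longrightarrow> (a + b) ^ r \<le> 2 ^ r * (a ^ r + (b::real) ^ r)"
proof -
  assume ab: "0 \<le> a" "0 \<le> b"
  have "(a + b) ^ r \<le> (2 * max a b) ^ r" using ab by (intro power_mono) auto
  also have "\<dots> = 2 ^ r * max a b ^ r" by (rule power_mult_distrib)
  also have "\<dots> \<le> 2 ^ r * (a ^ r + b ^ r)" using ab by (intro mult_left_mono) (auto simp: max_def)
  finally show ?thesis .
qed

section \<open>Moments of increments and one step of the isometry\<close>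

context bm_space
begin

lemma increment_norm_moment:
  "\<exists>K\<ge>0. \<forall>s t. 0 \<le> s \<and> s \<le> t \<and> t \<le> T \<longrightarrow>
    integrable M (\<lambda>\<omega>. norm (W t \<omega> - W s \<omega>) ^ p) \<and>
    expectation (\<lambda>\<omega>. norm (W t \<omega> - W s \<omega>) ^ p) \<le> K * sqrt (t - s) ^ p"
proof -
  obtain K where K0: "K \<ge> 0" and
    K: "\<And>\<sigma>. \<sigma> > 0 \<Longrightarrow> has_bochner_integral lborel (\<lambda>x. normal_density 0 \<sigma> x * \<bar>x\<bar> ^ p) (K * \<sigma> ^ p)"
    using normal_abs_moment[of p] by blast
  \<comment> \<open>The summand 1 covers \<open>p = 0\<close> with \<open>s = t\<close>, where both
    powers are \<open>0 ^ 0 = 1\<close>.\<close>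
  define K' where "K' = real CARD('m) ^ p * (real CARD('m) * K) + 1"
  have "K' \<ge> 0" using K0 by (simp add: K'_def)
  moreover have "integrable M (\<lambda>\<omega>. norm (W t \<omega> - W s \<omega>) ^ p) \<and>
    expectation (\<lambda>\<omega>. norm (W t \<omega> - W s \<omega>) ^ p) \<le> K' * sqrt (t - s) ^ p"
    if st: "0 \<le> s" "s \<le> t" "t \<le> T" for s t
  proof (cases "s = t")
    case True
    then show ?thesis using \<open>K' \<ge> 0\<close> K0 by (cases "p = 0") (auto simp: prob_space K'_def power_0_left)
  next
    case False
    then have st': "0 \<le> s" "s < t" "t \<le> T" using st by auto
    have [measurable]: "W t \<in> borel_measurable M" "W s \<in> borel_measurable M" using W_meas st by auto
    have hb: "has_bochner_integral M (\<lambda>\<omega>. \<bar>(W t \<omega> - W s \<omega>) $ i\<bar> ^ p) (K * sqrt (t - s) ^ p)" for i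
      by (rule increment_component_integral[OF st' _ K]) (use st' in auto)
    have hs: "has_bochner_integral M
        (\<lambda>\<omega>. real CARD('m) ^ p * (\<Sum>i\<in>UNIV. \<bar>(W t \<omega> - W s \<omega>) $ i\<bar> ^ p))
        (real CARD('m) ^ p * (\<Sum>i\<in>(UNIV::'m set). K * sqrt (t - s) ^ p))"
      by (intro has_bochner_integral_mult_right has_bochner_integral_sum hb)
    have le: "norm (W t \<omega> - W s \<omega>) ^ p \<le>
        real CARD('m) ^ p * (\<Sum>i\<in>UNIV. \<bar>(W t \<omega> - W s \<omega>) $ i\<bar> ^ p)" for \<omega>
      by (rule norm_power_le_sum)
    have int: "integrable M (\<lambda>\<omega>. norm (W t \<omega> - W s \<omega>) ^ p)"
      by (rule Bochner_Integration.integrable_bound[OF integrable.intros[OF hs]])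
         (auto intro!: AE_I2 order_trans[OF le] simp del: vector_minus_component)
    have "expectation (\<lambda>\<omega>. norm (W t \<omega> - W s \<omega>) ^ p) \<le>
        real CARD('m) ^ p * (\<Sum>i\<in>(UNIV::'m set). K * sqrt (t - s) ^ p)"
      unfolding has_bochner_integral_integral_eq[OF hs, symmetric]
      by (intro integral_mono int integrable.intros[OF hs] le)
    also have "\<dots> \<le> K' * sqrt (t - s) ^ p"
      using st by (simp add: K'_def algebra_simps)
    finally show ?thesis using int by simp
  qed
  ultimately show ?thesis by blast
qed

text \<open>In mean, each factor time step plus squared increment is worth one factor
  \<open>t - s\<close>, and a polynomial weight in the increment costs only a constant because
  \<open>t - s \<le> T\<close>. This is the shape of all Taylor remainders below:
  \<open>r = 1\<close> for moments and first order errors, \<open>r = 2\<close> for second order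
  errors.\<close>

lemma increment_poly_moment:
  "\<exists>K\<ge>0. \<forall>s t. 0 \<le> s \<and> s \<le> t \<and> t \<le> T \<longrightarrow>
    integrable M (\<lambda>\<omega>. ((t - s) + (norm (W t \<omega> - W s \<omega>))\<^sup>2) ^ r * (1 + norm (W t \<omega> - W s \<omega>)) ^ q) \<and>
    expectation (\<lambda>\<omega>. ((t - s) + (norm (W t \<omega> - W s \<omega>))\<^sup>2) ^ r * (1 + norm (W t \<omega> - W s \<omega>)) ^ q)
      \<le> K * (t - s) ^ r"
proof -
  define m where "m p s t = expectation (\<lambda>\<omega>. norm (W t \<omega> - W s \<omega>) ^ p)" for p s t
  have "\<forall>p. \<exists>K\<ge>0. \<forall>s t. 0 \<le> s \<and> s \<le> t \<and> t \<le> T \<longrightarrow>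
    integrable M (\<lambda>\<omega>. norm (W t \<omega> - W s \<omega>) ^ p) \<and> m p s t \<le> K * sqrt (t - s) ^ p"
    unfolding m_def using increment_norm_moment by blast
  from choice[OF this] obtain K where "\<forall>p. K p \<ge> 0 \<and> (\<forall>s t. 0 \<le> s \<and> s \<le> t \<and> t \<le> T \<longrightarrow>
    integrable M (\<lambda>\<omega>. norm (W t \<omega> - W s \<omega>) ^ p) \<and> m p s t \<le> K p * sqrt (t - s) ^ p)" by blast
  then have K: "\<And>p. K p \<ge> 0"
    "\<And>p s t. 0 \<le> s \<Longrightarrow> s \<le> t \<Longrightarrow> t \<le> T \<Longrightarrow> integrable M (\<lambda>\<omega>. norm (W t \<omega> - W s \<omega>) ^ p)"
    "\<And>p s t. 0 \<le> s \<Longrightarrow> s \<le> t \<Longrightarrow> t \<le> T \<Longrightarrow> m p s t \<le> K p * sqrt (t - s) ^ p"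
    by simp_all
  \<comment> \<open>The prefactor comes from \<open>power_add_le\<close> applied to both powers. The
    four summands are the products of the expanded terms, each of order \<open>(t - s) ^ r\<close>
    once surplus half powers are bounded by powers of \<open>sqrt T\<close>.\<close>
  define C where "C = 2 ^ r * 2 ^ q * (1 + K q * sqrt T ^ q + K (2 * r) + K (2 * r + q) * sqrt T ^ q)"
  have "C \<ge> 0" using K(1) T_pos by (simp add: C_def)
  moreover have "integrable M (\<lambda>\<omega>. ((t - s) + (norm (W t \<omega> - W s \<omega>))\<^sup>2) ^ r * (1 + norm (W t \<omega> - W s \<omega>)) ^ q) \<and>
    expectation (\<lambda>\<omega>. ((t - s) + (norm (W t \<omega> - W s \<omega>))\<^sup>2) ^ r * (1 + norm (W t \<omega> - W s \<omega>)) ^ q)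
      \<le> C * (t - s) ^ r" if st: "0 \<le> s" "s \<le> t" "t \<le> T" for s t
  proof -
    have [measurable]: "W t \<in> borel_measurable M" "W s \<in> borel_measurable M" using W_meas st by auto
    define n where "n \<omega> = norm (W t \<omega> - W s \<omega>)" for \<omega>
    define D where "D = t - s"
    have [measurable]: "n \<in> borel_measurable M" unfolding n_def by measurable
    have n0: "n \<omega> \<ge> 0" for \<omega> by (simp add: n_def)
    have D: "0 \<le> D" "D \<le> T" using st by (auto simp: D_def)
    have nint: "integrable M (\<lambda>\<omega>. n \<omega> ^ p)" for p using K(2)[OF st] by (simp add: n_def)
    have nm: "expectation (\<lambda>\<omega>. n \<omega> ^ p) \<le> K p * sqrt D ^ p" for p
      using K(3)[OF st] by (simp add: n_def m_def D_def)
    have sq: "sqrt D ^ p \<le> sqrt T ^ p" for p using D by (intro power_mono) auto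
    let ?B = "\<lambda>\<omega>. 2 ^ r * 2 ^ q * (D ^ r + D ^ r * n \<omega> ^ q + n \<omega> ^ (2 * r) + n \<omega> ^ (2 * r + q))"
    have Bint: "integrable M ?B" by (intro integrable_mult_right Bochner_Integration.integrable_add nint) auto
    have le: "(D + (n \<omega>)\<^sup>2) ^ r * (1 + n \<omega>) ^ q \<le> ?B \<omega>" for \<omega>
    proof -
      have "(D + (n \<omega>)\<^sup>2) ^ r * (1 + n \<omega>) ^ q \<le>
          (2 ^ r * (D ^ r + ((n \<omega>)\<^sup>2) ^ r)) * (2 ^ q * (1 ^ q + n \<omega> ^ q))"
        using D n0 by (intro mult_mono power_add_le mult_nonneg_nonneg add_nonneg_nonneg) auto
      also have "\<dots> = ?B \<omega>" by (simp add: power_mult[symmetric] power_add algebra_simps)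
      finally show ?thesis .
    qed
    have int: "integrable M (\<lambda>\<omega>. (D + (n \<omega>)\<^sup>2) ^ r * (1 + n \<omega>) ^ q)"
      by (rule Bochner_Integration.integrable_bound[OF Bint]) (use D n0 le in \<open>auto intro!: AE_I2\<close>)
    have "expectation (\<lambda>\<omega>. (D + (n \<omega>)\<^sup>2) ^ r * (1 + n \<omega>) ^ q) \<le> expectation ?B"
      by (intro integral_mono int Bint le)
    also have "\<dots> = 2 ^ r * 2 ^ q * (D ^ r + D ^ r * expectation (\<lambda>\<omega>. n \<omega> ^ q)
        + expectation (\<lambda>\<omega>. n \<omega> ^ (2 * r)) + expectation (\<lambda>\<omega>. n \<omega> ^ (2 * r + q)))"
      using nint by (simp add: prob_space)
    also have "\<dots> \<le> 2 ^ r * 2 ^ q * (D ^ r + D ^ r * (K q * sqrt T ^ q) + K (2 * r) * D ^ r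
        + D ^ r * (K (2 * r + q) * sqrt T ^ q))"
    proof (intro mult_left_mono add_mono order_refl)
      show "expectation (\<lambda>\<omega>. n \<omega> ^ q) \<le> K q * sqrt T ^ q"
        using order_trans[OF nm mult_left_mono[OF sq K(1)]] .
      show "expectation (\<lambda>\<omega>. n \<omega> ^ (2 * r)) \<le> K (2 * r) * D ^ r"
        using nm[of "2 * r"] D by (simp add: power_mult)
      have "K (2 * r + q) * sqrt D ^ (2 * r + q) = D ^ r * (K (2 * r + q) * sqrt D ^ q)"
        using D by (simp add: power_mult power_add)
      also have "\<dots> \<le> D ^ r * (K (2 * r + q) * sqrt T ^ q)"
        using D K(1) sq by (intro mult_left_mono) auto
      finally show "expectation (\<lambda>\<omega>. n \<omega> ^ (2 * r + q)) \<le> D ^ r * (K (2 * r + q) * sqrt T ^ q)"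
        using nm[of "2 * r + q"] by linarith
    qed (use D in auto)
    also have "\<dots> = C * D ^ r" by (simp add: C_def algebra_simps)
    finally show ?thesis using int by (simp add: n_def D_def)
  qed
  ultimately show ?thesis by blast
qed

lemma increment_mean:
  assumes st: "0 \<le> s" "s \<le> t" "t \<le> T"
  shows "has_bochner_integral M (\<lambda>\<omega>. (W t \<omega> - W s \<omega>) $ k) 0"
proof (cases "s = t")
  case False
  then have st': "0 \<le> s" "s < t" "t \<le> T" using st by auto
  show ?thesis
    using increment_component_integral[OF st', of "\<lambda>x. x" 0 k] normal_moment_nz_1[of "sqrt (t - s)" 0] st'
    by simp
qed (simp add: has_bochner_integral_zero)

text \<open>Off the diagonal, \<open>increment_prob\<close> on rectangles shows that the two
  coordinates are independent, and each has mean zero; on the diagonal this is the variance. Equal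
  times are separate because the law has a density only for \<open>s < t\<close>.\<close>

lemma increment_cov:
  assumes st: "0 \<le> s" "s \<le> t" "t \<le> T"
  shows "has_bochner_integral M (\<lambda>\<omega>. (W t \<omega> - W s \<omega>) $ k * (W t \<omega> - W s \<omega>) $ l)
    (if k = l then t - s else 0)"
proof (cases "s = t")
  case True
  then show ?thesis by (simp add: has_bochner_integral_zero)
next
  case False
  then have st': "0 \<le> s" "s < t" "t \<le> T" using st by auto
  define N where "N = density lborel (\<lambda>x. ennreal (normal_density 0 (sqrt (t - s)) x))"
  show ?thesis
  proof (cases "k = l")
    case True
    have "has_bochner_integral lborel (\<lambda>x. normal_density 0 (sqrt (t - s)) x * x\<^sup>2) (t - s)"
    proof -
      have "sqrt (t - s) > 0" using st' by simp
      note normal_moment_even[OF this, of 0 1]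
      moreover have "fact (2 * 1) / ((2 / (sqrt (t - s))\<^sup>2) ^ 1 * fact 1) = t - s"
        using st' by (simp add: diff_divide_distrib)
      ultimately show ?thesis by (simp only:) simp
    qed
    from increment_component_integral[OF st' _ this, of l] True show ?thesis
      by (simp add: power2_eq_square)
  next
    case False
    have [measurable]: "W t \<in> borel_measurable M" "W s \<in> borel_measurable M" using W_meas st by auto
    interpret N: prob_space N unfolding N_def using st' by (intro prob_space_normal_density) auto
    have dN: "distr M borel (\<lambda>\<omega>. (W t \<omega> - W s \<omega>) $ i) = N" for i
      unfolding N_def by (rule increment_component_distr[OF st'])
    have "indep_var borel (\<lambda>\<omega>. (W t \<omega> - W s \<omega>) $ k) borel (\<lambda>\<omega>. (W t \<omega> - W s \<omega>) $ l)"
      unfolding indep_var_distribution_eq dN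
    proof (intro conjI pair_measure_eqI)
      fix A B assume "A \<in> sets N" "B \<in> sets N"
      then have AB[measurable]: "A \<in> sets borel" "B \<in> sets borel" by (auto simp: N_def)
      define A' where "A' = (\<lambda>i. if i = k then A else if i = l then B else UNIV)"
      have "emeasure (distr M (borel \<Otimes>\<^sub>M borel)
           (\<lambda>x. ((W t x - W s x) $ k, (W t x - W s x) $ l))) (A \<times> B)
         = emeasure M {\<omega>\<in>space M. \<forall>i. (W t \<omega> - W s \<omega>) $ i \<in> A' i}"
        using False
        by (subst emeasure_distr) (auto simp: A'_def intro!: arg_cong2[where f=emeasure])
      also have "\<dots> = (\<Prod>i\<in>UNIV. emeasure N (A' i))"
        unfolding N_def by (rule increment_prob[OF st']) (auto simp: A'_def)
      also have "\<dots> = (\<Prod>i\<in>UNIV. (if i = k then emeasure N A else 1) * (if i = l then emeasure N B else 1))"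
        using N.emeasure_space_1 False by (intro prod.cong) (auto simp: A'_def N_def)
      also have "\<dots> = emeasure N A * emeasure N B" by (simp add: prod.distrib prod.delta)
      finally show "emeasure N A * emeasure N B = emeasure (distr M (borel \<Otimes>\<^sub>M borel)
           (\<lambda>x. ((W t x - W s x) $ k, (W t x - W s x) $ l))) (A \<times> B)" by simp
    qed (auto simp: N_def[symmetric] N.sigma_finite_measure_axioms,
         auto simp: N_def intro!: sets_pair_measure_cong)
    note ind = this
    have "integrable M (\<lambda>\<omega>. (W t \<omega> - W s \<omega>) $ i)" "expectation (\<lambda>\<omega>. (W t \<omega> - W s \<omega>) $ i) = 0" for i
      using increment_mean[OF st, of i] by (auto simp: has_bochner_integral_iff)
    then show ?thesis
      using indep_var_integrable[OF ind] indep_var_lebesgue_integral[OF ind] False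
      by (simp add: has_bochner_integral_iff)
  qed
qed

lemma has_integral_linear_increment:
  fixes p :: "'w \<Rightarrow> real^'m"
  assumes st: "0 \<le> s" "s \<le> t" "t \<le> T" and [measurable]: "p \<in> borel_measurable (F s)"
    and int: "\<And>i. integrable M (\<lambda>\<omega>. p \<omega> $ i)"
  shows "has_bochner_integral M (\<lambda>\<omega>. p \<omega> \<bullet> (W t \<omega> - W s \<omega>)) 0"
proof -
  have "has_bochner_integral M (\<lambda>\<omega>. p \<omega> $ i * (W t \<omega> - W s \<omega>) $ i) 0" for i
    using increment_mean[OF st, of i]
      integrable_mult_increment[OF st, of "\<lambda>\<omega>. p \<omega> $ i" "\<lambda>x. x $ i"]
      expectation_mult_increment[OF st, of "\<lambda>\<omega>. p \<omega> $ i" "\<lambda>x. x $ i"] int[of i]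
    by (simp add: has_bochner_integral_iff del: vector_minus_component)
  from has_bochner_integral_sum[of UNIV, OF this] show ?thesis
    by (simp add: inner_vec_def)
qed

text \<open>The covariance of the increment is \<open>t - s\<close> times the identity, so after
  factoring off the past only the diagonal entries of \<open>A\<close> survive.\<close>

lemma has_integral_quadratic_increment:
  fixes A :: "'w \<Rightarrow> real^'m^'m"
  assumes st: "0 \<le> s" "s \<le> t" "t \<le> T" and [measurable]: "A \<in> borel_measurable (F s)"
    and int: "\<And>i j. integrable M (\<lambda>\<omega>. A \<omega> $ i $ j)"
  shows "has_bochner_integral M (\<lambda>\<omega>. (W t \<omega> - W s \<omega>) \<bullet> (A \<omega> *v (W t \<omega> - W s \<omega>)))
    ((t - s) * expectation (\<lambda>\<omega>. trace (A \<omega>)))"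
proof -
  have *: "has_bochner_integral M (\<lambda>\<omega>. A \<omega> $ i $ j * ((W t \<omega> - W s \<omega>) $ i * (W t \<omega> - W s \<omega>) $ j))
     (expectation (\<lambda>\<omega>. A \<omega> $ i $ j) * (if i = j then t - s else 0))" for i j
    using increment_cov[OF st, of i j]
      integrable_mult_increment[OF st, of "\<lambda>\<omega>. A \<omega> $ i $ j" "\<lambda>x. x $ i * x $ j"]
      expectation_mult_increment[OF st, of "\<lambda>\<omega>. A \<omega> $ i $ j" "\<lambda>x. x $ i * x $ j"] int[of i j]
    by (simp add: has_bochner_integral_iff del: vector_minus_component)
  have "has_bochner_integral M (\<lambda>\<omega>. \<Sum>i\<in>UNIV. \<Sum>j\<in>UNIV.
      A \<omega> $ i $ j * ((W t \<omega> - W s \<omega>) $ i * (W t \<omega> - W s \<omega>) $ j))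
    (\<Sum>i\<in>UNIV. \<Sum>j\<in>UNIV. expectation (\<lambda>\<omega>. A \<omega> $ i $ j) * (if i = j then t - s else 0))"
    by (intro has_bochner_integral_sum *)
  also have "(\<lambda>\<omega>. \<Sum>i\<in>UNIV. \<Sum>j\<in>UNIV. A \<omega> $ i $ j * ((W t \<omega> - W s \<omega>) $ i * (W t \<omega> - W s \<omega>) $ j)) =
    (\<lambda>\<omega>. (W t \<omega> - W s \<omega>) \<bullet> (A \<omega> *v (W t \<omega> - W s \<omega>)))"
    by (simp add: inner_vec_def matrix_vector_mult_def sum_distrib_left mult_ac)
  also have "(\<Sum>i\<in>UNIV. \<Sum>j\<in>UNIV. expectation (\<lambda>\<omega>. A \<omega> $ i $ j) * (if i = j then t - s else 0)) =
     (\<Sum>i\<in>UNIV. (t - s) * expectation (\<lambda>\<omega>. A \<omega> $ i $ i))"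
    by (intro sum.cong refl) (simp add: if_distrib[where f="\<lambda>x. _ * x"] cong: if_cong)
  also have "\<dots> = (t - s) * expectation (\<lambda>\<omega>. trace (A \<omega>))"
    using int by (simp add: trace_def sum_distrib_left)
  finally show ?thesis .
qed

text \<open>One step of the Ito isometry. Expanding the square gives a linear term in the increment,
  with coefficient \<open>p\<close> and mean zero, and a quadratic one whose matrix is the Gram
  matrix of \<open>c\<close>, with trace equal to the squared norm of \<open>c\<close>.\<close>

lemma has_integral_sq_step:
  fixes Z :: "'w \<Rightarrow> real^'d" and c :: "'w \<Rightarrow> real^'m^'d"
  assumes st: "0 \<le> s" "s \<le> t" "t \<le> T"
    and [measurable]: "Z \<in> borel_measurable (F s)" "c \<in> borel_measurable (F s)"
    and Z: "integrable M (\<lambda>\<omega>. (norm (Z \<omega>))\<^sup>2)" and c: "integrable M (\<lambda>\<omega>. (norm (c \<omega>))\<^sup>2)"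
  shows "has_bochner_integral M (\<lambda>\<omega>. (norm (Z \<omega> + c \<omega> *v (W t \<omega> - W s \<omega>)))\<^sup>2)
    (expectation (\<lambda>\<omega>. (norm (Z \<omega>))\<^sup>2) + (t - s) * expectation (\<lambda>\<omega>. (norm (c \<omega>))\<^sup>2))"
proof -
  have mM[measurable]: "Z \<in> borel_measurable M" "c \<in> borel_measurable M"
    by (rule F_meas_M[OF st(1) order_trans[OF st(2,3)]]; fact)+
  define p where "p \<omega> = 2 *\<^sub>R (transpose (c \<omega>) *v Z \<omega>)" for \<omega>
  define A where "A \<omega> = transpose (c \<omega>) ** c \<omega>" for \<omega>
  have sp: "space (F s) = space M" using space_F st by auto
  have [measurable]: "p \<in> borel_measurable (F s)" "A \<in> borel_measurable (F s)"
    "p \<in> borel_measurable M" "A \<in> borel_measurable M"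
    unfolding p_def A_def by measurable
  have "integrable M (\<lambda>\<omega>. (norm (c \<omega>))\<^sup>2 + (norm (Z \<omega>))\<^sup>2)" using Z c by simp
  then have pint: "integrable M (\<lambda>\<omega>. p \<omega> $ i)" for i
  proof (rule Bochner_Integration.integrable_bound, goal_cases)
    case 2
    show ?case
    proof (rule AE_I2)
      fix \<omega>
      have "\<bar>p \<omega> $ i\<bar> \<le> norm (p \<omega>)" by (rule component_le_norm_cart)
      also have "\<dots> \<le> 2 * (norm (c \<omega>) * norm (Z \<omega>))"
        unfolding p_def using norm_matrix_vector_mult_le[of "transpose (c \<omega>)" "Z \<omega>"] by (simp add: norm_transpose)
      also have "\<dots> \<le> (norm (c \<omega>))\<^sup>2 + (norm (Z \<omega>))\<^sup>2"
        using sum_squares_bound[of "norm (c \<omega>)" "norm (Z \<omega>)"] by (simp add: mult_ac)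
      finally show "norm (p \<omega> $ i) \<le> norm ((norm (c \<omega>))\<^sup>2 + (norm (Z \<omega>))\<^sup>2)" by simp
    qed
  qed measurable
  have Aint: "integrable M (\<lambda>\<omega>. A \<omega> $ i $ j)" for i j
    using integrable_mult_right[OF c, of "real CARD('d)"]
  proof (rule Bochner_Integration.integrable_bound, goal_cases)
    case 2
    show ?case
    proof (rule AE_I2)
      fix \<omega>
      have "\<bar>A \<omega> $ i $ j\<bar> \<le> (\<Sum>k\<in>UNIV. \<bar>c \<omega> $ k $ i * c \<omega> $ k $ j\<bar>)"
        unfolding A_def by (simp add: matrix_matrix_mult_def transpose_def)
      also have "\<dots> \<le> (\<Sum>k\<in>(UNIV::'d set). norm (c \<omega>) * norm (c \<omega>))"
        unfolding abs_mult by (intro sum_mono mult_mono abs_nth_le_norm) auto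
      finally show "norm (A \<omega> $ i $ j) \<le> norm (real CARD('d) * (norm (c \<omega>))\<^sup>2)"
        by (simp add: power2_eq_square)
    qed
  qed measurable
  have "has_bochner_integral M
     (\<lambda>\<omega>. (norm (Z \<omega>))\<^sup>2 + p \<omega> \<bullet> (W t \<omega> - W s \<omega>) + (W t \<omega> - W s \<omega>) \<bullet> (A \<omega> *v (W t \<omega> - W s \<omega>)))
     (expectation (\<lambda>\<omega>. (norm (Z \<omega>))\<^sup>2) + 0 + (t - s) * expectation (\<lambda>\<omega>. trace (A \<omega>)))"
    using Z by (intro has_bochner_integral_add has_integral_linear_increment
        has_integral_quadratic_increment st pint Aint) (auto simp: has_bochner_integral_iff)
  also have "(\<lambda>\<omega>. (norm (Z \<omega>))\<^sup>2 + p \<omega> \<bullet> (W t \<omega> - W s \<omega>) + (W t \<omega> - W s \<omega>) \<bullet> (A \<omega> *v (W t \<omega> - W s \<omega>)))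
     = (\<lambda>\<omega>. (norm (Z \<omega> + c \<omega> *v (W t \<omega> - W s \<omega>)))\<^sup>2)"
  proof
    fix \<omega>
    define w where "w = W t \<omega> - W s \<omega>"
    have "w \<bullet> (A \<omega> *v w) = (c \<omega> *v w) \<bullet> (c \<omega> *v w)"
      unfolding A_def matrix_vector_mul_assoc[symmetric]
      by (simp add: dot_lmul_matrix[symmetric]) (rule inner_commute)
    moreover have "p \<omega> \<bullet> w = 2 * (Z \<omega> \<bullet> (c \<omega> *v w))"
      unfolding p_def by (simp add: dot_lmul_matrix[symmetric])
    ultimately show "(norm (Z \<omega>))\<^sup>2 + p \<omega> \<bullet> (W t \<omega> - W s \<omega>) + (W t \<omega> - W s \<omega>) \<bullet> (A \<omega> *v (W t \<omega> - W s \<omega>)) =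
       (norm (Z \<omega> + c \<omega> *v (W t \<omega> - W s \<omega>)))\<^sup>2"
      unfolding w_def[symmetric]
      by (simp add: power2_norm_eq_inner inner_add_left inner_add_right inner_commute)
  qed
  also have "(\<lambda>\<omega>. trace (A \<omega>)) = (\<lambda>\<omega>. (norm (c \<omega>))\<^sup>2)"
    unfolding A_def by (simp add: trace_transpose_mult)
  finally show ?thesis by simp
qed

end

section \<open>A maximal inequality for integrals of step processes\<close>

text \<open>The coefficients \<open>h\<close> are merely adapted. Square integrability is assumed
  where a second moment is taken, and the maximal inequality produces it by truncation.\<close>

locale bm_grid = bm_space M T F W
  for M :: "'w measure" and T :: real and F :: "real \<Rightarrow> 'w measure" and W :: "real \<Rightarrow> 'w \<Rightarrow> real^'m" +
  fixes L :: nat and \<tau> :: "nat \<Rightarrow> real" and h :: "nat \<Rightarrow> 'w \<Rightarrow> real^'m^'d"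
  assumes grid_0: "0 \<le> \<tau> 0" and grid_mono: "\<And>i. i < L \<Longrightarrow> \<tau> i \<le> \<tau> (Suc i)" and grid_T: "\<tau> L \<le> T"
    and h_meas: "\<And>i. i < L \<Longrightarrow> h i \<in> borel_measurable (F (\<tau> i))"
begin

lemma grid_le: "i \<le> j \<Longrightarrow> j \<le> L \<Longrightarrow> \<tau> i \<le> \<tau> j"
proof (induction j rule: dec_induct)
  case (step n)
  then show ?case using grid_mono[of n] by simp
qed simp

lemma grid_ge_0: "i \<le> L \<Longrightarrow> 0 \<le> \<tau> i"
  using grid_le[of 0 i] grid_0 by auto

lemma grid_le_T: "i \<le> L \<Longrightarrow> \<tau> i \<le> T"
  using grid_le[of i L] grid_T by auto

lemma simple_integral_adapted:
  "j \<le> L \<Longrightarrow> simple_integral_dW W j \<tau> h \<in> borel_measurable (F (\<tau> j))"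
proof -
  assume j: "j \<le> L"
  have "(\<lambda>\<omega>. h i \<omega> *v (W (\<tau> (Suc i)) \<omega> - W (\<tau> i) \<omega>)) \<in> borel_measurable (F (\<tau> j))" if "i < j" for i
  proof -
    have i: "i < L" "Suc i \<le> L" "i \<le> L" using that j by auto
    have "h i \<in> borel_measurable (F (\<tau> j))"
      using F_mono[OF grid_ge_0[OF i(3)] grid_le[of i j] grid_le_T[OF j] h_meas[OF i(1)]] that j by auto
    moreover have "W (\<tau> k) \<in> borel_measurable (F (\<tau> j))" if "k \<le> j" for k
      using F_mono[OF grid_ge_0 grid_le grid_le_T W_adapted[OF grid_ge_0 grid_le_T], of k j] that j by auto
    ultimately show ?thesis using that by (auto intro!: borel_measurable_matrix_vector_mult borel_measurable_diff)
  qed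
  then show ?thesis unfolding simple_integral_dW_def by (intro borel_measurable_sum) auto
qed

text \<open>The two conditions force \<open>j = Suc i\<close>. The sum including the term of cell
  \<open>i\<close> is already known when that cell begins, so an integrand can be cut before the sum
  crosses a threshold.\<close>

lemma quadratic_sum_adapted:
  "j \<le> L \<Longrightarrow> i < j \<Longrightarrow> j \<le> Suc i \<Longrightarrow>
    (\<lambda>\<omega>. \<Sum>i<j. (norm (h i \<omega>))\<^sup>2 * (\<tau> (Suc i) - \<tau> i)) \<in> borel_measurable (F (\<tau> i))"
proof -
  assume *: "j \<le> L" "i < j" "j \<le> Suc i"
  have "h k \<in> borel_measurable (F (\<tau> i))" if "k \<in> {..<j}" for k
    using F_mono[OF grid_ge_0 grid_le grid_le_T h_meas, of k i] * that by auto
  then show ?thesis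
    by (intro borel_measurable_sum borel_measurable_times borel_measurable_power) auto
qed

lemma simple_integral_meas: "j \<le> L \<Longrightarrow> simple_integral_dW W j \<tau> h \<in> borel_measurable M"
  by (rule F_meas_M[OF grid_ge_0 grid_le_T simple_integral_adapted])

text \<open>The Ito isometry on a grid: \<open>has_integral_sq_step\<close> with the integral so far
  in the role of \<open>Z\<close>.\<close>

lemma has_integral_sq_simple_integral:
  assumes int: "\<And>i. i < L \<Longrightarrow> integrable M (\<lambda>\<omega>. (norm (h i \<omega>))\<^sup>2)" and j: "j \<le> L"
  shows "has_bochner_integral M (\<lambda>\<omega>. (norm (simple_integral_dW W j \<tau> h \<omega>))\<^sup>2)
     (expectation (\<lambda>\<omega>. \<Sum>i<j. (norm (h i \<omega>))\<^sup>2 * (\<tau> (Suc i) - \<tau> i)))"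
  using j
proof (induction j)
  case 0
  then show ?case by (simp add: simple_integral_dW_def has_bochner_integral_zero)
next
  case (Suc j)
  then have j: "j < L" "j \<le> L" "Suc j \<le> L" by auto
  have IH: "has_bochner_integral M (\<lambda>\<omega>. (norm (simple_integral_dW W j \<tau> h \<omega>))\<^sup>2)
     (expectation (\<lambda>\<omega>. \<Sum>i<j. (norm (h i \<omega>))\<^sup>2 * (\<tau> (Suc i) - \<tau> i)))"
    using Suc by simp
  have "has_bochner_integral M (\<lambda>\<omega>. (norm (simple_integral_dW W j \<tau> h \<omega> + h j \<omega> *v (W (\<tau> (Suc j)) \<omega> - W (\<tau> j) \<omega>)))\<^sup>2)
    (expectation (\<lambda>\<omega>. (norm (simple_integral_dW W j \<tau> h \<omega>))\<^sup>2) + (\<tau> (Suc j) - \<tau> j) * expectation (\<lambda>\<omega>. (norm (h j \<omega>))\<^sup>2))"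
    using integrable.intros[OF IH] int j
    by (intro has_integral_sq_step grid_ge_0 grid_mono grid_le_T simple_integral_adapted h_meas) auto
  moreover have "integrable M (\<lambda>\<omega>. (norm (h i \<omega>))\<^sup>2 * (\<tau> (Suc i) - \<tau> i))" if "i \<le> j" for i
    using int[of i] that j by auto
  then have "expectation (\<lambda>\<omega>. \<Sum>i<Suc j. (norm (h i \<omega>))\<^sup>2 * (\<tau> (Suc i) - \<tau> i)) =
     expectation (\<lambda>\<omega>. (norm (simple_integral_dW W j \<tau> h \<omega>))\<^sup>2) +
     (\<tau> (Suc j) - \<tau> j) * expectation (\<lambda>\<omega>. (norm (h j \<omega>))\<^sup>2)"
    unfolding sum.lessThan_Suc has_bochner_integral_integral_eq[OF IH]
    by (subst Bochner_Integration.integral_add) auto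
  ultimately show ?case
    by (simp add: simple_integral_dW_def)
qed

abbreviation "S j \<omega> \<equiv> simple_integral_dW W j \<tau> h \<omega>"
abbreviation "V j \<omega> \<equiv> \<Sum>i<j. (norm (h i \<omega>))\<^sup>2 * (\<tau> (Suc i) - \<tau> i)"

text \<open>Stopping the integrand both when its quadratic sum would exceed \<open>\<delta>\<close> and once the integral
  has reached \<open>\<epsilon>\<close> makes a maximal inequality out of Chebyshev's inequality at the last grid point.\<close>

lemma simple_integral_maximal:
  assumes \<epsilon>: "0 < \<epsilon>" and \<delta>: "0 \<le> \<delta>"
  shows "prob {\<omega>\<in>space M. \<exists>j\<le>L. \<epsilon> \<le> norm (S j \<omega>)} \<le> \<delta> / \<epsilon>\<^sup>2 + prob {\<omega>\<in>space M. \<delta> < V L \<omega>}"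
proof -
  \<comment> \<open>The sum runs to \<open>Suc i\<close>, so the cut happens before the threshold is
    exceeded. Cells of length zero are discarded: their increment vanishes, and a bound on the
    quadratic sum says nothing about \<open>h i\<close> there.\<close>
  define G where "G i \<omega> \<longleftrightarrow> V (Suc i) \<omega> \<le> \<delta> \<and> (\<forall>j\<in>{..i}. norm (S j \<omega>) < \<epsilon>) \<and> \<tau> i < \<tau> (Suc i)" for i \<omega>
  define g where "g i \<omega> = (if G i \<omega> then h i \<omega> else 0)" for i \<omega>
  have Gm: "Measurable.pred (F (\<tau> i)) (G i)" if i: "i < L" for i
  proof -
    have [measurable]: "simple_integral_dW W j \<tau> h \<in> borel_measurable (F (\<tau> i))" if "j \<in> {..i}" for j
      using F_mono[OF grid_ge_0 grid_le grid_le_T simple_integral_adapted, of j i] i that by auto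
    have [measurable]: "(\<lambda>\<omega>. V (Suc i) \<omega>) \<in> borel_measurable (F (\<tau> i))"
      using quadratic_sum_adapted[of "Suc i" i] i by auto
    show ?thesis unfolding G_def by measurable
  qed
  have gm: "g i \<in> borel_measurable (F (\<tau> i))" if "i < L" for i
    unfolding g_def using Gm[OF that] h_meas[OF that] by measurable
  interpret g: bm_grid M T F W L \<tau> g
    by unfold_locales (use grid_0 grid_mono grid_T gm in auto)
  have hM: "h i \<in> borel_measurable M" if "i < L" for i
    using F_meas_M[OF grid_ge_0 grid_le_T h_meas[OF that]] that by auto
  have VM: "(\<lambda>\<omega>. V L \<omega>) \<in> borel_measurable M"
    using hM by (intro borel_measurable_sum borel_measurable_times borel_measurable_power
        borel_measurable_norm borel_measurable_const) auto
  have gle: "norm (g i \<omega>) \<le> norm (h i \<omega>)" for i \<omega> by (simp add: g_def)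
  have Vle: "g.V j \<omega> \<le> V j \<omega>" if "j \<le> L" for j \<omega>
    using that grid_mono by (intro sum_mono mult_right_mono power_mono gle) auto
  have Vmono: "V i \<omega> \<le> V j \<omega>" if "i \<le> j" "j \<le> L" for i j \<omega>
    using that grid_mono by (intro sum_mono2) auto
  have gV: "g.V j \<omega> \<le> \<delta>" if "j \<le> L" for j \<omega>
    using that
  proof (induction j)
    case (Suc j)
    show ?case
    proof (cases "G j \<omega>")
      case True
      then show ?thesis using Vle[of "Suc j" \<omega>] Suc.prems by (simp add: G_def)
    next
      case False
      then show ?thesis using Suc by (simp add: g_def)
    qed
  qed (use \<delta> in simp)
  \<comment> \<open>Truncation makes the integrand bounded: a single term of the quadratic sum is at
    most \<delta>, and the cell has positive length.\<close>
  have gint: "integrable M (\<lambda>\<omega>. (norm (g i \<omega>))\<^sup>2)" if i: "i < L" for i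
  proof (rule integrable_const_bound[where B="\<delta> / (\<tau> (Suc i) - \<tau> i)"])
    show "AE \<omega> in M. norm ((norm (g i \<omega>))\<^sup>2) \<le> \<delta> / (\<tau> (Suc i) - \<tau> i)"
    proof (rule AE_I2)
      fix \<omega>
      show "norm ((norm (g i \<omega>))\<^sup>2) \<le> \<delta> / (\<tau> (Suc i) - \<tau> i)"
      proof (cases "G i \<omega>")
        case True
        then have pos: "\<tau> i < \<tau> (Suc i)" by (simp add: G_def)
        have "(norm (g i \<omega>))\<^sup>2 * (\<tau> (Suc i) - \<tau> i) \<le> g.V (Suc i) \<omega>"
          using i grid_mono by (intro member_le_sum) auto
        also have "\<dots> \<le> \<delta>" using gV[of "Suc i" \<omega>] i by simp
        finally show ?thesis using pos by (simp add: pos_le_divide_eq)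
      next
        case False
        then show ?thesis using \<delta> grid_mono[OF i] by (simp add: g_def)
      qed
    qed
  qed (use F_meas_M[OF grid_ge_0 grid_le_T gm[OF i]] i in auto)
  have hb: "has_bochner_integral M (\<lambda>\<omega>. (norm (g.S L \<omega>))\<^sup>2) (expectation (\<lambda>\<omega>. g.V L \<omega>))"
    by (rule g.has_integral_sq_simple_integral[OF gint order_refl])
  have Vint: "integrable M (\<lambda>\<omega>. g.V L \<omega>)" using gint by auto
  have "expectation (\<lambda>\<omega>. g.V L \<omega>) \<le> expectation (\<lambda>\<omega>. \<delta>)"
    by (intro integral_mono Vint gV) auto
  then have E: "expectation (\<lambda>\<omega>. (norm (g.S L \<omega>))\<^sup>2) \<le> \<delta>"
    using has_bochner_integral_integral_eq[OF hb] by (simp add: prob_space)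
  note [measurable] = g.simple_integral_meas[OF order_refl] VM
  have "prob {\<omega>\<in>space M. \<exists>j\<le>L. \<epsilon> \<le> norm (S j \<omega>)} \<le>
      prob ({\<omega>\<in>space M. \<epsilon>\<^sup>2 \<le> (norm (g.S L \<omega>))\<^sup>2} \<union> {\<omega>\<in>space M. \<delta> < V L \<omega>})"
  proof (rule finite_measure_mono)
    show "{\<omega>\<in>space M. \<exists>j\<le>L. \<epsilon> \<le> norm (S j \<omega>)} \<subseteq>
      {\<omega>\<in>space M. \<epsilon>\<^sup>2 \<le> (norm (g.S L \<omega>))\<^sup>2} \<union> {\<omega>\<in>space M. \<delta> < V L \<omega>}"
    proof safe
      fix \<omega> j assume \<omega>: "\<omega> \<in> space M" "\<not> \<delta> < V L \<omega>" and j: "j \<le> L" "\<epsilon> \<le> norm (S j \<omega>)"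
      \<comment> \<open>First passage of the norm above \<epsilon>. Before \<open>k\<close> nothing
        has been cut on this path, except cells of length zero, which do not contribute.\<close>
      define k where "k = (LEAST j. \<epsilon> \<le> norm (S j \<omega>))"
      have k: "\<epsilon> \<le> norm (S k \<omega>)" "k \<le> j"
        unfolding k_def using j by (auto intro: LeastI Least_le)
      have less: "norm (S i \<omega>) < \<epsilon>" if "i < k" for i
        using not_less_Least[of i "\<lambda>j. \<epsilon> \<le> norm (S j \<omega>)"] that by (auto simp: k_def)
      have "g.S k \<omega> = S k \<omega>"
        unfolding simple_integral_dW_def
      proof (intro sum.cong refl)
        fix i assume "i \<in> {..<k}"
        then have i: "i < k" "i < L" using k j by auto
        have "V (Suc i) \<omega> \<le> \<delta>" using Vmono[of "Suc i" L \<omega>] i \<omega> by auto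
        then have "G i \<omega> \<or> \<tau> i = \<tau> (Suc i)"
          using less i grid_mono[OF i(2)] by (auto simp: G_def)
        then show "g i \<omega> *v (W (\<tau> (Suc i)) \<omega> - W (\<tau> i) \<omega>) = h i \<omega> *v (W (\<tau> (Suc i)) \<omega> - W (\<tau> i) \<omega>)"
          by (auto simp: g_def)
      qed
      \<comment> \<open>From \<open>k\<close> on the condition \<open>G\<close> fails because of
        index \<open>k\<close> itself, so the truncated integral keeps its large value up to the
        last grid point.\<close>
      moreover have "g.S L \<omega> = g.S k \<omega>"
        unfolding simple_integral_dW_def
      proof (rule sum.mono_neutral_right)
        show "\<forall>i\<in>{..<L} - {..<k}. g i \<omega> *v (W (\<tau> (Suc i)) \<omega> - W (\<tau> i) \<omega>) = 0"
        proof
          fix i assume "i \<in> {..<L} - {..<k}"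
          then have "\<not> G i \<omega>" using k unfolding G_def by (auto simp: not_less intro!: bexI[of _ k])
          then show "g i \<omega> *v (W (\<tau> (Suc i)) \<omega> - W (\<tau> i) \<omega>) = 0" by (simp add: g_def)
        qed
      qed (use k j in auto)
      ultimately have "\<epsilon> \<le> norm (g.S L \<omega>)" using k by simp
      then show "\<epsilon>\<^sup>2 \<le> (norm (g.S L \<omega>))\<^sup>2" using \<epsilon> by (intro power_mono) auto
    qed
  qed measurable
  also have "\<dots> \<le> prob {\<omega>\<in>space M. \<epsilon>\<^sup>2 \<le> (norm (g.S L \<omega>))\<^sup>2} + prob {\<omega>\<in>space M. \<delta> < V L \<omega>}"
    by (rule measure_Un_le) measurable
  also have "prob {\<omega>\<in>space M. \<epsilon>\<^sup>2 \<le> (norm (g.S L \<omega>))\<^sup>2} \<le> expectation (\<lambda>\<omega>. (norm (g.S L \<omega>))\<^sup>2) / \<epsilon>\<^sup>2"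
    by (rule integral_Markov_inequality_measure[OF integrable.intros[OF hb], of "{}"]) (use \<epsilon> in auto)
  also have "\<dots> \<le> \<delta> / \<epsilon>\<^sup>2" using E by (simp add: divide_right_mono)
  finally show ?thesis by simp
qed

end

section \<open>Step processes on different grids\<close>

text \<open>Two step processes on different grids are compared on the union of the grids.\<close>

locale partition =
  fixes A :: "real set" and L :: nat and \<rho> :: "nat \<Rightarrow> real"
  assumes A_eq: "A = \<rho> ` {..L}" and strict: "\<And>i. i < L \<Longrightarrow> \<rho> i < \<rho> (Suc i)"
begin

lemma le: "i \<le> j \<Longrightarrow> j \<le> L \<Longrightarrow> \<rho> i \<le> \<rho> j"
proof (induction j rule: dec_induct)
  case (step n)
  then show ?case using strict[of n] by simp
qed simp

text \<open>Two interval endpoints in \<open>A\<close> therefore either enclose a cell or miss it,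
  which makes step processes on coarser grids constant on the cells.\<close>

lemma gap: "a \<in> A \<Longrightarrow> i < L \<Longrightarrow> a \<le> \<rho> i \<or> \<rho> (Suc i) \<le> a"
proof -
  assume "a \<in> A" and i: "i < L"
  then obtain k where k: "k \<le> L" "a = \<rho> k" unfolding A_eq by auto
  show ?thesis using le[of k i] le[of "Suc i" k] i k by (cases "k \<le> i") auto
qed

lemma indicator_const:
  assumes "a \<in> A" "b \<in> A" "i < L" "s \<in> {\<rho> i<..\<rho> (Suc i)}"
  shows "indicator {a<..b} s = (if a \<le> \<rho> i \<and> \<rho> (Suc i) \<le> b then 1 else (0::real))"
  using gap[OF assms(1,3)] gap[OF assms(2,3)] assms(4) by (auto simp: indicator_def)

lemma telescope:
  fixes f :: "real \<Rightarrow> 'b::real_vector"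
  assumes ab: "a \<in> A" "b \<in> A" "a \<le> b"
  shows "(\<Sum>i<L. indicator {a<..b} (\<rho> (Suc i)) *\<^sub>R (f (\<rho> (Suc i)) - f (\<rho> i))) = f b - f a"
proof -
  \<comment> \<open>\<open>f\<close> continued constantly outside \<open>{a..b}\<close>: cells
    outside the interval then contribute zero and the whole sum telescopes.\<close>
  define c where "c x = f (max a (min b x))" for x
  have "(\<Sum>i<L. indicator {a<..b} (\<rho> (Suc i)) *\<^sub>R (f (\<rho> (Suc i)) - f (\<rho> i))) =
      (\<Sum>i<L. c (\<rho> (Suc i)) - c (\<rho> i))"
  proof (intro sum.cong refl)
    fix i assume "i \<in> {..<L}"
    then have i: "i < L" by simp
    show "indicator {a<..b} (\<rho> (Suc i)) *\<^sub>R (f (\<rho> (Suc i)) - f (\<rho> i)) = c (\<rho> (Suc i)) - c (\<rho> i)"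
      using gap[OF ab(1) i] gap[OF ab(2) i] strict[OF i] ab(3)
      by (auto simp: indicator_def c_def max_def min_def not_le)
  qed
  also have "\<dots> = c (\<rho> L) - c (\<rho> 0)" by (rule sum_lessThan_telescope)
  also have "\<dots> = f b - f a"
  proof -
    have "\<rho> 0 \<le> a" "b \<le> \<rho> L" using ab le unfolding A_eq by auto
    then show ?thesis using ab(3) by (cases "a = b") (auto simp: c_def max_def min_def)
  qed
  finally show ?thesis .
qed

lemma cell_ex:
  assumes "\<rho> 0 < s" "s \<le> \<rho> L"
  shows "\<exists>i<L. s \<in> {\<rho> i<..\<rho> (Suc i)}"
proof -
  define j where "j = (LEAST j. s \<le> \<rho> j)"
  have j: "s \<le> \<rho> j" "j \<le> L"
    unfolding j_def using assms(2) by (auto intro: LeastI Least_le)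
  then have "j \<noteq> 0" using assms(1) by (metis not_less)
  then obtain i where i: "j = Suc i" by (cases j) auto
  then have "\<not> s \<le> \<rho> i" using not_less_Least[of i "\<lambda>j. s \<le> \<rho> j"] by (simp add: j_def)
  then show ?thesis using i j by (intro exI[of _ i]) auto
qed

lemma sum_cells:
  assumes "i < L" "s \<in> {\<rho> i<..\<rho> (Suc i)}"
  shows "(\<Sum>j<L. indicator {\<rho> j<..\<rho> (Suc j)} s * c j) = (c i :: real)"
proof -
  have "indicator {\<rho> j<..\<rho> (Suc j)} s = (if j = i then 1 else (0::real))" if "j < L" for j
  proof (rule linorder_cases[of j i])
    assume "j < i" then show ?thesis using le[of "Suc j" i] assms by (auto simp: indicator_def)
  next
    assume "i < j" then show ?thesis using le[of "Suc i" j] assms that by (auto simp: indicator_def)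
  qed (use assms in auto)
  then have "(\<Sum>j<L. indicator {\<rho> j<..\<rho> (Suc j)} s * c j) = (\<Sum>j<L. if j = i then c j else 0)"
    by (intro sum.cong) auto
  then show ?thesis using assms by (simp add: sum.delta)
qed

text \<open>The value is sampled at the right endpoint because cells are open on the left and closed
  on the right.\<close>

lemma integral_step:
  fixes f :: "real \<Rightarrow> real"
  assumes const: "\<And>i s. i < L \<Longrightarrow> s \<in> {\<rho> i<..\<rho> (Suc i)} \<Longrightarrow> f s = f (\<rho> (Suc i))"
    and out: "\<And>s. s \<notin> {\<rho> 0<..\<rho> L} \<Longrightarrow> f s = 0" and sub: "0 \<le> \<rho> 0" "\<rho> L \<le> t"
  shows "(LINT s:{0..t}|lborel. f s) = (\<Sum>i<L. f (\<rho> (Suc i)) * (\<rho> (Suc i) - \<rho> i))"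
proof -
  have "indicator {0..t} s *\<^sub>R f s = (\<Sum>i<L. indicator {\<rho> i<..\<rho> (Suc i)} s * f (\<rho> (Suc i)))" for s
  proof (cases "s \<in> {\<rho> 0<..\<rho> L}")
    case True
    then obtain i where i: "i < L" "s \<in> {\<rho> i<..\<rho> (Suc i)}" using cell_ex by auto
    have "s \<in> {0..t}" using True sub by auto
    then show ?thesis using sum_cells[OF i, of "\<lambda>i. f (\<rho> (Suc i))"] const[OF i] by simp
  next
    case False
    have "indicator {\<rho> i<..\<rho> (Suc i)} s = (0::real)" if "i < L" for i
      using False le[of 0 i] le[of "Suc i" L] that by (auto simp: indicator_def)
    then show ?thesis using out[OF False] by simp
  qed
  then have "(LINT s:{0..t}|lborel. f s) =
      (LINT s|lborel. (\<Sum>i<L. indicator {\<rho> i<..\<rho> (Suc i)} s * f (\<rho> (Suc i))))"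
    unfolding set_lebesgue_integral_def by simp
  also have "\<dots> = (\<Sum>i<L. LINT s|lborel. indicator {\<rho> i<..\<rho> (Suc i)} s * f (\<rho> (Suc i)))"
    using strict by (intro Bochner_Integration.integral_sum integrable_mult_left integrable_real_indicator)
      (auto simp: less_imp_le)
  also have "\<dots> = (\<Sum>i<L. f (\<rho> (Suc i)) * (\<rho> (Suc i) - \<rho> i))"
    using strict by (intro sum.cong refl) (auto simp: mult.commute less_imp_le)
  finally show ?thesis .
qed

end

lemma partition_ex:
  fixes A :: "real set"
  assumes "finite A" "A \<noteq> {}"
  shows "\<exists>L \<rho>. partition A L \<rho>"
proof -
  define xs where "xs = sorted_list_of_set A"
  have xs: "set xs = A" "sorted_wrt (<) xs" using assms by (auto simp: xs_def)
  have ne: "xs \<noteq> []" using xs assms by auto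
  have "partition A (length xs - 1) (\<lambda>i. xs ! i)"
  proof
    have "length xs = Suc (length xs - 1)" using ne by simp
    then have "j \<le> length xs - 1 \<longleftrightarrow> j < length xs" for j by linarith
    then have "{..length xs - 1} = {..<length xs}" unfolding atMost_def lessThan_def by simp
    moreover have "A = {xs ! j |j. j < length xs}" unfolding xs(1)[symmetric] by (rule set_conv_nth)
    ultimately show "A = (!) xs ` {..length xs - 1}"
      unfolding image_def by blast
    show "xs ! i < xs ! Suc i" if "i < length xs - 1" for i
      using xs(2) that by (intro sorted_wrt_nth_less[of "(<)"]) auto
  qed
  then show ?thesis by blast
qed

section \<open>Step integrals compared on a common refinement\<close>

context bm_space
begin

text \<open>\<open>simple_process\<close> with the boundedness dropped, so that Riemann sums of
  unbounded continuous integrands are included.\<close>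

definition step_process :: "real \<Rightarrow> nat \<Rightarrow> (nat \<Rightarrow> real) \<Rightarrow> (nat \<Rightarrow> 'w \<Rightarrow> real^'m^'d) \<Rightarrow> bool" where
  "step_process t n \<tau> h \<longleftrightarrow> 0 \<le> \<tau> 0 \<and> (\<forall>i<n. \<tau> i \<le> \<tau> (Suc i)) \<and> \<tau> n \<le> t \<and>
     (\<forall>i<n. h i \<in> borel_measurable (F (\<tau> i)))"

lemma simple_process_step: "simple_process M t F n \<tau> h \<Longrightarrow> step_process t n \<tau> h"
  unfolding simple_process_def step_process_def by blast

lemma step_process_le:
  assumes "step_process t n \<tau> h" "i \<le> j" "j \<le> n"
  shows "\<tau> i \<le> \<tau> j"
  using assms(2,3)
proof (induction j rule: dec_induct)
  case (step k)
  then have "k < n" "\<tau> i \<le> \<tau> k" by auto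
  then show ?case using assms(1) unfolding step_process_def by (meson order_trans)
qed simp

lemma step_process_range:
  assumes "step_process t n \<tau> h" "i \<le> n"
  shows "0 \<le> \<tau> i" "\<tau> i \<le> t"
  using step_process_le[OF assms(1), of 0 i] step_process_le[OF assms(1), of i n] assms
  unfolding step_process_def by auto

lemma step_process_meas:
  assumes "step_process t n \<tau> h" "t \<le> T" "i < n"
  shows "h i \<in> borel_measurable M"
proof (rule F_meas_M)
  show "0 \<le> \<tau> i" "\<tau> i \<le> T" using step_process_range[OF assms(1), of i] assms(2,3) by auto
  show "h i \<in> borel_measurable (F (\<tau> i))" using assms(1,3) unfolding step_process_def by blast
qed

lemma simple_value_refine:
  assumes p: "partition A L \<rho>" and h: "step_process t n \<tau> h" and sub: "\<tau> ` {..n} \<subseteq> A"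
    and i: "i < L" and s: "s \<in> {\<rho> i<..\<rho> (Suc i)}"
  shows "simple_value n \<tau> h s \<omega> =
    (\<Sum>k<n. (if \<tau> k \<le> \<rho> i \<and> \<rho> (Suc i) \<le> \<tau> (Suc k) then 1 else 0) *\<^sub>R h k \<omega>)"
  unfolding simple_value_def
  by (intro sum.cong refl, subst partition.indicator_const[OF p _ _ i s]) (use sub in auto)

text \<open>On the cell starting at \<open>\<rho> i\<close> only those \<open>h k\<close> with
  \<open>\<tau> k \<le> \<rho> i\<close> have a nonzero coefficient, so nothing beyond the start of
  the cell is used.\<close>

lemma simple_value_refine_meas:
  assumes p: "partition A L \<rho>" and h: "step_process t n \<tau> h" and sub: "\<tau> ` {..n} \<subseteq> A"
    and i: "i < L" and A: "A \<subseteq> {0..t}" and t: "t \<le> T"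
  shows "simple_value n \<tau> h (\<rho> (Suc i)) \<in> borel_measurable (F (\<rho> i))"
proof -
  have s: "\<rho> (Suc i) \<in> {\<rho> i<..\<rho> (Suc i)}" using partition.strict[OF p i] by simp
  have "\<rho> i \<in> A" using partition.A_eq[OF p] i by auto
  then have \<rho>: "\<rho> i \<le> T" using A t by auto
  have "(\<lambda>\<omega>. (if \<tau> k \<le> \<rho> i \<and> \<rho> (Suc i) \<le> \<tau> (Suc k) then 1 else 0) *\<^sub>R h k \<omega>) \<in> borel_measurable (F (\<rho> i))"
    if "k < n" for k
  proof (cases "\<tau> k \<le> \<rho> i")
    case True
    have "h k \<in> borel_measurable (F (\<tau> k))" "0 \<le> \<tau> k"
      using h that step_process_range(1)[OF h, of k] unfolding step_process_def by auto
    then have "h k \<in> borel_measurable (F (\<rho> i))"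
      by (intro F_mono[OF _ True \<rho>])
    then show ?thesis by (intro borel_measurable_scaleR borel_measurable_const)
  next
    case False
    then have "(\<lambda>\<omega>. (if \<tau> k \<le> \<rho> i \<and> \<rho> (Suc i) \<le> \<tau> (Suc k) then 1 else 0) *\<^sub>R h k \<omega>) = (\<lambda>_. 0)"
      by simp
    then show ?thesis by (simp only: borel_measurable_const)
  qed
  note * = this
  have "(\<lambda>\<omega>. \<Sum>k<n. (if \<tau> k \<le> \<rho> i \<and> \<rho> (Suc i) \<le> \<tau> (Suc k) then 1 else 0) *\<^sub>R h k \<omega>)
      \<in> borel_measurable (F (\<rho> i))"
    by (rule borel_measurable_sum) (rule *[OF iffD1[OF lessThan_iff]])
  moreover have "simple_value n \<tau> h (\<rho> (Suc i)) =
      (\<lambda>\<omega>. \<Sum>k<n. (if \<tau> k \<le> \<rho> i \<and> \<rho> (Suc i) \<le> \<tau> (Suc k) then 1 else 0) *\<^sub>R h k \<omega>)"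
    by (rule ext) (rule simple_value_refine[OF p h sub i s])
  ultimately show ?thesis by (simp only:)
qed

text \<open>Each coarse increment of \<open>W\<close> telescopes into fine ones; exchanging the two
  sums collects the coefficients cell by cell.\<close>

lemma simple_integral_refine:
  assumes p: "partition A L \<rho>" and h: "step_process t n \<tau> h" and sub: "\<tau> ` {..n} \<subseteq> A"
  shows "simple_integral_dW W n \<tau> h \<omega> =
    simple_integral_dW W L \<rho> (\<lambda>i. simple_value n \<tau> h (\<rho> (Suc i))) \<omega>"
proof -
  have "h k \<omega> *v (W (\<tau> (Suc k)) \<omega> - W (\<tau> k) \<omega>) =
    (\<Sum>i<L. (indicator {\<tau> k<..\<tau> (Suc k)} (\<rho> (Suc i)) *\<^sub>R h k \<omega>) *v (W (\<rho> (Suc i)) \<omega> - W (\<rho> i) \<omega>))"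
    if k: "k < n" for k
  proof -
    have "W (\<tau> (Suc k)) \<omega> - W (\<tau> k) \<omega> =
      (\<Sum>i<L. indicator {\<tau> k<..\<tau> (Suc k)} (\<rho> (Suc i)) *\<^sub>R (W (\<rho> (Suc i)) \<omega> - W (\<rho> i) \<omega>))"
      using sub k h unfolding step_process_def
      by (intro partition.telescope[OF p, of _ _ "\<lambda>s. W s \<omega>", symmetric]) auto
    then show ?thesis
      by (simp add: matrix_vector_mult_scaleR scaleR_matrix_vector_assoc[symmetric]
          linear_sum[OF matrix_vector_mul_linear] del: sum.lessThan_Suc)
  qed
  then have "simple_integral_dW W n \<tau> h \<omega> = (\<Sum>k<n. \<Sum>i<L.
     (indicator {\<tau> k<..\<tau> (Suc k)} (\<rho> (Suc i)) *\<^sub>R h k \<omega>) *v (W (\<rho> (Suc i)) \<omega> - W (\<rho> i) \<omega>))"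
    unfolding simple_integral_dW_def by (intro sum.cong) auto
  also have "\<dots> = (\<Sum>i<L. \<Sum>k<n.
     (indicator {\<tau> k<..\<tau> (Suc k)} (\<rho> (Suc i)) *\<^sub>R h k \<omega>) *v (W (\<rho> (Suc i)) \<omega> - W (\<rho> i) \<omega>))"
    by (rule sum.swap)
  also have "\<dots> = simple_integral_dW W L \<rho> (\<lambda>i. simple_value n \<tau> h (\<rho> (Suc i))) \<omega>"
  proof -
    have *: "(\<Sum>k<n. B k) *v x = (\<Sum>k<n. B k *v x)" for B :: "nat \<Rightarrow> real^'m^'d" and x
      by (induction n) (auto simp: matrix_vector_mult_add_rdistrib)
    show ?thesis unfolding simple_integral_dW_def simple_value_def * ..
  qed
  finally show ?thesis .
qed

lemma simple_value_outside:
  assumes "step_process t n \<tau> h" "s \<notin> {\<tau> 0<..\<tau> n}"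
  shows "simple_value n \<tau> h s \<omega> = 0"
proof -
  have "indicator {\<tau> k<..\<tau> (Suc k)} s = (0::real)" if "k < n" for k
    using step_process_le[OF assms(1), of 0 k] step_process_le[OF assms(1), of "Suc k" n] that assms(2)
    by (auto simp: indicator_def)
  then show ?thesis unfolding simple_value_def by simp
qed

text \<open>On the union of both grids the difference is a single step integral whose quadratic sum
  is the integrated squared distance, and \<open>simple_integral_maximal\<close> applies. This plays
  the part of the isometry for processes without moments.\<close>

lemma simple_integral_compare:
  assumes t: "t \<le> T" and h: "step_process t n1 \<tau>1 h1" "step_process t n2 \<tau>2 h2"
    and \<epsilon>: "0 < \<epsilon>" and \<delta>: "0 \<le> \<delta>"
  shows "prob {\<omega>\<in>space M. \<epsilon> \<le> norm (simple_integral_dW W n1 \<tau>1 h1 \<omega> - simple_integral_dW W n2 \<tau>2 h2 \<omega>)}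
    \<le> \<delta> / \<epsilon>\<^sup>2 + prob {\<omega>\<in>space M. \<delta> <
        (LINT s:{0..t}|lborel. (norm (simple_value n1 \<tau>1 h1 s \<omega> - simple_value n2 \<tau>2 h2 s \<omega>))\<^sup>2)}"
proof -
  define A where "A = \<tau>1 ` {..n1} \<union> \<tau>2 ` {..n2}"
  have sub: "\<tau>1 ` {..n1} \<subseteq> A" "\<tau>2 ` {..n2} \<subseteq> A" by (auto simp: A_def)
  have A: "finite A" "A \<noteq> {}" "A \<subseteq> {0..t}"
    unfolding A_def using step_process_range[OF h(1)] step_process_range[OF h(2)] by auto
  obtain L \<rho> where p: "partition A L \<rho>" using partition_ex[OF A(1,2)] by blast
  have \<rho>: "0 \<le> \<rho> 0" "\<rho> L \<le> t" using A(3) partition.A_eq[OF p] by auto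
  define g1 where "g1 i = simple_value n1 \<tau>1 h1 (\<rho> (Suc i))" for i
  define g2 where "g2 i = simple_value n2 \<tau>2 h2 (\<rho> (Suc i))" for i
  interpret g: bm_grid M T F W L \<rho> "\<lambda>i \<omega>. g1 i \<omega> - g2 i \<omega>"
  proof unfold_locales
    show "(\<lambda>\<omega>. g1 i \<omega> - g2 i \<omega>) \<in> borel_measurable (F (\<rho> i))" if "i < L" for i
      unfolding g1_def g2_def using that
      by (intro borel_measurable_diff simple_value_refine_meas[OF p h(1) sub(1) _ A(3) t]
          simple_value_refine_meas[OF p h(2) sub(2) _ A(3) t])
  qed (use \<rho> t partition.strict[OF p] in \<open>auto intro: less_imp_le\<close>)
  have S: "g.S L \<omega> = simple_integral_dW W n1 \<tau>1 h1 \<omega> - simple_integral_dW W n2 \<tau>2 h2 \<omega>" for \<omega>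
    unfolding simple_integral_refine[OF p h(1) sub(1)] simple_integral_refine[OF p h(2) sub(2)]
    unfolding simple_integral_dW_def g1_def g2_def
    by (simp add: matrix_vector_mult_diff_rdistrib sum_subtractf)
  have V: "(LINT s:{0..t}|lborel. (norm (simple_value n1 \<tau>1 h1 s \<omega> - simple_value n2 \<tau>2 h2 s \<omega>))\<^sup>2)
      = g.V L \<omega>" for \<omega>
    unfolding g1_def g2_def
  proof (rule partition.integral_step[OF p _ _ \<rho>])
    fix i s assume i: "i < L" and s: "s \<in> {\<rho> i<..\<rho> (Suc i)}"
    have s': "\<rho> (Suc i) \<in> {\<rho> i<..\<rho> (Suc i)}" using partition.strict[OF p i] by simp
    show "(norm (simple_value n1 \<tau>1 h1 s \<omega> - simple_value n2 \<tau>2 h2 s \<omega>))\<^sup>2 =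
      (norm (simple_value n1 \<tau>1 h1 (\<rho> (Suc i)) \<omega> - simple_value n2 \<tau>2 h2 (\<rho> (Suc i)) \<omega>))\<^sup>2"
      unfolding simple_value_refine[OF p h(1) sub(1) i s] simple_value_refine[OF p h(2) sub(2) i s]
        simple_value_refine[OF p h(1) sub(1) i s'] simple_value_refine[OF p h(2) sub(2) i s'] ..
  next
    fix s assume s: "s \<notin> {\<rho> 0<..\<rho> L}"
    have "\<rho> 0 \<le> a" "a \<le> \<rho> L" if "a \<in> A" for a
      using that partition.le[OF p] unfolding partition.A_eq[OF p] by auto
    then have "\<rho> 0 \<le> \<tau>1 0" "\<tau>1 n1 \<le> \<rho> L" "\<rho> 0 \<le> \<tau>2 0" "\<tau>2 n2 \<le> \<rho> L"
      unfolding A_def by auto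
    then have "s \<notin> {\<tau>1 0<..\<tau>1 n1}" "s \<notin> {\<tau>2 0<..\<tau>2 n2}" using s by auto
    then show "(norm (simple_value n1 \<tau>1 h1 s \<omega> - simple_value n2 \<tau>2 h2 s \<omega>))\<^sup>2 = 0"
      using simple_value_outside[OF h(1)] simple_value_outside[OF h(2)] by simp
  qed
  have "g.S L \<in> borel_measurable M" using g.simple_integral_meas[OF order_refl] .
  then have "prob {\<omega>\<in>space M. \<epsilon> \<le> norm (g.S L \<omega>)} \<le> prob {\<omega>\<in>space M. \<exists>j\<le>L. \<epsilon> \<le> norm (g.S j \<omega>)}"
  proof (intro finite_measure_mono)
    have "g.S j \<in> borel_measurable M" if "j \<le> L" for j using g.simple_integral_meas[OF that] .
    then have "{\<omega>\<in>space M. \<epsilon> \<le> norm (g.S j \<omega>)} \<in> events" if "j \<le> L" for j using that by simp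
    then have "(\<Union>j\<in>{..L}. {\<omega>\<in>space M. \<epsilon> \<le> norm (g.S j \<omega>)}) \<in> events" by auto
    also have "(\<Union>j\<in>{..L}. {\<omega>\<in>space M. \<epsilon> \<le> norm (g.S j \<omega>)}) = {\<omega>\<in>space M. \<exists>j\<le>L. \<epsilon> \<le> norm (g.S j \<omega>)}" by auto
    finally show "{\<omega>\<in>space M. \<exists>j\<le>L. \<epsilon> \<le> norm (g.S j \<omega>)} \<in> events" .
  qed auto
  also have "\<dots> \<le> \<delta> / \<epsilon>\<^sup>2 + prob {\<omega>\<in>space M. \<delta> < g.V L \<omega>}"
    by (rule g.simple_integral_maximal[OF \<epsilon> \<delta>])
  finally show ?thesis unfolding S V .
qed

end

section \<open>Riemann sums approximate the stochastic integral\<close>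

text \<open>Dominated convergence for the indicators. It turns pathwise statements, where the
  threshold index depends on \<open>\<omega>\<close>, into convergence of probabilities.\<close>

lemma (in prob_space) prob_tendsto_0_AE:
  assumes E: "\<And>n. E n \<in> events" and ev: "AE \<omega> in M. \<forall>\<^sub>F n in sequentially. \<omega> \<notin> E n"
  shows "(\<lambda>n. prob (E n)) \<longlonglongrightarrow> 0"
proof -
  have "(\<lambda>n. LINT \<omega>|M. indicator (E n) \<omega>) \<longlonglongrightarrow> (LINT \<omega>|M. (0::real))"
  proof (rule integral_dominated_convergence[where w="\<lambda>_. 1"])
    show "AE \<omega> in M. (\<lambda>n. indicator (E n) \<omega>) \<longlonglongrightarrow> (0::real)"
      using ev
    proof (eventually_elim)
      case (elim \<omega>)
      then show "(\<lambda>n. indicator (E n) \<omega>) \<longlonglongrightarrow> (0::real)"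
        by (intro tendsto_eventually) (auto elim!: eventually_mono)
    qed
  qed (use E in auto)
  then show ?thesis using E by simp
qed

lemma (in prob_space) prob_tendsto_0:
  assumes "\<And>n. E n \<in> events" "\<And>\<omega>. \<omega> \<in> space M \<Longrightarrow> \<forall>\<^sub>F n in sequentially. \<omega> \<notin> E n"
  shows "(\<lambda>n. prob (E n)) \<longlonglongrightarrow> 0"
  using assms by (intro prob_tendsto_0_AE AE_I2) auto

lemma set_integrable_sq_diff:
  fixes f H :: "real \<Rightarrow> 'e::euclidean_space"
  assumes H: "continuous_on {0..t} H" and [measurable]: "f \<in> borel_measurable borel"
    and C: "\<And>s. norm (f s) \<le> C"
  shows "set_integrable lborel {0..t} (\<lambda>s. (norm (f s - H s))\<^sup>2)"
proof -
  have "bounded (H ` {0..t})" using compact_continuous_image[OF H] compact_imp_bounded by blast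
  then obtain B where "\<forall>y\<in>H ` {0..t}. norm y \<le> B" unfolding bounded_iff by blast
  then have B: "\<And>s. s \<in> {0..t} \<Longrightarrow> norm (H s) \<le> B" by blast
  have [measurable]: "(\<lambda>s. indicator {0..t} s *\<^sub>R H s) \<in> borel_measurable borel"
    by (rule borel_measurable_continuous_on_indicator[OF _ H]) auto
  have eq: "indicator {0..t} s *\<^sub>R (norm (f s - H s))\<^sup>2 =
     (norm (indicator {0..t} s *\<^sub>R f s - indicator {0..t} s *\<^sub>R H s))\<^sup>2" for s
    by (auto simp: indicator_def)
  show ?thesis
    unfolding set_integrable_def eq
  proof (rule integrableI_bounded_set[where A="{0..t}" and B="(C + B)\<^sup>2"])
    show "AE x in lborel. x \<in> {0..t} \<longrightarrow>
        norm ((norm (indicator {0..t} x *\<^sub>R f x - indicator {0..t} x *\<^sub>R H x))\<^sup>2) \<le> (C + B)\<^sup>2"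
    proof (intro AE_I2 impI)
      fix x assume x: "x \<in> {0..t}"
      have "norm (f x - H x) \<le> C + B"
        using norm_triangle_ineq4[of "f x" "H x"] C[of x] B[OF x] by linarith
      then show "norm ((norm (indicator {0..t} x *\<^sub>R f x - indicator {0..t} x *\<^sub>R H x))\<^sup>2) \<le> (C + B)\<^sup>2"
        using x by (simp add: power_mono)
    qed
  qed (auto simp: emeasure_lborel_Icc_eq)
qed

text \<open>The factors 2 are the reason for the thresholds \<open>\<delta> / 4\<close> in
  \<open>riemann_limit\<close>.\<close>

lemma set_integral_sq_diff_le:
  fixes f g H :: "real \<Rightarrow> 'e::euclidean_space"
  assumes H: "continuous_on {0..t} H"
    and f: "f \<in> borel_measurable borel" "\<And>s. norm (f s) \<le> C"
    and g: "g \<in> borel_measurable borel" "\<And>s. norm (g s) \<le> D"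
  shows "(LINT s:{0..t}|lborel. (norm (f s - g s))\<^sup>2) \<le>
    2 * (LINT s:{0..t}|lborel. (norm (f s - H s))\<^sup>2) + 2 * (LINT s:{0..t}|lborel. (norm (g s - H s))\<^sup>2)"
proof -
  note i = set_integrable_sq_diff[OF H f] set_integrable_sq_diff[OF H g]
  have i': "set_integrable lborel {0..t} (\<lambda>s. 2 * (norm (f s - H s))\<^sup>2)"
    "set_integrable lborel {0..t} (\<lambda>s. 2 * (norm (g s - H s))\<^sup>2)"
    using i by (intro set_integrable_mult_right; simp)+
  have *: "(norm (x - y))\<^sup>2 \<le> 2 * (norm (x - z))\<^sup>2 + 2 * (norm (y - z))\<^sup>2" for x y z :: 'e
  proof -
    have "norm (x - y) \<le> norm (x - z) + norm (y - z)"
      using norm_triangle_ineq4[of "x - z" "y - z"] by simp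
    then have "(norm (x - y))\<^sup>2 \<le> (norm (x - z) + norm (y - z))\<^sup>2" by (intro power_mono) auto
    then show ?thesis
      using sum_squares_bound[of "norm (x - z)" "norm (y - z)"] by (simp add: power2_sum)
  qed
  have meas: "(\<lambda>s. indicator {0..t} s *\<^sub>R (norm (f s - g s))\<^sup>2) \<in> borel_measurable lborel"
    using f(1) g(1) by measurable
  have "set_integrable lborel {0..t} (\<lambda>s. (norm (f s - g s))\<^sup>2)"
    using set_integral_add(1)[OF i'] unfolding set_integrable_def
    by (rule Bochner_Integration.integrable_bound[OF _ meas]) (auto simp: indicator_def intro!: AE_I2 * )
  then have "(LINT s:{0..t}|lborel. (norm (f s - g s))\<^sup>2) \<le>
    (LINT s:{0..t}|lborel. 2 * (norm (f s - H s))\<^sup>2 + 2 * (norm (g s - H s))\<^sup>2)"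
    by (rule set_integral_mono[OF _ set_integral_add(1)[OF i']]) (rule * )
  also have "\<dots> = 2 * (LINT s:{0..t}|lborel. (norm (f s - H s))\<^sup>2) + 2 * (LINT s:{0..t}|lborel. (norm (g s - H s))\<^sup>2)"
    using set_integral_add(2)[OF i'] by simp
  finally show ?thesis .
qed

lemma simple_value_bounded: "norm (simple_value n \<tau> h s \<omega>) \<le> (\<Sum>k<n. norm (h k \<omega>))"
  unfolding simple_value_def
  by (rule order_trans[OF norm_sum], rule sum_mono) (simp add: indicator_def)

lemma simple_value_measurable_time: "(\<lambda>s. simple_value n \<tau> h s \<omega>) \<in> borel_measurable borel"
  unfolding simple_value_def by measurable

section \<open>Dyadic grids and Riemann sums\<close>

context bm_space
begin

text \<open>Dyadic points are chosen because the grids are nested: every coarse grid time occurs in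
  each finer grid, as \<open>dy_refine\<close> records.\<close>

definition dy :: "nat \<Rightarrow> nat \<Rightarrow> real" where
  "dy n i = real i * T / 2 ^ n"

lemma dy_nonneg: "0 \<le> dy n i"
  using T_pos by (simp add: dy_def)

lemma dy_0: "dy n 0 = 0"
  by (simp add: dy_def)

lemma dy_last: "dy n (2 ^ n) = T"
  by (simp add: dy_def)

lemma dy_less: "i < j \<Longrightarrow> dy n i < dy n j"
  using T_pos by (simp add: dy_def divide_strict_right_mono)

lemma dy_le: "i \<le> j \<Longrightarrow> dy n i \<le> dy n j"
  using T_pos by (simp add: dy_def divide_right_mono)

lemma dy_le_T: "i \<le> 2 ^ n \<Longrightarrow> dy n i \<le> T"
  using dy_le[of i "2 ^ n" n] by (simp add: dy_last)

lemma dy_Suc: "dy n (Suc i) - dy n i = T / 2 ^ n"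
  by (simp add: dy_def field_simps)

lemma dy_refine: "n \<le> m \<Longrightarrow> dy m (i * 2 ^ (m - n)) = dy n i"
proof -
  assume "n \<le> m"
  then have "(2::real) ^ m = 2 ^ n * 2 ^ (m - n)" by (simp add: power_add[symmetric])
  then show ?thesis by (simp add: dy_def)
qed

lemma dy_partition: "partition (dy n ` {..j}) j (dy n)"
  by unfold_locales (auto simp: dy_less)

definition riemann :: "(real \<Rightarrow> 'w \<Rightarrow> real^'m^'d) \<Rightarrow> nat \<Rightarrow> nat \<Rightarrow> 'w \<Rightarrow> real^'d" where
  "riemann H n j \<omega> = simple_integral_dW W j (dy n) (\<lambda>i. H (dy n i)) \<omega>"

lemma riemann_step_process:
  assumes "adapted_process T F H" "j \<le> 2 ^ n"
  shows "step_process (dy n j) j (dy n) (\<lambda>i. H (dy n i))"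
proof -
  have "H (dy n i) \<in> borel_measurable (F (dy n i))" if "i < j" for i
    using assms(1) dy_nonneg[of n i] dy_le_T[of i n] that assms(2) unfolding adapted_process_def by auto
  then show ?thesis unfolding step_process_def by (simp add: dy_nonneg dy_le)
qed

lemma riemann_value:
  fixes H :: "real \<Rightarrow> 'w \<Rightarrow> real^'m^'d"
  assumes "adapted_process T F H" "j \<le> 2 ^ n" "i < j" "s \<in> {dy n i<..dy n (Suc i)}"
  shows "simple_value j (dy n) (\<lambda>i. H (dy n i)) s \<omega> = H (dy n i) \<omega>"
proof -
  have eq: "(dy n k \<le> dy n i \<and> dy n (Suc i) \<le> dy n (Suc k)) = (k = i)" for k
    using dy_less[of k i n] dy_less[of i k n] dy_less[of "Suc k" "Suc i" n]
    by (cases k i rule: linorder_cases) auto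
  show ?thesis
    unfolding simple_value_refine[OF dy_partition riemann_step_process[OF assms(1,2)] order_refl assms(3,4)] eq
    using assms(3) by (simp add: if_distrib[where f="\<lambda>x. x *\<^sub>R _"] sum.delta cong: if_cong)
qed

text \<open>Uniform continuity of one path on the compact interval. \<open>N\<close> depends on
  \<open>\<omega>\<close>, so only convergence in probability results after integrating.\<close>

lemma dyadic_modulus:
  fixes H :: "real \<Rightarrow> 'w \<Rightarrow> 'e::real_normed_vector"
  assumes "continuous_paths M T H" "\<omega> \<in> space M" "0 < e"
  shows "\<exists>N. \<forall>n\<ge>N. \<forall>i<2 ^ n. \<forall>s\<in>{dy n i..dy n (Suc i)}. norm (H s \<omega> - H (dy n i) \<omega>) \<le> e"
proof -
  have "continuous_on {0..T} (\<lambda>t. H t \<omega>)" using assms unfolding continuous_paths_def by blast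
  then have "uniformly_continuous_on {0..T} (\<lambda>t. H t \<omega>)"
    by (rule compact_uniformly_continuous) simp
  then obtain d where d: "d > 0" "\<And>s t. s \<in> {0..T} \<Longrightarrow> t \<in> {0..T} \<Longrightarrow> dist t s < d \<Longrightarrow> dist (H t \<omega>) (H s \<omega>) < e"
    using assms(3) unfolding uniformly_continuous_on_def by metis
  obtain N where N: "T / d < 2 ^ N" using real_arch_pow[of 2 "T / d"] by auto
  show ?thesis
  proof (intro exI[of _ N] allI impI ballI)
    fix n i s assume n: "N \<le> n" and i: "i < 2 ^ n" and s: "s \<in> {dy n i..dy n (Suc i)}"
    have "(2::real) ^ N \<le> 2 ^ n" using n by simp
    then have "T / d < 2 ^ n" using N by linarith
    then have "T / 2 ^ n < d" using d(1) by (simp add: field_simps)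
    moreover have "s - dy n i \<le> T / 2 ^ n" using s dy_Suc[of n i] by auto
    ultimately have "dist s (dy n i) < d" using s by (simp add: dist_real_def)
    moreover have "s \<in> {0..T}" "dy n i \<in> {0..T}"
      using s i dy_nonneg[of n i] dy_le_T[of "Suc i" n] dy_le_T[of i n] by auto
    ultimately show "norm (H s \<omega> - H (dy n i) \<omega>) \<le> e"
      using d(2)[of "dy n i" s] by (simp add: dist_norm)
  qed
qed

lemma riemann_sq_dist:
  fixes H :: "real \<Rightarrow> 'w \<Rightarrow> real^'m^'d"
  assumes ad: "adapted_process T F H" and co: "continuous_paths M T H" and \<omega>: "\<omega> \<in> space M"
    and e: "0 < e"
  shows "\<exists>N. \<forall>n\<ge>N. \<forall>j\<le>2 ^ n. (LINT s:{0..dy n j}|lborel.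
    (norm (simple_value j (dy n) (\<lambda>i. H (dy n i)) s \<omega> - H s \<omega>))\<^sup>2) \<le> e"
proof -
  have eT: "0 < sqrt (e / T)" using e T_pos by simp
  obtain N where N: "\<And>n i s. n \<ge> N \<Longrightarrow> i < 2 ^ n \<Longrightarrow> s \<in> {dy n i..dy n (Suc i)} \<Longrightarrow>
      norm (H s \<omega> - H (dy n i) \<omega>) \<le> sqrt (e / T)"
    using dyadic_modulus[OF co \<omega> eT] by blast
  have "(LINT s:{0..dy n j}|lborel.
    (norm (simple_value j (dy n) (\<lambda>i. H (dy n i)) s \<omega> - H s \<omega>))\<^sup>2) \<le> e" if n: "n \<ge> N" and j: "j \<le> 2 ^ n" for n j
  proof -
    let ?f = "\<lambda>s. (norm (simple_value j (dy n) (\<lambda>i. H (dy n i)) s \<omega> - H s \<omega>))\<^sup>2"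
    have cH: "continuous_on {0..dy n j} (\<lambda>s. H s \<omega>)"
      using co \<omega> dy_le_T[OF j] unfolding continuous_paths_def
      by (auto intro: continuous_on_subset[of "{0..T}"])
    \<comment> \<open>Time 0 lies in no half-open cell, so the step process vanishes there instead
      of equalling \<open>H 0\<close>; a single point does not affect the integral.\<close>
    have "?f s \<le> e / T" if s: "s \<in> {0..dy n j}" "s \<noteq> 0" for s
    proof -
      obtain i where i: "i < j" "s \<in> {dy n i<..dy n (Suc i)}"
        using partition.cell_ex[OF dy_partition, of n s j] s by (auto simp: dy_0)
      have "norm (H s \<omega> - H (dy n i) \<omega>) \<le> sqrt (e / T)" using N[of n i s] i j n by auto
      then have "?f s \<le> (sqrt (e / T))\<^sup>2"
        unfolding riemann_value[OF ad j i] by (intro power_mono) (auto simp: norm_minus_commute)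
      then show ?thesis using e T_pos by simp
    qed
    then have "AE s in lborel. indicator {0..dy n j} s *\<^sub>R ?f s \<le> indicator {0..dy n j} s *\<^sub>R (e / T)"
      using AE_lborel_singleton[of 0] by (auto simp: indicator_def elim!: eventually_mono)
    moreover have "set_integrable lborel {0..dy n j} ?f"
      by (rule set_integrable_sq_diff[OF cH simple_value_measurable_time simple_value_bounded])
    ultimately have "(LINT s:{0..dy n j}|lborel. ?f s) \<le> (LINT s:{0..dy n j}|lborel. e / T)"
      unfolding set_lebesgue_integral_def set_integrable_def
      by (intro integral_mono_AE) (auto simp: emeasure_lborel_Icc_eq)
    also have "\<dots> = dy n j * (e / T)"
      using dy_nonneg[of n j] by (simp add: set_lebesgue_integral_def)
    also have "\<dots> \<le> T * (e / T)"
      using dy_le_T[OF j] e T_pos by (intro mult_right_mono) auto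
    finally show ?thesis using T_pos by simp
  qed
  then show ?thesis by blast
qed

text \<open>Progressive measurability makes the integrand jointly measurable, and integrating out
  time preserves measurability. The restricted measure \<open>N\<close> is used because
  \<open>H\<close> is controlled on \<open>{0..t}\<close> only.\<close>

lemma sq_dist_measurable:
  fixes H :: "real \<Rightarrow> 'w \<Rightarrow> real^'m^'d"
  assumes pr: "progressive t F H" and t: "0 \<le> t" "t \<le> T" and h: "step_process t n \<tau> h"
  shows "(\<lambda>\<omega>. LINT s:{0..t}|lborel. (norm (simple_value n \<tau> h s \<omega> - H s \<omega>))\<^sup>2) \<in> borel_measurable M"
proof -
  define N where "N = restrict_space lborel {0..t}"
  have sN: "sets N = sets (restrict_space borel {0..t})"
    unfolding N_def by (intro sets_restrict_space_cong) simp
  interpret N: sigma_finite_measure N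
    unfolding N_def by (rule sigma_finite_measure_restrict_space) (auto intro: sigma_finite_lborel)
  have idF: "(\<lambda>\<omega>. \<omega>) \<in> M \<rightarrow>\<^sub>M F t"
    using measurable_from_subalg[OF subalg_F, of t "\<lambda>\<omega>. \<omega>" "F t"] t by auto
  have sndN: "snd \<in> M \<Otimes>\<^sub>M N \<rightarrow>\<^sub>M restrict_space borel {0..t}"
    unfolding measurable_cong_sets[OF refl sN[symmetric]] by simp
  have "(\<lambda>p. (snd p, fst p)) \<in> M \<Otimes>\<^sub>M N \<rightarrow>\<^sub>M restrict_space borel {0..t} \<Otimes>\<^sub>M F t"
    by (intro measurable_Pair sndN measurable_compose[OF measurable_fst idF])
  moreover have "(\<lambda>(s, \<omega>). H s \<omega>) \<in> borel_measurable (restrict_space borel {0..t} \<Otimes>\<^sub>M F t)"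
    using pr t unfolding progressive_def by simp
  ultimately have "(\<lambda>p. (\<lambda>(s, \<omega>). H s \<omega>) (snd p, fst p)) \<in> borel_measurable (M \<Otimes>\<^sub>M N)"
    by (rule measurable_compose)
  then have Hm: "(\<lambda>p. H (snd p) (fst p)) \<in> borel_measurable (M \<Otimes>\<^sub>M N)" by simp
  have sb: "snd \<in> M \<Otimes>\<^sub>M N \<rightarrow>\<^sub>M borel"
    using measurable_compose[OF sndN measurable_restrict_space1[OF measurable_ident]] by simp
  have "(\<lambda>p. indicator {\<tau> i<..\<tau> (Suc i)} (snd p) *\<^sub>R h i (fst p)) \<in> borel_measurable (M \<Otimes>\<^sub>M N)"
    if "i < n" for i
    by (intro borel_measurable_scaleR measurable_compose[OF sb] measurable_compose[OF measurable_fst]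
        step_process_meas[OF h t(2) that]) measurable
  note * = this
  have "(\<lambda>p. \<Sum>i<n. indicator {\<tau> i<..\<tau> (Suc i)} (snd p) *\<^sub>R h i (fst p)) \<in> borel_measurable (M \<Otimes>\<^sub>M N)"
    by (rule borel_measurable_sum) (rule *[OF iffD1[OF lessThan_iff]])
  then have "(\<lambda>p. simple_value n \<tau> h (snd p) (fst p)) \<in> borel_measurable (M \<Otimes>\<^sub>M N)"
    unfolding simple_value_def .
  with Hm have "(\<lambda>(\<omega>, s). (norm (simple_value n \<tau> h s \<omega> - H s \<omega>))\<^sup>2) \<in> borel_measurable (M \<Otimes>\<^sub>M N)"
    unfolding case_prod_beta by measurable
  then have "(\<lambda>\<omega>. LINT s|N. (norm (simple_value n \<tau> h s \<omega> - H s \<omega>))\<^sup>2) \<in> borel_measurable M"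
    by (rule N.borel_measurable_lebesgue_integral)
  also have "(\<lambda>\<omega>. LINT s|N. (norm (simple_value n \<tau> h s \<omega> - H s \<omega>))\<^sup>2) =
     (\<lambda>\<omega>. LINT s:{0..t}|lborel. (norm (simple_value n \<tau> h s \<omega> - H s \<omega>))\<^sup>2)"
    unfolding N_def set_lebesgue_integral_def by (subst integral_restrict_space) auto
  finally show ?thesis .
qed

lemma simple_integral_dW_meas:
  assumes "step_process t n \<tau> h" "t \<le> T"
  shows "simple_integral_dW W n \<tau> h \<in> borel_measurable M"
proof -
  interpret bm_grid M T F W n \<tau> h
    using assms unfolding step_process_def by unfold_locales auto
  show ?thesis by (rule simple_integral_meas) simp
qed

text \<open>The definition of the integral supplies some approximating sequence. Its members and the
  Riemann sums are both close to \<open>H\<close> in the square mean over time, hence close to each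
  other, and \<open>simple_integral_compare\<close> transfers this to the integrals.\<close>

lemma riemann_limit:
  fixes H :: "real \<Rightarrow> 'w \<Rightarrow> real^'m^'d"
  assumes ad: "adapted_process T F H" and co: "continuous_paths M T H"
    and j0: "j0 \<le> 2 ^ n0" and I: "is_ito_integral M F W (dy n0 j0) H I"
    and \<epsilon>: "0 < \<epsilon>" and \<eta>: "0 < \<eta>"
  shows "\<exists>N\<ge>n0. \<forall>n\<ge>N. prob {\<omega>\<in>space M. \<epsilon> \<le> norm (riemann H n (j0 * 2 ^ (n - n0)) \<omega> - I \<omega>)} \<le> \<eta>"
proof -
  define t where "t = dy n0 j0"
  have t: "0 \<le> t" "t \<le> T" using dy_nonneg dy_le_T[OF j0] by (auto simp: t_def)
  from I obtain nn tt hh where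
    pr: "progressive t F H" and Im: "I \<in> borel_measurable M" and
    sp: "\<And>k. simple_process M t F (nn k) (tt k) (hh k)" and
    c1: "tendsto_in_prob M (\<lambda>k \<omega>. LINT s:{0..t}|lborel. (norm (simple_value (nn k) (tt k) (hh k) s \<omega> - H s \<omega>))\<^sup>2) (\<lambda>\<omega>. 0)"
    and c2: "tendsto_in_prob M (\<lambda>k. simple_integral_dW W (nn k) (tt k) (hh k)) I"
    unfolding is_ito_integral_def t_def[symmetric] by blast
  \<comment> \<open>Makes the first term of \<open>simple_integral_compare\<close>, at level
    \<open>\<epsilon> / 2\<close>, equal to \<open>\<eta> / 2\<close>. If both squared distances to
    \<open>H\<close> are below \<open>\<delta> / 4\<close>, then the mutual one is at most
    \<delta>.\<close>
  define \<delta> where "\<delta> = \<eta> / 2 * (\<epsilon> / 2)\<^sup>2"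
  have \<delta>: "\<delta> > 0" using \<epsilon> \<eta> by (simp add: \<delta>_def)
  define J where "J n = j0 * 2 ^ (n - n0)" for n
  have Jt: "dy n (J n) = t" if "n0 \<le> n" for n using dy_refine[OF that] by (simp add: J_def t_def)
  have J: "J n \<le> 2 ^ n" if "n0 \<le> n" for n
  proof -
    have "J n \<le> 2 ^ n0 * 2 ^ (n - n0)" unfolding J_def using j0 by simp
    also have "\<dots> = 2 ^ n" using that by (simp add: power_add[symmetric])
    finally show ?thesis .
  qed
  define rv where "rv n s \<omega> = simple_value (J n) (dy n) (\<lambda>i. H (dy n i)) s \<omega>" for n s \<omega>
  define Q where "Q n \<omega> = (LINT s:{0..t}|lborel. (norm (rv n s \<omega> - H s \<omega>))\<^sup>2)" for n \<omega>
  define P where "P k \<omega> = (LINT s:{0..t}|lborel. (norm (simple_value (nn k) (tt k) (hh k) s \<omega> - H s \<omega>))\<^sup>2)" for k \<omega>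
  have rsp: "step_process t (J n) (dy n) (\<lambda>i. H (dy n i))" if "n0 \<le> n" for n
    using riemann_step_process[OF ad J[OF that]] unfolding Jt[OF that] .
  have Qm: "Q n \<in> borel_measurable M" if "n0 \<le> n" for n
    unfolding Q_def[abs_def] rv_def by (rule sq_dist_measurable[OF pr t rsp[OF that]])
  have Pm: "P k \<in> borel_measurable M" for k
    unfolding P_def[abs_def] by (rule sq_dist_measurable[OF pr t simple_process_step[OF sp]])
  have Km: "simple_integral_dW W (nn k) (tt k) (hh k) \<in> borel_measurable M" for k
    by (rule simple_integral_dW_meas[OF simple_process_step[OF sp] t(2)])
  have Rm: "riemann H n (J n) \<in> borel_measurable M" if "n0 \<le> n" for n
    unfolding riemann_def[abs_def] by (rule simple_integral_dW_meas[OF rsp[OF that] t(2)])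
  have "(\<lambda>n. prob {\<omega>\<in>space M. \<delta> / 4 \<le> Q (n + n0) \<omega>}) \<longlonglongrightarrow> 0"
  proof (rule prob_tendsto_0)
    show "{\<omega> \<in> space M. \<delta> / 4 \<le> Q (n + n0) \<omega>} \<in> events" for n
      using Qm[of "n + n0"] by simp
    fix \<omega> assume \<omega>: "\<omega> \<in> space M"
    have "0 < \<delta> / 8" using \<delta> by simp
    then obtain N where N: "\<And>n j. n \<ge> N \<Longrightarrow> j \<le> 2 ^ n \<Longrightarrow> (LINT s:{0..dy n j}|lborel.
       (norm (simple_value j (dy n) (\<lambda>i. H (dy n i)) s \<omega> - H s \<omega>))\<^sup>2) \<le> \<delta> / 8"
      using riemann_sq_dist[OF ad co \<omega>] by blast
    have "\<not> \<delta> / 4 \<le> Q (n + n0) \<omega>" if "n \<ge> N" for n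
      using N[of "n + n0" "J (n + n0)"] J[of "n + n0"] Jt[of "n + n0"] that \<delta> by (simp add: Q_def rv_def)
    then show "\<forall>\<^sub>F n in sequentially. \<omega> \<notin> {\<omega> \<in> space M. \<delta> / 4 \<le> Q (n + n0) \<omega>}"
      by (intro eventually_sequentiallyI[of N]) auto
  qed
  then have "\<forall>\<^sub>F n in sequentially. prob {\<omega>\<in>space M. \<delta> / 4 \<le> Q (n + n0) \<omega>} < \<eta> / 2"
    by (rule order_tendstoD(2)) (use \<eta> in simp)
  then obtain N where N: "\<And>n. n \<ge> N \<Longrightarrow> prob {\<omega>\<in>space M. \<delta> / 4 \<le> Q (n + n0) \<omega>} < \<eta> / 2"
    unfolding eventually_sequentially by blast
  have main: "prob {\<omega>\<in>space M. \<epsilon> \<le> norm (riemann H n (J n) \<omega> - I \<omega>)} \<le> \<eta> / 2 + prob {\<omega>\<in>space M. \<delta> / 4 \<le> Q n \<omega>}"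
    if n: "n0 \<le> n" for n
  proof -
    note [measurable] = Qm[OF n] Rm[OF n] Pm Km Im
    let ?K = "\<lambda>k. simple_integral_dW W (nn k) (tt k) (hh k)"
    have le: "prob {\<omega>\<in>space M. \<epsilon> \<le> norm (riemann H n (J n) \<omega> - I \<omega>)} \<le>
       \<eta> / 2 + prob {\<omega>\<in>space M. \<delta> / 4 \<le> Q n \<omega>} + prob {\<omega>\<in>space M. \<delta> / 4 \<le> dist (P k \<omega>) 0}
        + prob {\<omega>\<in>space M. \<epsilon> / 2 \<le> dist (?K k \<omega>) (I \<omega>)}" for k
    proof -
      let ?A = "{\<omega>\<in>space M. \<epsilon> / 2 \<le> norm (?K k \<omega> - riemann H n (J n) \<omega>)}"
      let ?B = "{\<omega>\<in>space M. \<epsilon> / 2 \<le> dist (?K k \<omega>) (I \<omega>)}"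
      let ?D = "\<lambda>\<omega>. LINT s:{0..t}|lborel. (norm (simple_value (nn k) (tt k) (hh k) s \<omega> - rv n s \<omega>))\<^sup>2"
      let ?C1 = "{\<omega>\<in>space M. \<delta> / 4 \<le> Q n \<omega>}"
      let ?C2 = "{\<omega>\<in>space M. \<delta> / 4 \<le> dist (P k \<omega>) 0}"
      have "prob {\<omega>\<in>space M. \<epsilon> \<le> norm (riemann H n (J n) \<omega> - I \<omega>)} \<le> prob (?A \<union> ?B)"
      proof (rule finite_measure_mono)
        show "{\<omega> \<in> space M. \<epsilon> \<le> norm (riemann H n (J n) \<omega> - I \<omega>)} \<subseteq> ?A \<union> ?B"
        proof safe
          fix \<omega> assume a: "\<epsilon> \<le> norm (riemann H n (J n) \<omega> - I \<omega>)"
            and b: "\<not> \<epsilon> / 2 \<le> dist (?K k \<omega>) (I \<omega>)"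
          have "norm (riemann H n (J n) \<omega> - I \<omega>) \<le>
              norm (?K k \<omega> - riemann H n (J n) \<omega>) + norm (?K k \<omega> - I \<omega>)"
            using norm_triangle_ineq4[of "?K k \<omega> - I \<omega>" "?K k \<omega> - riemann H n (J n) \<omega>"] by simp
          then show "\<epsilon> / 2 \<le> norm (?K k \<omega> - riemann H n (J n) \<omega>)"
            using a b by (simp add: dist_norm)
        qed
      qed measurable
      also have "\<dots> \<le> prob ?A + prob ?B" by (rule measure_Un_le) measurable
      also have "prob ?A \<le> \<delta> / (\<epsilon> / 2)\<^sup>2 + prob {\<omega>\<in>space M. \<delta> < ?D \<omega>}"
        unfolding riemann_def rv_def
        by (rule simple_integral_compare[OF t(2) simple_process_step[OF sp] rsp[OF n]]) (use \<epsilon> \<delta> in auto)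
      also have "\<delta> / (\<epsilon> / 2)\<^sup>2 = \<eta> / 2" using \<epsilon> by (simp add: \<delta>_def)
      also have "prob {\<omega>\<in>space M. \<delta> < ?D \<omega>} \<le> prob (?C1 \<union> ?C2)"
      proof (rule finite_measure_mono)
        show "{\<omega> \<in> space M. \<delta> < ?D \<omega>} \<subseteq> ?C1 \<union> ?C2"
        proof safe
          fix \<omega> assume \<omega>: "\<omega> \<in> space M" and d: "\<delta> < ?D \<omega>" and p: "\<not> \<delta> / 4 \<le> dist (P k \<omega>) 0"
          have cH: "continuous_on {0..t} (\<lambda>s. H s \<omega>)"
            using co \<omega> t unfolding continuous_paths_def
            by (auto intro: continuous_on_subset[of "{0..T}"])
          have "?D \<omega> \<le> 2 * P k \<omega> + 2 * Q n \<omega>"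
            unfolding P_def Q_def rv_def
            by (rule set_integral_sq_diff_le[OF cH simple_value_measurable_time simple_value_bounded
                  simple_value_measurable_time simple_value_bounded])
          then show "\<delta> / 4 \<le> Q n \<omega>" using d p by simp
        qed
      qed measurable
      also have "\<dots> \<le> prob ?C1 + prob ?C2" by (rule measure_Un_le) measurable
      finally show ?thesis by simp
    qed
    \<comment> \<open>With \<open>n\<close> fixed, \<open>k\<close> tends to infinity: the terms
      involving the unspecified approximating sequence disappear.\<close>
    have "(\<lambda>k. \<eta> / 2 + prob {\<omega>\<in>space M. \<delta> / 4 \<le> Q n \<omega>} + prob {\<omega>\<in>space M. \<delta> / 4 \<le> dist (P k \<omega>) 0}
        + prob {\<omega>\<in>space M. \<epsilon> / 2 \<le> dist (?K k \<omega>) (I \<omega>)}) \<longlonglongrightarrow>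
        \<eta> / 2 + prob {\<omega>\<in>space M. \<delta> / 4 \<le> Q n \<omega>} + 0 + 0"
      using c1[unfolded tendsto_in_prob_def P_def[symmetric], rule_format, of "\<delta> / 4"]
        c2[unfolded tendsto_in_prob_def, rule_format, of "\<epsilon> / 2"] \<delta> \<epsilon>
      by (intro tendsto_add tendsto_const) simp_all
    from LIMSEQ_le_const[OF this] le show ?thesis by auto
  qed
  show ?thesis
  proof (intro exI[of _ "N + n0"] conjI allI impI)
    fix n assume "N + n0 \<le> n"
    then have "n0 \<le> n" "prob {\<omega>\<in>space M. \<delta> / 4 \<le> Q n \<omega>} < \<eta> / 2"
      using N[of "n - n0"] by auto
    then show "prob {\<omega>\<in>space M. \<epsilon> \<le> norm (riemann H n (j0 * 2 ^ (n - n0)) \<omega> - I \<omega>)} \<le> \<eta>"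
      using main[of n] unfolding J_def by linarith
  qed simp
qed

end

section \<open>Uniformity of the Riemann sum approximation over grid points\<close>

context bm_space
begin

lemma adapted_meas: "adapted_process T F H \<Longrightarrow> 0 \<le> t \<Longrightarrow> t \<le> T \<Longrightarrow> H t \<in> borel_measurable M"
  using F_meas_M[of t "H t" borel] unfolding adapted_process_def by simp

lemma dy_cell:
  assumes "n \<le> m" "i < 2 ^ m"
  shows "i div 2 ^ (m - n) < 2 ^ n" "dy m i \<in> {dy n (i div 2 ^ (m - n))..dy n (Suc (i div 2 ^ (m - n)))}"
proof -
  let ?K = "2 ^ (m - n) :: nat"
  have "(2::nat) ^ m = 2 ^ n * ?K" using assms(1) by (simp add: power_add[symmetric])
  then show "i div ?K < 2 ^ n" using assms(2) by (simp add: less_mult_imp_div_less)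
  have "i div ?K * ?K \<le> i" by simp
  moreover have "i \<le> Suc (i div ?K) * ?K"
    using dividend_less_div_times[of ?K i] by simp
  ultimately show "dy m i \<in> {dy n (i div ?K)..dy n (Suc (i div ?K))}"
    using dy_le[of "i div ?K * ?K" i m] dy_le[of i "Suc (i div ?K) * ?K" m]
    unfolding dy_refine[OF assms(1)] by simp
qed

text \<open>A block of \<open>2 ^ (m - n)\<close> fine increments telescopes to one coarse
  increment, so the coarse sum is a step integral on the fine grid with the integrand frozen at
  coarse points.\<close>

lemma riemann_refine:
  fixes H :: "real \<Rightarrow> 'w \<Rightarrow> real^'m^'d"
  assumes nm: "n \<le> m"
  shows "riemann H n j \<omega> =
    simple_integral_dW W (j * 2 ^ (m - n)) (dy m) (\<lambda>i. H (dy n (i div 2 ^ (m - n)))) \<omega>"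
proof -
  define K where "K = (2::nat) ^ (m - n)"
  have K: "K > 0" by (simp add: K_def)
  define f where "f i = H (dy n (i div K)) \<omega> *v (W (dy m (Suc i)) \<omega> - W (dy m i) \<omega>)" for i
  have "sum f {k * K..<k * K + K} = H (dy n k) \<omega> *v (W (dy n (Suc k)) \<omega> - W (dy n k) \<omega>)" for k
  proof -
    have d: "i div K = k" if "i \<in> {k * K..<k * K + K}" for i
      using that K by (intro div_nat_eqI) (auto simp: algebra_simps)
    have "sum f {k * K..<k * K + K} =
        (\<Sum>i\<in>{k * K..<k * K + K}. H (dy n k) \<omega> *v (W (dy m (Suc i)) \<omega> - W (dy m i) \<omega>))"
      by (intro sum.cong refl) (simp add: f_def d)
    also have "\<dots> = H (dy n k) \<omega> *v (\<Sum>i\<in>{k * K..<k * K + K}. W (dy m (Suc i)) \<omega> - W (dy m i) \<omega>)"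
      by (simp add: linear_sum[OF matrix_vector_mul_linear])
    also have "(\<Sum>i\<in>{k * K..<k * K + K}. W (dy m (Suc i)) \<omega> - W (dy m i) \<omega>) =
        W (dy m (Suc k * K)) \<omega> - W (dy m (k * K)) \<omega>"
      using sum_Suc_diff'[of "k * K" "k * K + K" "\<lambda>i. W (dy m i) \<omega>"] by (simp add: add.commute)
    finally show ?thesis unfolding K_def dy_refine[OF nm] .
  qed
  then have "riemann H n j \<omega> = (\<Sum>k<j. sum f {k * K..<k * K + K})"
    unfolding riemann_def simple_integral_dW_def by simp
  also have "\<dots> = sum f {..<j * K}" by (rule sum.nat_group)
  finally show ?thesis unfolding simple_integral_dW_def f_def K_def .
qed

text \<open>\<open>riemann_limit\<close> has no rate while the number of grid points grows with
  \<open>n\<close>, so a union bound at level \<open>n\<close> is impossible. Instead a much finer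
  level \<open>m\<close> is chosen for each \<open>n\<close>, where the union bound over the coarse
  points does work. Coarse and fine sums are then compared at all points at once by the maximal
  inequality.\<close>

lemma riemann_uniform:
  fixes H :: "real \<Rightarrow> 'w \<Rightarrow> real^'m^'d"
  assumes ad: "adapted_process T F H" and co: "continuous_paths M T H"
    and I: "\<And>t. t \<in> {0..T} \<Longrightarrow> is_ito_integral M F W t H (I t)" and \<epsilon>: "0 < \<epsilon>"
  shows "(\<lambda>n. prob {\<omega>\<in>space M. \<exists>j\<in>{..2 ^ n}. \<epsilon> \<le> norm (riemann H n j \<omega> - I (dy n j) \<omega>)}) \<longlonglongrightarrow> 0"
proof -
  define g where "g n m i \<omega> = H (dy m i) \<omega> - H (dy n (i div 2 ^ (m - n))) \<omega>" for n m i \<omega>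
  define V where "V n m \<omega> = (\<Sum>i<2 ^ m. (norm (g n m i \<omega>))\<^sup>2 * (dy m (Suc i) - dy m i))" for n m \<omega>
  \<comment> \<open>All finer levels are allowed at once, because \<open>m\<close> is chosen only
    after \<open>n\<close> and \<eta>. Path continuity bounds the quadratic sums uniformly in
    \<open>m \<ge> n\<close>.\<close>
  define E where "E \<delta> n = {\<omega>\<in>space M. \<exists>m\<in>{n..}. \<delta> < V n m \<omega>}" for \<delta> n
  have gF: "g n m i \<in> borel_measurable (F (dy m i))" if nm: "n \<le> m" and i: "i < 2 ^ m" for n m i
  proof -
    note c = dy_cell[OF nm i]
    have "dy m i \<le> T" using dy_le_T i by simp
    moreover have "H t \<in> borel_measurable (F t)" if "0 \<le> t" "t \<le> T" for t
      using ad that unfolding adapted_process_def by simp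
    moreover have "H (dy n (i div 2 ^ (m - n))) \<in> borel_measurable (F (dy m i))"
    proof (rule F_mono)
      have "dy n (i div 2 ^ (m - n)) \<in> {0..T}" using c(1) dy_nonneg dy_le_T by simp
      then show "H (dy n (i div 2 ^ (m - n))) \<in> borel_measurable (F (dy n (i div 2 ^ (m - n))))"
        using ad unfolding adapted_process_def by blast
    qed (use c dy_nonneg \<open>dy m i \<le> T\<close> in auto)
    ultimately show ?thesis unfolding g_def using dy_nonneg by (intro borel_measurable_diff) auto
  qed
  have grid: "bm_grid M T F W (2 ^ m) (dy m) (g n m)" if nm: "n \<le> m" for n m
    by unfold_locales (use gF[OF nm] in \<open>auto simp: dy_nonneg dy_le dy_last\<close>)
  have gM: "g n m i \<in> borel_measurable M" if nm: "n \<le> m" and i: "i < 2 ^ m" for n m i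
    using F_meas_M[OF dy_nonneg dy_le_T gF[OF nm i]] i by simp
  have VM: "V n m \<in> borel_measurable M" if nm: "n \<le> m" for n m
  proof -
    have "(\<lambda>\<omega>. (norm (g n m i \<omega>))\<^sup>2 * (dy m (Suc i) - dy m i)) \<in> borel_measurable M" if "i \<in> {..<2 ^ m}" for i
      using gM[OF nm, of i] that by simp
    then show ?thesis unfolding V_def[abs_def] by (rule borel_measurable_sum)
  qed
  have E_ev: "E \<delta> n \<in> events" for \<delta> n
  proof -
    have "E \<delta> n = (\<Union>m\<in>{n..}. {\<omega>\<in>space M. \<delta> < V n m \<omega>})" by (auto simp: E_def)
    moreover have "{\<omega>\<in>space M. \<delta> < V n m \<omega>} \<in> events" if "m \<in> {n..}" for m
      using VM[of n m] that by simp
    ultimately show ?thesis by (auto intro!: sets.countable_UN'')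
  qed
  have E_lim: "(\<lambda>n. prob (E \<delta> n)) \<longlonglongrightarrow> 0" if \<delta>: "0 < \<delta>" for \<delta>
  proof (rule prob_tendsto_0[OF E_ev])
    fix \<omega> assume \<omega>: "\<omega> \<in> space M"
    have "0 < sqrt (\<delta> / T)" using \<delta> T_pos by simp
    then obtain N where N: "\<And>n i s. n \<ge> N \<Longrightarrow> i < 2 ^ n \<Longrightarrow> s \<in> {dy n i..dy n (Suc i)} \<Longrightarrow>
      norm (H s \<omega> - H (dy n i) \<omega>) \<le> sqrt (\<delta> / T)"
      using dyadic_modulus[OF co \<omega>] by blast
    have "V n m \<omega> \<le> \<delta>" if n: "N \<le> n" and nm: "n \<le> m" for n m
    proof -
      have "V n m \<omega> \<le> (\<Sum>i<(2::nat) ^ m. \<delta> / T * (T / 2 ^ m))"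
        unfolding V_def
      proof (intro sum_mono mult_mono)
        fix i assume "i \<in> {..<(2::nat) ^ m}"
        then have i: "i < 2 ^ m" by simp
        have "norm (g n m i \<omega>) \<le> sqrt (\<delta> / T)"
          unfolding g_def using N[OF n dy_cell[OF nm i]] .
        then have "(norm (g n m i \<omega>))\<^sup>2 \<le> (sqrt (\<delta> / T))\<^sup>2" by (intro power_mono) auto
        then show "(norm (g n m i \<omega>))\<^sup>2 \<le> \<delta> / T" using \<delta> T_pos by simp
      qed (use \<delta> T_pos dy_Suc dy_le[of _ "Suc _"] in auto)
      also have "\<dots> = \<delta>" using T_pos by simp
      finally show ?thesis .
    qed
    then have "\<omega> \<notin> E \<delta> n" if "N \<le> n" for n
      using that by (auto simp: E_def not_less)
    then show "\<forall>\<^sub>F n in sequentially. \<omega> \<notin> E \<delta> n" by (rule eventually_sequentiallyI)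
  qed
  define A where "A n = {\<omega>\<in>space M. \<exists>j\<in>{..2 ^ n}. \<epsilon> \<le> norm (riemann H n j \<omega> - I (dy n j) \<omega>)}" for n
  \<comment> \<open>One \<eta> is the Chebyshev term of the maximal inequality, the other is the
    union bound at level \<open>m\<close>.\<close>
  have bound: "prob (A n) \<le> 2 * \<eta> + prob (E (\<eta> * (\<epsilon> / 2)\<^sup>2) n)" if \<eta>: "0 < \<eta>" for \<eta> n
  proof -
    define \<delta> where "\<delta> = \<eta> * (\<epsilon> / 2)\<^sup>2"
    have \<delta>: "0 \<le> \<delta>" using \<eta> by (simp add: \<delta>_def)
    \<comment> \<open>There are \<open>2 ^ n + 1\<close> coarse grid points, both ends
      included.\<close>
    define \<eta>' where "\<eta>' = \<eta> / real (2 ^ n + 1)"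
    have \<eta>': "0 < \<eta>'" using \<eta> by (simp add: \<eta>'_def add_pos_pos)
    have half: "0 < \<epsilon> / 2" using \<epsilon> by simp
    have "\<forall>j\<in>{..2 ^ n}. \<exists>N\<ge>n. \<forall>m\<ge>N.
      prob {\<omega>\<in>space M. \<epsilon> / 2 \<le> norm (riemann H m (j * 2 ^ (m - n)) \<omega> - I (dy n j) \<omega>)} \<le> \<eta>'"
      by (intro ballI riemann_limit[OF ad co _ I half \<eta>']) (auto simp: dy_nonneg dy_le_T)
    from bchoice[OF this] obtain N where N: "\<And>j m. j \<le> 2 ^ n \<Longrightarrow> N j \<le> m \<Longrightarrow>
      prob {\<omega>\<in>space M. \<epsilon> / 2 \<le> norm (riemann H m (j * 2 ^ (m - n)) \<omega> - I (dy n j) \<omega>)} \<le> \<eta>'"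
      by auto
    \<comment> \<open>Any level above \<open>n\<close> and all the finitely many \<open>N j\<close>
      would do; the sum is a convenient one.\<close>
    define m where "m = n + (\<Sum>j\<le>2 ^ n. N j)"
    have nm: "n \<le> m" by (simp add: m_def)
    have Nm: "N j \<le> m" if "j \<le> 2 ^ n" for j
      using member_le_sum[of j "{..2 ^ n}" N] that by (simp add: m_def)
    define K where "K = (2::nat) ^ (m - n)"
    have K2: "2 ^ n * K = 2 ^ m" using nm by (simp add: K_def power_add[symmetric])
    interpret G: bm_grid M T F W "2 ^ m" "dy m" "g n m" by (rule grid[OF nm])
    have GS: "G.S (j * K) \<omega> = riemann H m (j * K) \<omega> - riemann H n j \<omega>" for j \<omega>
      unfolding riemann_refine[OF nm, of H j]
      unfolding riemann_def simple_integral_dW_def g_def K_def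
      by (simp add: matrix_vector_mult_diff_rdistrib sum_subtractf)
    have GSm: "G.S j \<in> borel_measurable M" if "j \<in> {..2 ^ m}" for j
      using G.simple_integral_meas that by simp
    have Im: "I (dy n j) \<in> borel_measurable M" if "j \<in> {..2 ^ n}" for j
      using I[of "dy n j"] dy_nonneg dy_le_T that unfolding is_ito_integral_def by simp
    have Rm: "riemann H m (j * K) \<in> borel_measurable M" if "j \<in> {..2 ^ n}" for j
    proof -
      have "j * K \<le> 2 ^ m" using that K2[symmetric] by simp
      then show ?thesis
        unfolding riemann_def[abs_def] using dy_le_T
        by (intro simple_integral_dW_meas[OF riemann_step_process[OF ad]]) auto
    qed
    let ?B = "\<lambda>j. {\<omega>\<in>space M. \<epsilon> / 2 \<le> norm (riemann H m (j * K) \<omega> - I (dy n j) \<omega>)}"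
    let ?C = "{\<omega>\<in>space M. \<exists>j\<le>2 ^ m. \<epsilon> / 2 \<le> norm (G.S j \<omega>)}"
    have Bev: "?B j \<in> events" if "j \<in> {..2 ^ n}" for j
      using Rm[OF that] Im[OF that] by simp
    have UBev: "(\<Union>j\<in>{..2 ^ n}. ?B j) \<in> events"
      by (rule sets.finite_UN[OF finite_atMost Bev])
    have Cev: "?C \<in> events"
    proof -
      have "?C = (\<Union>j\<in>{..2 ^ m}. {\<omega>\<in>space M. \<epsilon> / 2 \<le> norm (G.S j \<omega>)})" by auto
      moreover have "{\<omega>\<in>space M. \<epsilon> / 2 \<le> norm (G.S j \<omega>)} \<in> events" if "j \<in> {..2 ^ m}" for j
        using GSm[OF that] by simp
      ultimately show ?thesis by auto
    qed
    have "prob (A n) \<le> prob (?C \<union> (\<Union>j\<in>{..2 ^ n}. ?B j))"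
    proof (rule finite_measure_mono)
      show "A n \<subseteq> ?C \<union> (\<Union>j\<in>{..2 ^ n}. ?B j)"
      proof (rule subsetI)
        fix \<omega> assume "\<omega> \<in> A n"
        then obtain j where \<omega>: "\<omega> \<in> space M" and j: "j \<le> 2 ^ n"
          and le: "\<epsilon> \<le> norm (riemann H n j \<omega> - I (dy n j) \<omega>)" by (auto simp: A_def)
        have "norm (riemann H n j \<omega> - I (dy n j) \<omega>) \<le>
            norm (riemann H m (j * K) \<omega> - I (dy n j) \<omega>) + norm (G.S (j * K) \<omega>)"
          unfolding GS using norm_triangle_ineq4[of "riemann H m (j * K) \<omega> - I (dy n j) \<omega>"
              "riemann H m (j * K) \<omega> - riemann H n j \<omega>"] by simp
        then have "\<epsilon> / 2 \<le> norm (riemann H m (j * K) \<omega> - I (dy n j) \<omega>) \<or> \<epsilon> / 2 \<le> norm (G.S (j * K) \<omega>)"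
          using le by linarith
        moreover have "j * K \<le> 2 ^ m" using j K2[symmetric] by simp
        ultimately show "\<omega> \<in> ?C \<union> (\<Union>j\<in>{..2 ^ n}. ?B j)" using \<omega> j by auto
      qed
      show "?C \<union> (\<Union>j\<in>{..2 ^ n}. ?B j) \<in> events"
        by (rule sets.Un[OF Cev UBev])
    qed
    also have "\<dots> \<le> prob ?C + prob (\<Union>j\<in>{..2 ^ n}. ?B j)"
      by (rule measure_Un_le[OF Cev UBev])
    also have "prob ?C \<le> \<delta> / (\<epsilon> / 2)\<^sup>2 + prob {\<omega>\<in>space M. \<delta> < G.V (2 ^ m) \<omega>}"
      by (rule G.simple_integral_maximal[OF half \<delta>])
    also have "\<delta> / (\<epsilon> / 2)\<^sup>2 = \<eta>" using \<epsilon> by (simp add: \<delta>_def)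
    also have "prob {\<omega>\<in>space M. \<delta> < G.V (2 ^ m) \<omega>} \<le> prob (E \<delta> n)"
      using nm by (intro finite_measure_mono E_ev) (auto simp: E_def V_def)
    also have "prob (\<Union>j\<in>{..2 ^ n}. ?B j) \<le> (\<Sum>j\<in>{..2 ^ n}. prob (?B j))"
      by (rule measure_UNION_le[OF finite_atMost Bev])
    also have "\<dots> \<le> (\<Sum>j\<in>{..(2::nat) ^ n}. \<eta>')"
      using N Nm unfolding K_def by (intro sum_mono) auto
    also have "\<dots> = real (2 ^ n + 1) * \<eta>'" by simp
    also have "\<dots> = \<eta>" 
    proof -
      have c: "c \<noteq> 0 \<Longrightarrow> c * (\<eta> / c) = \<eta>" for c :: real by simp
      show ?thesis unfolding \<eta>'_def by (rule c) linarith
    qed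
    finally show ?thesis unfolding \<delta>_def by simp
  qed
  have "(\<lambda>n. prob (A n)) \<longlonglongrightarrow> 0"
  proof (rule LIMSEQ_I)
    fix r :: real assume r: "0 < r"
    define \<eta> where "\<eta> = r / 4"
    have \<eta>: "0 < \<eta>" using r by (simp add: \<eta>_def)
    have "0 < \<eta> * (\<epsilon> / 2)\<^sup>2" using \<eta> \<epsilon> by simp
    from LIMSEQ_D[OF E_lim[OF this] \<eta>] obtain n0 where
      n0: "\<And>n. n \<ge> n0 \<Longrightarrow> prob (E (\<eta> * (\<epsilon> / 2)\<^sup>2) n) < \<eta>" by auto
    have "norm (prob (A n) - 0) < r" if "n \<ge> n0" for n
      using bound[OF \<eta>, of n] n0[OF that] r by (simp add: \<eta>_def)
    then show "\<exists>no. \<forall>n\<ge>no. norm (prob (A n) - 0) < r" by blast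
  qed
  then show ?thesis unfolding A_def .
qed

end

section \<open>The Euler scheme converges to the solution\<close>

lemma lipschitz_borel_measurable:
  fixes f :: "'a::metric_space \<Rightarrow> 'b::metric_space"
  shows "L-lipschitz_on UNIV f \<Longrightarrow> f \<in> borel_measurable borel"
  by (intro borel_measurable_continuous_onI lipschitz_on_continuous_on)

lemma set_integral_minus_const_le:
  fixes f :: "real \<Rightarrow> 'e::euclidean_space"
  assumes ab: "a \<le> b" and f: "set_integrable lborel {a<..b} f"
    and le: "\<And>s. s \<in> {a<..b} \<Longrightarrow> norm (f s - c) \<le> e"
  shows "norm ((LINT s:{a<..b}|lborel. f s) - (b - a) *\<^sub>R c) \<le> (b - a) * e"
proof -
  have c: "set_integrable lborel {a<..b} (\<lambda>_. c)" and e: "set_integrable lborel {a<..b} (\<lambda>_. e)"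
    using ab unfolding set_integrable_def
    by (auto intro!: integrable_scaleR_left integrable_mult_left integrable_real_indicator)
  have i: "set_integrable lborel {a<..b} (\<lambda>s. f s - c)" using set_integral_diff(1)[OF f c] .
  have "(LINT s:{a<..b}|lborel. f s) - (b - a) *\<^sub>R c = (LINT s:{a<..b}|lborel. f s - c)"
    using set_integral_diff(2)[OF f c] ab by (simp add: set_lebesgue_integral_def)
  also have "norm \<dots> \<le> (LINT s:{a<..b}|lborel. norm (f s - c))"
    by (rule set_integral_norm_bound[OF i])
  also have "\<dots> \<le> (LINT s:{a<..b}|lborel. e)"
    by (rule set_integral_mono[OF set_integrable_norm[OF i] e le])
  also have "\<dots> = (b - a) * e" using ab by (simp add: set_lebesgue_integral_def)
  finally show ?thesis .
qed

locale sde = bm_space M T F W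
  for M :: "'w measure" and T :: real and F :: "real \<Rightarrow> 'w measure" and W :: "real \<Rightarrow> 'w \<Rightarrow> real^'m" +
  fixes \<mu> :: "real^'d \<Rightarrow> real^'d" and \<sigma> :: "real^'d \<Rightarrow> real^'m^'d" and K\<mu> K\<sigma> :: real
    and \<xi> :: "'w \<Rightarrow> real^'d"
  assumes lip_\<mu>: "K\<mu>-lipschitz_on UNIV \<mu>" and lip_\<sigma>: "K\<sigma>-lipschitz_on UNIV \<sigma>"
    and \<xi>_meas: "\<xi> \<in> borel_measurable (F 0)"
begin

lemma measurable_\<mu>[measurable]: "\<mu> \<in> borel_measurable borel"
  using lip_\<mu> by (rule lipschitz_borel_measurable)

lemma measurable_\<sigma>[measurable]: "\<sigma> \<in> borel_measurable borel"
  using lip_\<sigma> by (rule lipschitz_borel_measurable)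

definition lip_const :: real where "lip_const = K\<mu> + K\<sigma>"

lemma lip_const_nonneg: "0 \<le> lip_const"
  using lip_\<mu> lip_\<sigma> by (simp add: lip_const_def lipschitz_on_nonneg)

lemma lip: "norm (\<mu> x - \<mu> y) \<le> lip_const * norm (x - y)" "norm (\<sigma> x - \<sigma> y) \<le> lip_const * norm (x - y)"
proof -
  have "norm (\<mu> x - \<mu> y) \<le> K\<mu> * norm (x - y)" "norm (\<sigma> x - \<sigma> y) \<le> K\<sigma> * norm (x - y)"
    using lipschitz_onD[OF lip_\<mu>, of x y] lipschitz_onD[OF lip_\<sigma>, of x y] by (auto simp: dist_norm)
  moreover have "K\<mu> * norm (x - y) \<le> lip_const * norm (x - y)" "K\<sigma> * norm (x - y) \<le> lip_const * norm (x - y)"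
    using lipschitz_on_nonneg[OF lip_\<mu>] lipschitz_on_nonneg[OF lip_\<sigma>]
    by (auto simp: lip_const_def intro!: mult_right_mono)
  ultimately show "norm (\<mu> x - \<mu> y) \<le> lip_const * norm (x - y)" "norm (\<sigma> x - \<sigma> y) \<le> lip_const * norm (x - y)" by linarith+
qed

definition dt :: "nat \<Rightarrow> real" where "dt n = T / 2 ^ n"

lemma dt_pos: "0 < dt n" and dt_le_T: "dt n \<le> T"
proof -
  show "0 < dt n" using T_pos by (simp add: dt_def)
  have "(1::real) \<le> 2 ^ n" by simp
  then show "dt n \<le> T" using T_pos unfolding dt_def by (simp add: divide_le_eq mult_le_cancel_left1)
qed

lemma dy_Suc_dt: "dy n (Suc i) - dy n i = dt n"
  by (simp add: dt_def dy_Suc)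

definition inc :: "nat \<Rightarrow> nat \<Rightarrow> 'w \<Rightarrow> real^'m" where
  "inc n i \<omega> = W (dy n (Suc i)) \<omega> - W (dy n i) \<omega>"

primrec euler :: "nat \<Rightarrow> nat \<Rightarrow> 'w \<Rightarrow> real^'d" where
  "euler n 0 = \<xi>"
| "euler n (Suc i) = (\<lambda>\<omega>. euler n i \<omega> + dt n *\<^sub>R \<mu> (euler n i \<omega>) + \<sigma> (euler n i \<omega>) *v inc n i \<omega>)"

lemma measurable_dy_mono:
  "i \<le> j \<Longrightarrow> j \<le> 2 ^ n \<Longrightarrow> f \<in> measurable (F (dy n i)) N \<Longrightarrow> f \<in> measurable (F (dy n j)) N"
  by (rule F_mono[OF dy_nonneg dy_le dy_le_T])

lemma measurable_dy_M: "i \<le> 2 ^ n \<Longrightarrow> f \<in> measurable (F (dy n i)) N \<Longrightarrow> f \<in> measurable M N"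
  by (rule F_meas_M[OF dy_nonneg dy_le_T])

lemma inc_adapted: "i < 2 ^ n \<Longrightarrow> inc n i \<in> borel_measurable (F (dy n (Suc i)))"
  unfolding inc_def[abs_def]
  by (intro borel_measurable_diff W_adapted dy_nonneg dy_le_T measurable_dy_mono[of i "Suc i"]) auto

lemma euler_adapted: "i \<le> 2 ^ n \<Longrightarrow> euler n i \<in> borel_measurable (F (dy n i))"
proof (induction i)
  case 0
  then show ?case using \<xi>_meas by (simp add: dy_0)
next
  case (Suc i)
  have [measurable]: "euler n i \<in> borel_measurable (F (dy n (Suc i)))"
    using measurable_dy_mono[of i "Suc i" n] Suc by simp
  have [measurable]: "inc n i \<in> borel_measurable (F (dy n (Suc i)))"
    using inc_adapted[of i n] Suc.prems by simp
  show ?case unfolding euler.simps by measurable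
qed

end

section \<open>Residual of the solution on dyadic grids\<close>

locale sde_solution = sde M T F W \<mu> \<sigma> K\<mu> K\<sigma> \<xi>
  for M :: "'w measure" and T :: real and F :: "real \<Rightarrow> 'w measure" and W :: "real \<Rightarrow> 'w \<Rightarrow> real^'m"
    and \<mu> :: "real^'d \<Rightarrow> real^'d" and \<sigma> :: "real^'d \<Rightarrow> real^'m^'d" and K\<mu> K\<sigma> :: real
    and \<xi> :: "'w \<Rightarrow> real^'d" +
  fixes X :: "real \<Rightarrow> 'w \<Rightarrow> real^'d"
  assumes X_adapted: "adapted_process T F X" and X_cont: "continuous_paths M T X"
    and X_sol: "solves_SDE M T F W \<mu> \<sigma> \<xi> X"
begin

text \<open>The Riemann sum form of the right side of the equation along the true solution. It
  separates two errors: \<open>X - xbar\<close>, small by convergence of Riemann sums, and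
  \<open>xbar - euler\<close>, a recursion with Lipschitz coefficients.\<close>

definition xbar :: "nat \<Rightarrow> nat \<Rightarrow> 'w \<Rightarrow> real^'d" where
  "xbar n j \<omega> = \<xi> \<omega> + (\<Sum>i<j. dt n *\<^sub>R \<mu> (X (dy n i) \<omega>)) + (\<Sum>i<j. \<sigma> (X (dy n i) \<omega>) *v inc n i \<omega>)"

definition res :: "nat \<Rightarrow> nat \<Rightarrow> 'w \<Rightarrow> real^'d" where
  "res n j \<omega> = X (dy n j) \<omega> - xbar n j \<omega>"

lemma X_dy_adapted: "i \<le> 2 ^ n \<Longrightarrow> X (dy n i) \<in> borel_measurable (F (dy n i))"
  using X_adapted dy_nonneg dy_le_T unfolding adapted_process_def by simp

lemma \<xi>_dy: "i \<le> 2 ^ n \<Longrightarrow> \<xi> \<in> borel_measurable (F (dy n i))"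
  using measurable_dy_mono[of 0 i n \<xi> borel] \<xi>_meas by (simp add: dy_0)

lemma res_adapted: 
  assumes j: "j \<le> 2 ^ n"
  shows "res n j \<in> borel_measurable (F (dy n j))"
proof -
  have X: "X (dy n i) \<in> borel_measurable (F (dy n j))" if "i \<le> j" for i
    using that j by (intro measurable_dy_mono[OF that j] X_dy_adapted) auto
  have inc: "inc n i \<in> borel_measurable (F (dy n j))" if "i < j" for i
    using that j by (intro measurable_dy_mono[of "Suc i" j] inc_adapted) auto
  have "(\<lambda>\<omega>. dt n *\<^sub>R \<mu> (X (dy n i) \<omega>)) \<in> borel_measurable (F (dy n j))"
    "(\<lambda>\<omega>. \<sigma> (X (dy n i) \<omega>) *v inc n i \<omega>) \<in> borel_measurable (F (dy n j))" if "i \<in> {..<j}" for i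
  proof -
    have [measurable]: "X (dy n i) \<in> borel_measurable (F (dy n j))" "inc n i \<in> borel_measurable (F (dy n j))"
      using X[of i] inc[of i] that by auto
    show "(\<lambda>\<omega>. dt n *\<^sub>R \<mu> (X (dy n i) \<omega>)) \<in> borel_measurable (F (dy n j))"
      "(\<lambda>\<omega>. \<sigma> (X (dy n i) \<omega>) *v inc n i \<omega>) \<in> borel_measurable (F (dy n j))"
      by measurable
  qed
  note * = this
  have "xbar n j \<in> borel_measurable (F (dy n j))"
    unfolding xbar_def[abs_def]
    by (intro borel_measurable_add \<xi>_dy[OF j]; rule borel_measurable_sum; erule *)
  then show ?thesis unfolding res_def[abs_def] using X[of j] by (intro borel_measurable_diff) auto
qed

text \<open>The quadrature error accumulates at rate at most \<open>e / T\<close> per unit of time,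
  which makes it uniform over the grid points.\<close>

lemma drift_sum_limit:
  assumes \<omega>: "\<omega> \<in> space M" and e: "0 < e"
  shows "\<exists>N. \<forall>n\<ge>N. \<forall>j\<le>2 ^ n. norm ((LINT s:{0..dy n j}|lborel. \<mu> (X s \<omega>)) -
    (\<Sum>i<j. dt n *\<^sub>R \<mu> (X (dy n i) \<omega>))) \<le> e"
proof -
  have "continuous_paths M T (\<lambda>s \<omega>. \<mu> (X s \<omega>))"
    using X_cont lip_\<mu>[THEN lipschitz_on_continuous_on]
    unfolding continuous_paths_def by (auto intro: continuous_on_compose2)
  note cp = this
  have eT: "0 < e / T" using e T_pos by simp
  obtain N where N: "\<And>n i s. n \<ge> N \<Longrightarrow> i < 2 ^ n \<Longrightarrow> s \<in> {dy n i..dy n (Suc i)} \<Longrightarrow>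
      norm (\<mu> (X s \<omega>) - \<mu> (X (dy n i) \<omega>)) \<le> e / T"
    using dyadic_modulus[OF cp \<omega> eT] by blast
  have int: "set_integrable lborel {0..T} (\<lambda>s. \<mu> (X s \<omega>))"
    using cp \<omega> unfolding continuous_paths_def by (intro borel_integrable_atLeastAtMost') auto
  have "norm ((LINT s:{0..dy n j}|lborel. \<mu> (X s \<omega>)) -
    (\<Sum>i<j. dt n *\<^sub>R \<mu> (X (dy n i) \<omega>))) \<le> dy n j * (e / T)" if n: "n \<ge> N" and j: "j \<le> 2 ^ n" for n j
    using j
  proof (induction j)
    case 0
    have "(LINT s:{0..0::real}|lborel. \<mu> (X s \<omega>)) = 0"
    proof -
      have "AE s in lborel. indicator {0..0::real} s *\<^sub>R \<mu> (X s \<omega>) = 0"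
        using AE_lborel_singleton[of "0::real"] by eventually_elim auto
      then show ?thesis unfolding set_lebesgue_integral_def by (rule integral_eq_zero_AE)
    qed
    then show ?case by (simp add: dy_0)
  next
    case (Suc j)
    have sub: "{0..dy n j} \<subseteq> {0..T}" "{dy n j<..dy n (Suc j)} \<subseteq> {0..T}"
      using dy_le_T[of j n] dy_le_T[of "Suc j" n] dy_nonneg[of n j] Suc.prems by auto
    have eq: "{0..dy n (Suc j)} = {0..dy n j} \<union> {dy n j<..dy n (Suc j)}"
      using dy_le[of j "Suc j" n] dy_nonneg[of n j] by auto
    have i2: "set_integrable lborel {dy n j<..dy n (Suc j)} (\<lambda>s. \<mu> (X s \<omega>))"
      by (rule set_integrable_subset[OF int _ sub(2)]) auto
    have spl: "(LINT s:{0..dy n (Suc j)}|lborel. \<mu> (X s \<omega>)) =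
      (LINT s:{0..dy n j}|lborel. \<mu> (X s \<omega>)) + (LINT s:{dy n j<..dy n (Suc j)}|lborel. \<mu> (X s \<omega>))"
      unfolding eq by (rule set_integral_Un[OF _ set_integrable_subset[OF int _ sub(1)] i2]) auto
    have "norm ((LINT s:{dy n j<..dy n (Suc j)}|lborel. \<mu> (X s \<omega>)) -
        (dy n (Suc j) - dy n j) *\<^sub>R \<mu> (X (dy n j) \<omega>)) \<le> (dy n (Suc j) - dy n j) * (e / T)"
      by (rule set_integral_minus_const_le[OF dy_le i2 N[OF n]]) (use Suc.prems in auto)
    then have "norm ((LINT s:{dy n j<..dy n (Suc j)}|lborel. \<mu> (X s \<omega>)) -
        dt n *\<^sub>R \<mu> (X (dy n j) \<omega>)) \<le> (dy n (Suc j) - dy n j) * (e / T)" unfolding dy_Suc_dt .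
    moreover have "norm ((LINT s:{0..dy n j}|lborel. \<mu> (X s \<omega>)) -
        (\<Sum>i<j. dt n *\<^sub>R \<mu> (X (dy n i) \<omega>))) \<le> dy n j * (e / T)" using Suc by simp
    ultimately have "norm (((LINT s:{0..dy n j}|lborel. \<mu> (X s \<omega>)) - (\<Sum>i<j. dt n *\<^sub>R \<mu> (X (dy n i) \<omega>)))
       + ((LINT s:{dy n j<..dy n (Suc j)}|lborel. \<mu> (X s \<omega>)) - dt n *\<^sub>R \<mu> (X (dy n j) \<omega>)))
      \<le> dy n j * (e / T) + (dy n (Suc j) - dy n j) * (e / T)"
      by (intro norm_triangle_le add_mono)
    also have "dy n j * (e / T) + (dy n (Suc j) - dy n j) * (e / T) = dy n (Suc j) * (e / T)"
      by (simp add: algebra_simps)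
    finally show ?case unfolding spl by (simp add: algebra_simps)
  qed
  moreover have "dy n j * (e / T) \<le> e" if "j \<le> 2 ^ n" for n j
    using mult_right_mono[OF dy_le_T[OF that], of "e / T"] eT T_pos by simp
  ultimately show ?thesis by (meson order_trans)
qed

text \<open>The residual is the quadrature error of the drift, which vanishes almost surely, minus
  the defect of the stochastic Riemann sum, which \<open>riemann_uniform\<close> controls.\<close>

lemma res_uniform:
  assumes \<epsilon>: "0 < \<epsilon>"
  shows "(\<lambda>n. prob {\<omega>\<in>space M. \<exists>j\<in>{..2 ^ n}. \<epsilon> \<le> norm (res n j \<omega>)}) \<longlonglongrightarrow> 0"
proof -
  define H where "H s \<omega> = \<sigma> (X s \<omega>)" for s \<omega>
  have H_ad: "adapted_process T F H"
    using X_adapted unfolding adapted_process_def H_def[abs_def]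
    by (auto intro: measurable_compose[OF _ measurable_\<sigma>])
  have H_co: "continuous_paths M T H"
    using X_cont lip_\<sigma>[THEN lipschitz_on_continuous_on]
    unfolding continuous_paths_def H_def[abs_def] by (auto intro: continuous_on_compose2)
  from X_sol have "\<forall>t\<in>{0..T}. \<exists>I. is_ito_integral M F W t H I \<and>
        (AE \<omega> in M. X t \<omega> = \<xi> \<omega> + (LINT s:{0..t}|lborel. \<mu> (X s \<omega>)) + I \<omega>)"
    unfolding solves_SDE_def H_def[abs_def] .
  from bchoice[OF this] obtain I where I: "\<And>t. t \<in> {0..T} \<Longrightarrow> is_ito_integral M F W t H (I t)"
    and AE_I: "\<And>t. t \<in> {0..T} \<Longrightarrow> AE \<omega> in M. X t \<omega> = \<xi> \<omega> + (LINT s:{0..t}|lborel. \<mu> (X s \<omega>)) + I t \<omega>"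
    by blast
  \<comment> \<open>Written through \<open>X\<close> and \<open>I\<close> instead of the time
    integral, so that measurability follows from \<open>res_eq\<close>. Where the equation holds,
    \<open>D\<close> is the quadrature error of the drift.\<close>
  define D where "D n j \<omega> = X (dy n j) \<omega> - \<xi> \<omega> - I (dy n j) \<omega> - (\<Sum>i<j. dt n *\<^sub>R \<mu> (X (dy n i) \<omega>))" for n j \<omega>
  have res_eq: "res n j \<omega> = D n j \<omega> - (riemann H n j \<omega> - I (dy n j) \<omega>)" for n j \<omega>
    unfolding res_def xbar_def D_def riemann_def simple_integral_dW_def H_def inc_def by (simp add: algebra_simps)
  have half: "0 < \<epsilon> / 2" using \<epsilon> by simp
  let ?A = "\<lambda>n. {\<omega>\<in>space M. \<exists>j\<in>{..2 ^ n}. \<epsilon> / 2 \<le> norm (D n j \<omega>)}"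
  let ?B = "\<lambda>n. {\<omega>\<in>space M. \<exists>j\<in>{..2 ^ n}. \<epsilon> / 2 \<le> norm (riemann H n j \<omega> - I (dy n j) \<omega>)}"
  have Im: "I (dy n j) \<in> borel_measurable M" if "j \<in> {..2 ^ n}" for j n
    using I[of "dy n j"] dy_nonneg dy_le_T that unfolding is_ito_integral_def by simp
  have Rm: "riemann H n j \<in> borel_measurable M" if "j \<in> {..2 ^ n}" for j n
    unfolding riemann_def[abs_def] using dy_le_T that
    by (intro simple_integral_dW_meas[OF riemann_step_process[OF H_ad]]) auto
  have resm: "res n j \<in> borel_measurable M" if "j \<in> {..2 ^ n}" for j n
    using measurable_dy_M[OF _ res_adapted] that by simp
  have Dm: "D n j \<in> borel_measurable M" if "j \<in> {..2 ^ n}" for j n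
  proof -
    have "D n j = (\<lambda>\<omega>. res n j \<omega> + (riemann H n j \<omega> - I (dy n j) \<omega>))" by (auto simp: res_eq)
    then show ?thesis using resm[OF that] Rm[OF that] Im[OF that] by simp
  qed
  have ev: "{\<omega>\<in>space M. \<exists>j\<in>{..2 ^ n}. c \<le> norm (f j \<omega>)} \<in> events"
    if f: "\<And>j. j \<in> {..2 ^ n} \<Longrightarrow> f j \<in> borel_measurable M" for n c and f :: "nat \<Rightarrow> 'w \<Rightarrow> real^'d"
  proof -
    have "{\<omega>\<in>space M. \<exists>j\<in>{..2 ^ n}. c \<le> norm (f j \<omega>)} = (\<Union>j\<in>{..2 ^ n}. {\<omega>\<in>space M. c \<le> norm (f j \<omega>)})"
      by auto
    moreover have "{\<omega>\<in>space M. c \<le> norm (f j \<omega>)} \<in> events" if "j \<in> {..2 ^ n}" for j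
      using f[OF that] by simp
    ultimately show ?thesis by auto
  qed
  have A_ev: "?A n \<in> events" for n by (rule ev[OF Dm])
  have B_ev: "?B n \<in> events" for n by (rule ev) (intro borel_measurable_diff Rm Im)
  \<comment> \<open>The exceptional set of the equation depends on the time, but the dyadic times
    are countable.\<close>
  have "AE \<omega> in M. \<forall>n. \<forall>j\<in>{..2 ^ n}. X (dy n j) \<omega> =
      \<xi> \<omega> + (LINT s:{0..dy n j}|lborel. \<mu> (X s \<omega>)) + I (dy n j) \<omega>"
    unfolding AE_all_countable
    by (intro allI AE_finite_allI AE_I) (auto simp: dy_nonneg dy_le_T)
  then have AE: "AE \<omega> in M. \<forall>\<^sub>F n in sequentially. \<omega> \<notin> ?A n"
    using AE_space
  proof eventually_elim
    case (elim \<omega>)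
    have "0 < \<epsilon> / 4" using \<epsilon> by simp
    from drift_sum_limit[OF elim(2) this] obtain N where N: "\<And>n j. n \<ge> N \<Longrightarrow> j \<le> 2 ^ n \<Longrightarrow>
      norm ((LINT s:{0..dy n j}|lborel. \<mu> (X s \<omega>)) - (\<Sum>i<j. dt n *\<^sub>R \<mu> (X (dy n i) \<omega>))) \<le> \<epsilon> / 4" by blast
    have "norm (D n j \<omega>) \<le> \<epsilon> / 4" if "n \<ge> N" "j \<in> {..2 ^ n}" for n j
    proof -
      have "D n j \<omega> = (LINT s:{0..dy n j}|lborel. \<mu> (X s \<omega>)) - (\<Sum>i<j. dt n *\<^sub>R \<mu> (X (dy n i) \<omega>))"
        using elim(1)[rule_format, OF that(2)] unfolding D_def by simp
      then show ?thesis using N[of n j] that by simp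
    qed
    then have "\<omega> \<notin> ?A n" if "n \<ge> N" for n using that \<epsilon> by (fastforce simp: not_le)
    then show ?case by (rule eventually_sequentiallyI)
  qed
  have "(\<lambda>n. prob (?A n) + prob (?B n)) \<longlonglongrightarrow> 0 + 0"
    by (intro tendsto_add prob_tendsto_0_AE A_ev AE riemann_uniform[OF H_ad H_co I half])
  then have lim: "(\<lambda>n. prob (?A n) + prob (?B n)) \<longlonglongrightarrow> 0" by simp
  have le: "prob {\<omega>\<in>space M. \<exists>j\<in>{..2 ^ n}. \<epsilon> \<le> norm (res n j \<omega>)} \<le> prob (?A n) + prob (?B n)" for n
  proof -
    have "prob {\<omega>\<in>space M. \<exists>j\<in>{..2 ^ n}. \<epsilon> \<le> norm (res n j \<omega>)} \<le> prob (?A n \<union> ?B n)"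
    proof (rule finite_measure_mono)
      show "{\<omega>\<in>space M. \<exists>j\<in>{..2 ^ n}. \<epsilon> \<le> norm (res n j \<omega>)} \<subseteq> ?A n \<union> ?B n"
      proof safe
        fix \<omega> j assume \<omega>: "\<omega> \<in> space M" and j: "j \<le> (2::nat) ^ n" and le: "\<epsilon> \<le> norm (res n j \<omega>)"
          and nb: "\<not> (\<exists>j\<in>{..2 ^ n}. \<epsilon> / 2 \<le> norm (riemann H n j \<omega> - I (dy n j) \<omega>))"
        have "norm (riemann H n j \<omega> - I (dy n j) \<omega>) < \<epsilon> / 2" using nb j by (auto simp: not_le)
        then have "\<epsilon> / 2 \<le> norm (D n j \<omega>)"
          using le norm_triangle_ineq4[of "D n j \<omega>" "riemann H n j \<omega> - I (dy n j) \<omega>"]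
          unfolding res_eq by linarith
        then show "\<exists>j\<in>{..2 ^ n}. \<epsilon> / 2 \<le> norm (D n j \<omega>)" using j by auto
      qed
    qed (intro sets.Un A_ev B_ev)
    also have "\<dots> \<le> prob (?A n) + prob (?B n)" by (rule measure_Un_le[OF A_ev B_ev])
    finally show ?thesis .
  qed
  show ?thesis
    by (rule tendsto_sandwich[OF always_eventually always_eventually tendsto_const lim])
      (intro allI measure_nonneg, intro allI le)
qed

end

context sde_solution
begin

text \<open>The error \<open>xbar - euler\<close> is frozen (\<open>err\<close>) as soon as the accumulated squared residual of
  the solution exceeds \<open>\<delta>\<close>. Before that time Gronwall's argument controls its second moment by
  \<open>\<delta>\<close>, and the freezing has small probability by \<open>res_uniform\<close>; no moments of the solution are
  needed.\<close>

definition ctrl :: "real \<Rightarrow> nat \<Rightarrow> nat \<Rightarrow> 'w \<Rightarrow> bool" where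
  "ctrl \<delta> n i \<omega> \<longleftrightarrow> (\<Sum>j<Suc i. (norm (res n j \<omega>))\<^sup>2 * dt n) \<le> \<delta>"

definition bdiff :: "nat \<Rightarrow> nat \<Rightarrow> 'w \<Rightarrow> real^'d" where
  "bdiff n i \<omega> = \<mu> (X (dy n i) \<omega>) - \<mu> (euler n i \<omega>)"

definition cdiff :: "nat \<Rightarrow> nat \<Rightarrow> 'w \<Rightarrow> real^'m^'d" where
  "cdiff n i \<omega> = \<sigma> (X (dy n i) \<omega>) - \<sigma> (euler n i \<omega>)"

definition err :: "real \<Rightarrow> nat \<Rightarrow> nat \<Rightarrow> 'w \<Rightarrow> real^'d" where
  "err \<delta> n j \<omega> = (\<Sum>i<j. if ctrl \<delta> n i \<omega> then dt n *\<^sub>R bdiff n i \<omega> + cdiff n i \<omega> *v inc n i \<omega> else 0)"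

lemma xbar_minus_euler:
  "xbar n j \<omega> - euler n j \<omega> = (\<Sum>i<j. dt n *\<^sub>R bdiff n i \<omega> + cdiff n i \<omega> *v inc n i \<omega>)"
  by (induction j)
     (simp_all add: xbar_def bdiff_def cdiff_def matrix_vector_mult_diff_rdistrib algebra_simps)

lemma ctrl_mono:
  assumes "ctrl \<delta> n i \<omega>" "j \<le> i"
  shows "ctrl \<delta> n j \<omega>"
proof -
  have "(\<Sum>j<Suc j. (norm (res n j \<omega>))\<^sup>2 * dt n) \<le> (\<Sum>j<Suc i. (norm (res n j \<omega>))\<^sup>2 * dt n)"
    using assms(2) dt_pos[of n] by (intro sum_mono2) auto
  then show ?thesis using assms(1) unfolding ctrl_def by linarith
qed

lemma err_eq:
  assumes "\<And>i. i < j \<Longrightarrow> ctrl \<delta> n i \<omega>"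
  shows "err \<delta> n j \<omega> = xbar n j \<omega> - euler n j \<omega>"
  unfolding err_def xbar_minus_euler using assms by (intro sum.cong) auto

text \<open>While \<open>ctrl\<close> holds nothing has been frozen, so \<open>X - euler\<close>
  equals \<open>res + err\<close> and the Lipschitz bound applies.\<close>

lemma ctrl_coeff_le:
  assumes "ctrl \<delta> n i \<omega>"
  shows "(norm (bdiff n i \<omega>))\<^sup>2 \<le> 2 * lip_const\<^sup>2 * ((norm (res n i \<omega>))\<^sup>2 + (norm (err \<delta> n i \<omega>))\<^sup>2)"
    and "(norm (cdiff n i \<omega>))\<^sup>2 \<le> 2 * lip_const\<^sup>2 * ((norm (res n i \<omega>))\<^sup>2 + (norm (err \<delta> n i \<omega>))\<^sup>2)"
proof -
  have "err \<delta> n i \<omega> = xbar n i \<omega> - euler n i \<omega>"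
    using ctrl_mono[OF assms] by (intro err_eq) auto
  then have "X (dy n i) \<omega> - euler n i \<omega> = res n i \<omega> + err \<delta> n i \<omega>" by (simp add: res_def)
  then have le: "norm (X (dy n i) \<omega> - euler n i \<omega>) \<le> norm (res n i \<omega>) + norm (err \<delta> n i \<omega>)"
    using norm_triangle_ineq by metis
  have *: "z\<^sup>2 \<le> 2 * lip_const\<^sup>2 * ((norm (res n i \<omega>))\<^sup>2 + (norm (err \<delta> n i \<omega>))\<^sup>2)"
    if z: "0 \<le> z" "z \<le> lip_const * norm (X (dy n i) \<omega> - euler n i \<omega>)" for z
  proof -
    have "z \<le> lip_const * (norm (res n i \<omega>) + norm (err \<delta> n i \<omega>))"
      using mult_left_mono[OF le lip_const_nonneg] z by linarith
    then have "z\<^sup>2 \<le> (lip_const * (norm (res n i \<omega>) + norm (err \<delta> n i \<omega>)))\<^sup>2" using z by (intro power_mono)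
    also have "\<dots> = lip_const\<^sup>2 * (norm (res n i \<omega>) + norm (err \<delta> n i \<omega>))\<^sup>2" by (rule power_mult_distrib)
    also have "\<dots> \<le> lip_const\<^sup>2 * (2 * ((norm (res n i \<omega>))\<^sup>2 + (norm (err \<delta> n i \<omega>))\<^sup>2))"
      using sum_squares_bound[of "norm (res n i \<omega>)" "norm (err \<delta> n i \<omega>)"]
      by (intro mult_left_mono) (auto simp: power2_sum)
    finally show ?thesis by (simp add: algebra_simps)
  qed
  show "(norm (bdiff n i \<omega>))\<^sup>2 \<le> 2 * lip_const\<^sup>2 * ((norm (res n i \<omega>))\<^sup>2 + (norm (err \<delta> n i \<omega>))\<^sup>2)"
    "(norm (cdiff n i \<omega>))\<^sup>2 \<le> 2 * lip_const\<^sup>2 * ((norm (res n i \<omega>))\<^sup>2 + (norm (err \<delta> n i \<omega>))\<^sup>2)"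
    unfolding bdiff_def cdiff_def by (intro * norm_ge_zero lip)+
qed

text \<open>The sum in \<open>ctrl\<close> goes up to and including index \<open>i\<close>, and
  \<open>res n i\<close> is known at \<open>dy n i\<close>: freezing never looks ahead.\<close>

lemma ctrl_adapted: "i < 2 ^ n \<Longrightarrow> Measurable.pred (F (dy n i)) (ctrl \<delta> n i)"
proof -
  assume i: "i < 2 ^ n"
  have "res n j \<in> borel_measurable (F (dy n i))" if "j \<in> {..<Suc i}" for j
    using that i by (intro measurable_dy_mono[of j i] res_adapted) auto
  then have "(\<lambda>\<omega>. (norm (res n j \<omega>))\<^sup>2 * dt n) \<in> borel_measurable (F (dy n i))" if "j \<in> {..<Suc i}" for j
    using that by simp
  then have [measurable]: "(\<lambda>\<omega>. \<Sum>j<Suc i. (norm (res n j \<omega>))\<^sup>2 * dt n) \<in> borel_measurable (F (dy n i))"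
    by (rule borel_measurable_sum)
  show ?thesis unfolding ctrl_def[abs_def] by measurable
qed

lemma bdiff_adapted: "i \<le> 2 ^ n \<Longrightarrow> bdiff n i \<in> borel_measurable (F (dy n i))"
  unfolding bdiff_def[abs_def]
  by (intro borel_measurable_diff measurable_compose[OF _ measurable_\<mu>] X_dy_adapted euler_adapted)

lemma cdiff_adapted: "i \<le> 2 ^ n \<Longrightarrow> cdiff n i \<in> borel_measurable (F (dy n i))"
  unfolding cdiff_def[abs_def]
  by (intro borel_measurable_diff measurable_compose[OF _ measurable_\<sigma>] X_dy_adapted euler_adapted)

lemma err_adapted:
  assumes j: "j \<le> 2 ^ n"
  shows "err \<delta> n j \<in> borel_measurable (F (dy n j))"
proof -
  have "(\<lambda>\<omega>. if ctrl \<delta> n i \<omega> then dt n *\<^sub>R bdiff n i \<omega> + cdiff n i \<omega> *v inc n i \<omega> else 0)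
    \<in> borel_measurable (F (dy n j))" if "i \<in> {..<j}" for i
  proof -
    have i: "i < 2 ^ n" "i \<le> 2 ^ n" "i \<le> j" "Suc i \<le> j" using that j by auto
    have [measurable]: "Measurable.pred (F (dy n j)) (ctrl \<delta> n i)"
      "bdiff n i \<in> borel_measurable (F (dy n j))" "cdiff n i \<in> borel_measurable (F (dy n j))"
      "inc n i \<in> borel_measurable (F (dy n j))"
      by (rule measurable_dy_mono[OF i(3) j] measurable_dy_mono[OF i(4) j],
          rule ctrl_adapted[OF i(1)] bdiff_adapted[OF i(2)] cdiff_adapted[OF i(2)] inc_adapted[OF i(1)])+
    show ?thesis by measurable
  qed
  then show ?thesis unfolding err_def[abs_def] by (rule borel_measurable_sum)
qed

text \<open>The rate of one step in \<open>err_step\<close>: 1 from splitting the cross term of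
  error and drift, \<open>2 * lip_const\<^sup>2\<close> from \<open>ctrl_coeff_le\<close>, and
  \<open>2 + T\<close> from \<open>2 * dt n + (dt n)\<^sup>2 \<le> dt n * (2 + T)\<close>, drift and
  diffusion together.\<close>

definition errC :: real where "errC = 1 + (2 + T) * (2 * lip_const\<^sup>2)"

lemma errC_pos: "0 < errC"
  using T_pos by (simp add: errC_def add_pos_nonneg)

definition rho :: "real \<Rightarrow> nat \<Rightarrow> nat \<Rightarrow> 'w \<Rightarrow> real" where
  "rho \<delta> n i \<omega> = (if ctrl \<delta> n i \<omega> then (norm (res n i \<omega>))\<^sup>2 else 0)"

text \<open>\<open>rho\<close> is the squared residual cut off by \<open>ctrl\<close>. The bounds
  hold on every path, which gives integrability without moments of \<open>X\<close>: a nonzero last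
  term means that the whole sum obeys \<open>ctrl\<close>, and a zero one leaves the earlier bound
  in force.\<close>

lemma rho_bounds:
  assumes "0 \<le> \<delta>"
  shows "0 \<le> rho \<delta> n i \<omega>" "rho \<delta> n i \<omega> \<le> \<delta> / dt n" "(\<Sum>i<j. rho \<delta> n i \<omega> * dt n) \<le> \<delta>"
proof -
  show "0 \<le> rho \<delta> n i \<omega>" by (simp add: rho_def)
  show "rho \<delta> n i \<omega> \<le> \<delta> / dt n"
  proof (cases "ctrl \<delta> n i \<omega>")
    case True
    have "(norm (res n i \<omega>))\<^sup>2 * dt n \<le> (\<Sum>j<Suc i. (norm (res n j \<omega>))\<^sup>2 * dt n)"
      using dt_pos[of n] by (intro member_le_sum) auto
    also have "\<dots> \<le> \<delta>" using True by (simp add: ctrl_def)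
    finally show ?thesis using True dt_pos[of n] by (simp add: rho_def pos_le_divide_eq)
  qed (use assms dt_pos[of n] in \<open>auto simp: rho_def\<close>)
  show "(\<Sum>i<j. rho \<delta> n i \<omega> * dt n) \<le> \<delta>"
  proof (induction j)
    case (Suc j)
    show ?case
    proof (cases "ctrl \<delta> n j \<omega>")
      case True
      have "(\<Sum>i<Suc j. rho \<delta> n i \<omega> * dt n) \<le> (\<Sum>i<Suc j. (norm (res n i \<omega>))\<^sup>2 * dt n)"
        using dt_pos[of n] by (intro sum_mono mult_right_mono) (auto simp: rho_def)
      then show ?thesis using True by (simp add: ctrl_def)
    next
      case False
      then show ?thesis using Suc by (simp add: rho_def)
    qed
  qed (use assms in simp)
qed

lemma rho_integrable:
  assumes "0 \<le> \<delta>" "i < 2 ^ n"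
  shows "integrable M (rho \<delta> n i)"
proof (rule integrable_const_bound[where B="\<delta> / dt n"])
  have [measurable]: "Measurable.pred M (ctrl \<delta> n i)" "res n i \<in> borel_measurable M"
    using measurable_dy_M[OF _ ctrl_adapted[OF assms(2)]] measurable_dy_M[OF _ res_adapted] assms by auto
  show "rho \<delta> n i \<in> borel_measurable M" unfolding rho_def[abs_def] by measurable
qed (use rho_bounds[OF assms(1)] in auto)

text \<open>The increment term is handled by \<open>has_integral_sq_step\<close>, the drift by the
  square of a sum, and both stopped coefficients are dominated by \<open>q\<close>. The outcome is a
  linear recursion forced by \<open>rho\<close>.\<close>

lemma err_step:
  assumes \<delta>: "0 \<le> \<delta>" and i: "i < 2 ^ n" and int: "integrable M (\<lambda>\<omega>. (norm (err \<delta> n i \<omega>))\<^sup>2)"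
  shows "integrable M (\<lambda>\<omega>. (norm (err \<delta> n (Suc i) \<omega>))\<^sup>2)"
    and "expectation (\<lambda>\<omega>. (norm (err \<delta> n (Suc i) \<omega>))\<^sup>2) \<le>
      (1 + errC * dt n) * expectation (\<lambda>\<omega>. (norm (err \<delta> n i \<omega>))\<^sup>2) + errC * dt n * expectation (rho \<delta> n i)"
proof -
  let ?e = "err \<delta> n i" and ?D = "dt n"
  define b where "b \<omega> = (if ctrl \<delta> n i \<omega> then bdiff n i \<omega> else 0)" for \<omega>
  define c where "c \<omega> = (if ctrl \<delta> n i \<omega> then cdiff n i \<omega> else 0)" for \<omega>
  define Z where "Z \<omega> = ?e \<omega> + ?D *\<^sub>R b \<omega>" for \<omega>
  have i': "i \<le> 2 ^ n" using i by simp
  note [measurable] = ctrl_adapted[OF i] bdiff_adapted[OF i'] cdiff_adapted[OF i'] err_adapted[OF i']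
  have bF[measurable]: "b \<in> borel_measurable (F (dy n i))" and cF[measurable]: "c \<in> borel_measurable (F (dy n i))"
    unfolding b_def[abs_def] c_def[abs_def] by measurable
  have ZF: "Z \<in> borel_measurable (F (dy n i))" unfolding Z_def[abs_def] by measurable
  note mM[measurable] = measurable_dy_M[OF i' bF] measurable_dy_M[OF i' cF] measurable_dy_M[OF i' ZF]
  define q where "q \<omega> = 2 * lip_const\<^sup>2 * (rho \<delta> n i \<omega> + (norm (?e \<omega>))\<^sup>2)" for \<omega>
  have qint: "integrable M q" unfolding q_def[abs_def] using rho_integrable[OF \<delta> i] int by simp
  have q0: "0 \<le> q \<omega>" for \<omega> using rho_bounds(1)[OF \<delta>] by (simp add: q_def)
  have bq: "(norm (b \<omega>))\<^sup>2 \<le> q \<omega>" for \<omega>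
    using ctrl_coeff_le(1)[of \<delta> n i \<omega>] q0[of \<omega>] by (auto simp: b_def q_def rho_def)
  have cq: "(norm (c \<omega>))\<^sup>2 \<le> q \<omega>" for \<omega>
    using ctrl_coeff_le(2)[of \<delta> n i \<omega>] q0[of \<omega>] by (auto simp: c_def q_def rho_def)
  have Zle: "(norm (Z \<omega>))\<^sup>2 \<le> (1 + ?D) * (norm (?e \<omega>))\<^sup>2 + (?D + ?D\<^sup>2) * q \<omega>" for \<omega>
  proof -
    define x where "x = norm (?e \<omega>)"
    define y where "y = norm (b \<omega>)"
    have xy: "0 \<le> x" "0 \<le> y" by (auto simp: x_def y_def)
    have D: "0 < ?D" by (rule dt_pos)
    have "norm (Z \<omega>) \<le> x + ?D * y"
      unfolding Z_def x_def y_def using norm_triangle_ineq[of "?e \<omega>" "?D *\<^sub>R b \<omega>"] D by simp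
    then have "(norm (Z \<omega>))\<^sup>2 \<le> (x + ?D * y)\<^sup>2" by (intro power_mono) auto
    also have "\<dots> = x\<^sup>2 + ?D * (2 * x * y) + ?D\<^sup>2 * y\<^sup>2" by (simp add: power2_sum power_mult_distrib)
    also have "?D * (2 * x * y) \<le> ?D * (x\<^sup>2 + y\<^sup>2)"
      using sum_squares_bound[of x y] D by (intro mult_left_mono) auto
    also have "x\<^sup>2 + ?D * (x\<^sup>2 + y\<^sup>2) + ?D\<^sup>2 * y\<^sup>2 = (1 + ?D) * x\<^sup>2 + (?D + ?D\<^sup>2) * y\<^sup>2"
      by (simp add: algebra_simps)
    also have "\<dots> \<le> (1 + ?D) * x\<^sup>2 + (?D + ?D\<^sup>2) * q \<omega>"
      using bq[of \<omega>] D by (intro add_left_mono mult_left_mono) (auto simp: y_def)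
    finally show ?thesis by (simp add: x_def)
  qed
  have int2: "integrable M (\<lambda>\<omega>. (1 + ?D) * (norm (?e \<omega>))\<^sup>2 + (?D + ?D\<^sup>2) * q \<omega>)"
    using int qint by simp
  have Zint: "integrable M (\<lambda>\<omega>. (norm (Z \<omega>))\<^sup>2)"
    by (rule Bochner_Integration.integrable_bound[OF int2])
       (auto intro!: AE_I2 order_trans[OF Zle])
  have cint: "integrable M (\<lambda>\<omega>. (norm (c \<omega>))\<^sup>2)"
    by (rule Bochner_Integration.integrable_bound[OF qint]) (auto intro!: AE_I2 order_trans[OF cq])
  have "has_bochner_integral M (\<lambda>\<omega>. (norm (Z \<omega> + c \<omega> *v (W (dy n (Suc i)) \<omega> - W (dy n i) \<omega>)))\<^sup>2)
    (expectation (\<lambda>\<omega>. (norm (Z \<omega>))\<^sup>2) + (dy n (Suc i) - dy n i) * expectation (\<lambda>\<omega>. (norm (c \<omega>))\<^sup>2))"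
    by (rule has_integral_sq_step[OF dy_nonneg dy_le dy_le_T ZF cF Zint cint]) (use i in auto)
  also have "(\<lambda>\<omega>. (norm (Z \<omega> + c \<omega> *v (W (dy n (Suc i)) \<omega> - W (dy n i) \<omega>)))\<^sup>2) =
     (\<lambda>\<omega>. (norm (err \<delta> n (Suc i) \<omega>))\<^sup>2)"
  proof
    fix \<omega>
    have "err \<delta> n (Suc i) \<omega> = Z \<omega> + c \<omega> *v (W (dy n (Suc i)) \<omega> - W (dy n i) \<omega>)"
      unfolding Z_def b_def c_def inc_def[symmetric] by (simp add: err_def)
    then show "(norm (Z \<omega> + c \<omega> *v (W (dy n (Suc i)) \<omega> - W (dy n i) \<omega>)))\<^sup>2 = (norm (err \<delta> n (Suc i) \<omega>))\<^sup>2"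
      by simp
  qed
  finally have hb: "has_bochner_integral M (\<lambda>\<omega>. (norm (err \<delta> n (Suc i) \<omega>))\<^sup>2)
    (expectation (\<lambda>\<omega>. (norm (Z \<omega>))\<^sup>2) + ?D * expectation (\<lambda>\<omega>. (norm (c \<omega>))\<^sup>2))" unfolding dy_Suc_dt .
  show "integrable M (\<lambda>\<omega>. (norm (err \<delta> n (Suc i) \<omega>))\<^sup>2)" using hb by (rule integrable.intros)
  have D: "0 < ?D" "?D \<le> T" by (rule dt_pos dt_le_T)+
  define a where "a = expectation (\<lambda>\<omega>. (norm (?e \<omega>))\<^sup>2)"
  define r where "r = expectation (rho \<delta> n i)"
  have a0: "0 \<le> a" by (simp add: a_def)
  have r0: "0 \<le> r" using rho_bounds(1)[OF \<delta>] by (simp add: r_def)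
  have qE: "expectation q = 2 * lip_const\<^sup>2 * (r + a)"
    unfolding q_def[abs_def] a_def r_def using rho_integrable[OF \<delta> i] int by simp
  have "expectation (\<lambda>\<omega>. (norm (err \<delta> n (Suc i) \<omega>))\<^sup>2) =
      expectation (\<lambda>\<omega>. (norm (Z \<omega>))\<^sup>2) + ?D * expectation (\<lambda>\<omega>. (norm (c \<omega>))\<^sup>2)"
    using hb by (rule has_bochner_integral_integral_eq)
  also have "\<dots> \<le> expectation (\<lambda>\<omega>. (1 + ?D) * (norm (?e \<omega>))\<^sup>2 + (?D + ?D\<^sup>2) * q \<omega>) + ?D * expectation q"
    using D by (intro add_mono integral_mono mult_left_mono Zint int2 cint qint Zle cq) auto
  also have "\<dots> = (1 + ?D) * a + (2 * ?D + ?D\<^sup>2) * (2 * lip_const\<^sup>2 * (r + a))"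
    using int qint by (simp add: qE a_def algebra_simps)
  also have "\<dots> \<le> (1 + ?D) * a + (?D * (2 + T)) * (2 * lip_const\<^sup>2 * (r + a))"
    using D a0 r0 by (intro add_left_mono mult_right_mono) (auto simp: power2_eq_square algebra_simps)
  also have "\<dots> = (1 + errC * ?D) * a + (errC - 1) * ?D * r" by (simp add: errC_def algebra_simps)
  also have "\<dots> \<le> (1 + errC * ?D) * a + errC * ?D * r"
    using D r0 by (intro add_left_mono mult_right_mono) auto
  finally show "expectation (\<lambda>\<omega>. (norm (err \<delta> n (Suc i) \<omega>))\<^sup>2) \<le>
      (1 + errC * dt n) * expectation (\<lambda>\<omega>. (norm (err \<delta> n i \<omega>))\<^sup>2) + errC * dt n * expectation (rho \<delta> n i)"
    by (simp add: a_def r_def)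
qed

text \<open>Discrete Gronwall from initial error zero: the growth factors multiply to at most
  \<open>exp (errC * T)\<close>, and the accumulated forcing is at most
  \<open>errC * \<delta>\<close> by the pathwise bound on \<open>rho\<close>.\<close>

lemma err_moment:
  assumes \<delta>: "0 \<le> \<delta>" and j: "j \<le> 2 ^ n"
  shows "integrable M (\<lambda>\<omega>. (norm (err \<delta> n j \<omega>))\<^sup>2)"
    and "expectation (\<lambda>\<omega>. (norm (err \<delta> n j \<omega>))\<^sup>2) \<le> exp (errC * T) * (errC * \<delta>)"
proof -
  have D: "0 < dt n" by (rule dt_pos)
  have "integrable M (\<lambda>\<omega>. (norm (err \<delta> n j \<omega>))\<^sup>2) \<and>
    expectation (\<lambda>\<omega>. (norm (err \<delta> n j \<omega>))\<^sup>2) \<le> (1 + errC * dt n) ^ j * (\<Sum>i<j. errC * dt n * expectation (rho \<delta> n i))"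
    using j
  proof (induction j)
    case 0
    then show ?case by (simp add: err_def)
  next
    case (Suc j)
    then have j: "j < 2 ^ n" and IH: "integrable M (\<lambda>\<omega>. (norm (err \<delta> n j \<omega>))\<^sup>2)"
      "expectation (\<lambda>\<omega>. (norm (err \<delta> n j \<omega>))\<^sup>2) \<le> (1 + errC * dt n) ^ j * (\<Sum>i<j. errC * dt n * expectation (rho \<delta> n i))"
      by auto
    have C: "0 \<le> errC * dt n" using errC_pos D by simp
    have r0: "0 \<le> expectation (rho \<delta> n j)" using rho_bounds(1)[OF \<delta>] by simp
    have "expectation (\<lambda>\<omega>. (norm (err \<delta> n (Suc j) \<omega>))\<^sup>2) \<le>
      (1 + errC * dt n) * expectation (\<lambda>\<omega>. (norm (err \<delta> n j \<omega>))\<^sup>2) + errC * dt n * expectation (rho \<delta> n j)"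
      by (rule err_step(2)[OF \<delta> j IH(1)])
    also have "\<dots> \<le> (1 + errC * dt n) * ((1 + errC * dt n) ^ j * (\<Sum>i<j. errC * dt n * expectation (rho \<delta> n i)))
       + (1 + errC * dt n) ^ Suc j * (errC * dt n * expectation (rho \<delta> n j))"
    proof (intro add_mono mult_left_mono IH(2))
      have "1 \<le> (1 + errC * dt n) ^ Suc j" by (rule one_le_power) (use C in simp)
      then show "errC * dt n * expectation (rho \<delta> n j) \<le>
          (1 + errC * dt n) ^ Suc j * (errC * dt n * expectation (rho \<delta> n j))"
        using C r0 by (metis mult_le_cancel_right1 mult_nonneg_nonneg not_less)
    qed (use C in simp)
    also have "\<dots> = (1 + errC * dt n) ^ Suc j * (\<Sum>i<Suc j. errC * dt n * expectation (rho \<delta> n i))"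
      by (simp add: algebra_simps)
    finally show ?case using err_step(1)[OF \<delta> j IH(1)] by simp
  qed
  moreover have "(1 + errC * dt n) ^ j * (\<Sum>i<j. errC * dt n * expectation (rho \<delta> n i)) \<le> exp (errC * T) * (errC * \<delta>)"
  proof (intro mult_mono)
    have "(1 + errC * dt n) ^ j \<le> exp (errC * dt n) ^ j"
      using errC_pos D by (intro power_mono exp_ge_add_one_self) auto
    also have "\<dots> = exp (real j * (errC * dt n))" by (rule exp_of_nat_mult[symmetric])
    also have "\<dots> \<le> exp (errC * T)"
    proof -
      have "real j * dt n = dy n j" by (simp add: dt_def dy_def)
      then have "real j * (errC * dt n) = errC * dy n j" by (simp add: mult.left_commute)
      also have "\<dots> \<le> errC * T" using errC_pos dy_le_T[OF j] by (intro mult_left_mono) auto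
      finally show ?thesis by simp
    qed
    finally show "(1 + errC * dt n) ^ j \<le> exp (errC * T)" .
    have "(\<Sum>i<j. errC * dt n * expectation (rho \<delta> n i)) = errC * (\<Sum>i<j. expectation (\<lambda>\<omega>. rho \<delta> n i \<omega> * dt n))"
      by (simp add: sum_distrib_left mult_ac)
    also have "(\<Sum>i<j. expectation (\<lambda>\<omega>. rho \<delta> n i \<omega> * dt n)) = expectation (\<lambda>\<omega>. \<Sum>i<j. rho \<delta> n i \<omega> * dt n)"
      using j rho_integrable[OF \<delta>] by (intro Bochner_Integration.integral_sum[symmetric]) auto
    also have "\<dots> \<le> expectation (\<lambda>\<omega>. \<delta>)"
      using j rho_integrable[OF \<delta>] by (intro integral_mono rho_bounds(3)[OF \<delta>]) auto
    finally show "(\<Sum>i<j. errC * dt n * expectation (rho \<delta> n i)) \<le> errC * \<delta>"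
      using errC_pos by (simp add: prob_space)
    show "0 \<le> (\<Sum>i<j. errC * dt n * expectation (rho \<delta> n i))"
      using errC_pos D rho_bounds(1)[OF \<delta>] by (intro sum_nonneg mult_nonneg_nonneg integral_nonneg) auto
  qed simp
  ultimately show "integrable M (\<lambda>\<omega>. (norm (err \<delta> n j \<omega>))\<^sup>2)"
    "expectation (\<lambda>\<omega>. (norm (err \<delta> n j \<omega>))\<^sup>2) \<le> exp (errC * T) * (errC * \<delta>)" by linarith+
qed

lemma euler_tendsto:
  assumes \<epsilon>: "0 < \<epsilon>"
  shows "(\<lambda>n. prob {\<omega>\<in>space M. \<epsilon> \<le> norm (euler n (2 ^ n) \<omega> - X T \<omega>)}) \<longlonglongrightarrow> 0"
proof (rule LIMSEQ_I)
  fix \<eta> :: real assume \<eta>: "0 < \<eta>"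
  \<comment> \<open>With this \<open>C\<close>, the Chebyshev bound for \<open>err\<close> at level
    \<open>\<epsilon> / 2\<close> reads \<open>C * \<delta>\<close>; \<delta> makes it half of
    \<eta>.\<close>
  define C where "C = exp (errC * T) * errC / (\<epsilon> / 2)\<^sup>2"
  have C: "0 < C" using errC_pos \<epsilon> by (simp add: C_def)
  define \<delta> where "\<delta> = \<eta> / (2 * C)"
  have \<delta>: "0 < \<delta>" using \<eta> C by (simp add: \<delta>_def)
  \<comment> \<open>If all residuals are below \<kappa>, their squares accumulate to at most
    \<open>T * (\<delta> / T)\<close>, so \<open>ctrl\<close> never fails; moreover the last
    residual is below \<open>\<epsilon> / 2\<close>.\<close>
  define \<kappa> where "\<kappa> = min (\<epsilon> / 2) (sqrt (\<delta> / T))"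
  have \<kappa>: "0 < \<kappa>" using \<epsilon> \<delta> T_pos by (simp add: \<kappa>_def)
  let ?A = "\<lambda>n. {\<omega>\<in>space M. \<exists>j\<in>{..2 ^ n}. \<kappa> \<le> norm (res n j \<omega>)}"
  let ?B = "\<lambda>n. {\<omega>\<in>space M. (\<epsilon> / 2)\<^sup>2 \<le> (norm (err \<delta> n (2 ^ n) \<omega>))\<^sup>2}"
  obtain N where N: "\<And>n. n \<ge> N \<Longrightarrow> prob (?A n) < \<eta> / 2"
    using LIMSEQ_D[OF res_uniform[OF \<kappa>], of "\<eta> / 2"] \<eta> by auto
  have "prob {\<omega>\<in>space M. \<epsilon> \<le> norm (euler n (2 ^ n) \<omega> - X T \<omega>)} < \<eta>" if n: "n \<ge> N" for n
  proof -
    have eM: "err \<delta> n (2 ^ n) \<in> borel_measurable M"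
      by (rule measurable_dy_M[OF order_refl err_adapted[OF order_refl]])
    have rM: "res n j \<in> borel_measurable M" if "j \<in> {..2 ^ n}" for j
      using measurable_dy_M[OF _ res_adapted] that by simp
    have A: "?A n \<in> events"
    proof -
      have "?A n = (\<Union>j\<in>{..2 ^ n}. {\<omega>\<in>space M. \<kappa> \<le> norm (res n j \<omega>)})" by auto
      moreover have "{\<omega>\<in>space M. \<kappa> \<le> norm (res n j \<omega>)} \<in> events" if "j \<in> {..2 ^ n}" for j
        using rM[OF that] by simp
      ultimately show ?thesis by auto
    qed
    have B: "?B n \<in> events" using eM by simp
    have "prob {\<omega>\<in>space M. \<epsilon> \<le> norm (euler n (2 ^ n) \<omega> - X T \<omega>)} \<le> prob (?A n \<union> ?B n)"
    proof (rule finite_measure_mono)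
      show "{\<omega>\<in>space M. \<epsilon> \<le> norm (euler n (2 ^ n) \<omega> - X T \<omega>)} \<subseteq> ?A n \<union> ?B n"
      proof (rule subsetI, rule ccontr)
        fix \<omega> assume "\<omega> \<in> {\<omega>\<in>space M. \<epsilon> \<le> norm (euler n (2 ^ n) \<omega> - X T \<omega>)}" "\<omega> \<notin> ?A n \<union> ?B n"
        then have \<omega>: "\<omega> \<in> space M" "\<epsilon> \<le> norm (euler n (2 ^ n) \<omega> - X T \<omega>)"
          and small: "\<And>j. j \<le> 2 ^ n \<Longrightarrow> norm (res n j \<omega>) < \<kappa>"
          and e: "(norm (err \<delta> n (2 ^ n) \<omega>))\<^sup>2 < (\<epsilon> / 2)\<^sup>2"
          by (auto simp: not_le)
        have "ctrl \<delta> n i \<omega>" if i: "i < 2 ^ n" for i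
        proof -
          have "(norm (res n j \<omega>))\<^sup>2 \<le> \<delta> / T" if "j \<le> 2 ^ n" for j
          proof -
            have "norm (res n j \<omega>) \<le> sqrt (\<delta> / T)" using small[OF that] by (simp add: \<kappa>_def)
            then have "(norm (res n j \<omega>))\<^sup>2 \<le> (sqrt (\<delta> / T))\<^sup>2" by (intro power_mono) auto
            then show ?thesis using \<delta> T_pos by simp
          qed
          then have "(\<Sum>j<Suc i. (norm (res n j \<omega>))\<^sup>2 * dt n) \<le> (\<Sum>j<Suc i. \<delta> / T * dt n)"
            using i dt_pos[of n] by (intro sum_mono mult_right_mono) auto
          also have "\<dots> = dy n (Suc i) * (\<delta> / T)" by (simp add: dy_def dt_def algebra_simps)
          also have "\<dots> \<le> T * (\<delta> / T)" using dy_le_T[of "Suc i" n] i \<delta> T_pos by (intro mult_right_mono) auto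
          finally show ?thesis using T_pos by (simp add: ctrl_def)
        qed
        then have "err \<delta> n (2 ^ n) \<omega> = xbar n (2 ^ n) \<omega> - euler n (2 ^ n) \<omega>" by (rule err_eq)
        then have "X T \<omega> - euler n (2 ^ n) \<omega> = res n (2 ^ n) \<omega> + err \<delta> n (2 ^ n) \<omega>"
          by (simp add: res_def dy_last)
        then have "norm (X T \<omega> - euler n (2 ^ n) \<omega>) \<le> norm (res n (2 ^ n) \<omega>) + norm (err \<delta> n (2 ^ n) \<omega>)"
          using norm_triangle_ineq by metis
        moreover have "norm (res n (2 ^ n) \<omega>) < \<epsilon> / 2" using small[of "2 ^ n"] by (simp add: \<kappa>_def)
        moreover have "norm (err \<delta> n (2 ^ n) \<omega>) < \<epsilon> / 2"
          using e \<epsilon> by (intro power_less_imp_less_base[OF e]) simp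
        ultimately show False using \<omega>(2) by (simp add: norm_minus_commute)
      qed
    qed (rule sets.Un[OF A B])
    also have "\<dots> \<le> prob (?A n) + prob (?B n)" by (rule measure_Un_le[OF A B])
    also have "prob (?B n) \<le> expectation (\<lambda>\<omega>. (norm (err \<delta> n (2 ^ n) \<omega>))\<^sup>2) / (\<epsilon> / 2)\<^sup>2"
      by (rule integral_Markov_inequality_measure[OF err_moment(1)[OF less_imp_le[OF \<delta>] order_refl], of "{}"]) (use \<epsilon> \<delta> in auto)
    also have "\<dots> \<le> (exp (errC * T) * (errC * \<delta>)) / (\<epsilon> / 2)\<^sup>2"
      by (rule divide_right_mono[OF err_moment(2)]) (use \<delta> in auto)
    also have "\<dots> = C * \<delta>" by (simp add: C_def)
    also have "\<dots> = \<eta> / 2" using C by (simp add: \<delta>_def)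
    finally show ?thesis using N[OF n] by simp
  qed
  then show "\<exists>no. \<forall>n\<ge>no. norm (prob {\<omega>\<in>space M. \<epsilon> \<le> norm (euler n (2 ^ n) \<omega> - X T \<omega>)} - 0) < \<eta>"
    by auto
qed

end

section \<open>Moments of the Euler scheme\<close>

text \<open>The first order term is kept exactly because in the application it contains the
  mean-zero part; only the second order part may be estimated. \<open>-1 \<le> \<beta>\<close>
  allows multiplying the induction hypothesis by \<open>1 + \<beta>\<close>.\<close>

lemma power_one_plus_le:
  fixes \<beta> :: real
  assumes "-1 \<le> \<beta>"
  shows "(1 + \<beta>) ^ p \<le> 1 + real p * \<beta> + (real p)\<^sup>2 * \<beta>\<^sup>2 * (1 + \<bar>\<beta>\<bar>) ^ p"
proof (induction p)
  case (Suc p)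
  let ?P = "(1 + \<bar>\<beta>\<bar>) ^ p"
  have P: "1 \<le> ?P" by (rule one_le_power) simp
  then have P1: "1 \<le> ?P * (1 + \<bar>\<beta>\<bar>)" using mult_mono[of 1 ?P 1 "1 + \<bar>\<beta>\<bar>"] by simp
  have b2: "0 \<le> \<beta>\<^sup>2" by simp
  have "(1 + \<beta>) ^ Suc p \<le> (1 + real p * \<beta> + (real p)\<^sup>2 * \<beta>\<^sup>2 * ?P) * (1 + \<beta>)"
    using Suc assms by (simp add: mult.commute mult_left_mono)
  also have "\<dots> = 1 + real (Suc p) * \<beta> + real p * \<beta>\<^sup>2 + (real p)\<^sup>2 * \<beta>\<^sup>2 * (?P * (1 + \<beta>))"
    by (simp add: algebra_simps power2_eq_square)
  also have "\<dots> \<le> 1 + real (Suc p) * \<beta> + real p * \<beta>\<^sup>2 * (?P * (1 + \<bar>\<beta>\<bar>))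
      + (real p)\<^sup>2 * \<beta>\<^sup>2 * (?P * (1 + \<bar>\<beta>\<bar>))"
  proof (intro add_mono order_refl mult_left_mono)
    show "real p * \<beta>\<^sup>2 \<le> real p * \<beta>\<^sup>2 * (?P * (1 + \<bar>\<beta>\<bar>))"
      using mult_left_mono[OF P1, of "real p * \<beta>\<^sup>2"] by simp
  qed (use P in auto)
  also have "\<dots> = 1 + real (Suc p) * \<beta> + (real p + (real p)\<^sup>2) * (\<beta>\<^sup>2 * (?P * (1 + \<bar>\<beta>\<bar>)))"
    by (simp add: algebra_simps)
  also have "\<dots> \<le> 1 + real (Suc p) * \<beta> + (real (Suc p))\<^sup>2 * (\<beta>\<^sup>2 * (?P * (1 + \<bar>\<beta>\<bar>)))"
  proof (intro add_left_mono mult_right_mono)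
    show "real p + (real p)\<^sup>2 \<le> (real (Suc p))\<^sup>2" by (simp add: power2_eq_square algebra_simps)
    show "0 \<le> \<beta>\<^sup>2 * (?P * (1 + \<bar>\<beta>\<bar>))" using P1 by (intro mult_nonneg_nonneg) auto
  qed
  finally show ?case by (simp add: mult_ac)
qed simp

context sde
begin

definition growth_const :: real where "growth_const = lip_const + norm (\<mu> 0) + norm (\<sigma> 0)"

lemma growth_const_nonneg: "0 \<le> growth_const"
  using lip_const_nonneg by (simp add: growth_const_def)

lemma growth: "norm (\<mu> x) \<le> growth_const * (1 + norm x)" "norm (\<sigma> x) \<le> growth_const * (1 + norm x)"
proof -
  have "norm (\<mu> x) \<le> norm (\<mu> 0) + lip_const * norm x"
    using lip(1)[of x 0] norm_triangle_sub[of "\<mu> x" "\<mu> 0"] by simp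
  moreover have "norm (\<sigma> x) \<le> norm (\<sigma> 0) + lip_const * norm x"
    using lip(2)[of x 0] norm_triangle_sub[of "\<sigma> x" "\<sigma> 0"] by simp
  moreover have "0 \<le> norm (\<mu> 0) * norm x" "0 \<le> norm (\<sigma> 0) * norm x"
    "0 \<le> norm (\<mu> 0)" "0 \<le> norm (\<sigma> 0)" by simp_all
  moreover have "growth_const * (1 + norm x) = lip_const + norm (\<mu> 0) + norm (\<sigma> 0) + lip_const * norm x
      + norm (\<mu> 0) * norm x + norm (\<sigma> 0) * norm x"
    by (simp add: growth_const_def algebra_simps)
  ultimately show "norm (\<mu> x) \<le> growth_const * (1 + norm x)" "norm (\<sigma> x) \<le> growth_const * (1 + norm x)"
    using lip_const_nonneg by linarith+
qed

text \<open>\<open>qf D y\<close> is the coefficient of the Brownian increment in the relative change of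
  \<open>1 + |y|\<^sup>2\<close> during one Euler step of length \<open>D\<close>; its contribution has mean zero.\<close>

definition qf :: "real \<Rightarrow> real^'d \<Rightarrow> real^'m" where
  "qf D y = (2 / (1 + (norm y)\<^sup>2)) *\<^sub>R (transpose (\<sigma> y) *v (y + D *\<^sub>R \<mu> y))"

lemma qf_inner: "qf D y \<bullet> w = 2 * ((y + D *\<^sub>R \<mu> y) \<bullet> (\<sigma> y *v w)) / (1 + (norm y)\<^sup>2)"
  unfolding qf_def by (simp add: dot_lmul_matrix[symmetric])

text \<open>The relative change \<beta> of \<open>1 + |y|^2\<close> is the linear term
  \<open>qf D y \<bullet> w\<close> plus \<gamma>, which is of order D + |w|^2. Its square is of the
  same order up to a power of 1 + |w|, so \<open>power_one_plus_le\<close> leaves only the linear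
  term outside the remainder.\<close>

lemma euler_step_pointwise:
  "\<exists>C\<ge>0. \<forall>y w D. 0 \<le> D \<and> D \<le> T \<longrightarrow>
    (1 + (norm (y + D *\<^sub>R \<mu> y + \<sigma> y *v w))\<^sup>2) ^ p \<le> (1 + (norm y)\<^sup>2) ^ p *
      (1 + real p * (qf D y \<bullet> w) + C * ((D + (norm w)\<^sup>2) ^ 1 * (1 + norm w) ^ (2 * p + 2)))
    \<and> norm (qf D y) \<le> C"
proof -
  \<comment> \<open>1 + |y| is at most twice \<open>s\<close>, the root of 1 + |y|^2. Below,
    \<open>c1\<close> bounds \<gamma>, \<open>c2\<close> bounds \<open>qf\<close>, \<open>c3\<close>
    bounds the square of \<beta>, and \<open>c4\<close> bounds 1 + |\<beta>|.\<close>
  define k where "k = 2 * growth_const"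
  have k: "0 \<le> k" using growth_const_nonneg by (simp add: k_def)
  have T: "0 \<le> T" using T_pos by simp
  define c1 where "c1 = 2 * k + T * k\<^sup>2 + k\<^sup>2"
  define c2 where "c2 = 2 * k * (1 + T * k)"
  define c3 where "c3 = 2 * c2\<^sup>2 + 2 * c1\<^sup>2 * (1 + T)"
  define c4 where "c4 = 1 + c2 + c1 * (T + 1)"
  define C where "C = real p * c1 + (real p)\<^sup>2 * (c3 * c4 ^ p)"
  have c: "0 \<le> c1" "0 \<le> c2" "0 \<le> c3" "0 \<le> c4" using k T by (auto simp: c1_def c2_def c3_def c4_def)
  then have C: "0 \<le> C" by (simp add: C_def)
  have "(1 + (norm (y + D *\<^sub>R \<mu> y + \<sigma> y *v w))\<^sup>2) ^ p \<le> (1 + (norm y)\<^sup>2) ^ p *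
      (1 + real p * (qf D y \<bullet> w) + C * ((D + (norm w)\<^sup>2) * (1 + norm w) ^ (2 * p + 2)))
    \<and> norm (qf D y) \<le> c2" if D: "0 \<le> D" "D \<le> T" for y w D
  proof -
    define A where "A = 1 + (norm y)\<^sup>2"
    have A: "1 \<le> A" by (simp add: A_def)
    define s where "s = sqrt A"
    have s: "1 \<le> s" "s\<^sup>2 = A" "0 \<le> s" using A by (auto simp: s_def)
    have ys: "norm y \<le> s" unfolding s_def A_def by (rule real_le_rsqrt) simp
    have ms: "norm (\<mu> y) \<le> k * s" "norm (\<sigma> y) \<le> k * s"
    proof -
      have "growth_const * (1 + norm y) \<le> growth_const * (2 * s)" using s ys growth_const_nonneg by (intro mult_left_mono) auto
      then show "norm (\<mu> y) \<le> k * s" "norm (\<sigma> y) \<le> k * s" using growth[of y] by (auto simp: k_def)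
    qed
    define G where "G = 2 * D * (y \<bullet> \<mu> y) + D\<^sup>2 * (norm (\<mu> y))\<^sup>2 + (norm (\<sigma> y *v w))\<^sup>2"
    define \<gamma> where "\<gamma> = G / A"
    define \<beta> where "\<beta> = qf D y \<bullet> w + \<gamma>"
    have "(norm (y + D *\<^sub>R \<mu> y + \<sigma> y *v w))\<^sup>2 = (norm y)\<^sup>2 + 2 * ((y + D *\<^sub>R \<mu> y) \<bullet> (\<sigma> y *v w))
        + G"
      unfolding power2_norm_eq_inner G_def
      by (simp add: inner_add_left inner_add_right inner_commute power2_eq_square algebra_simps)
    then have eq: "1 + (norm (y + D *\<^sub>R \<mu> y + \<sigma> y *v w))\<^sup>2 = A * (1 + \<beta>)"
    proof -
      have "A * (1 + \<beta>) = A + 2 * ((y + D *\<^sub>R \<mu> y) \<bullet> (\<sigma> y *v w)) + G"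
        using A unfolding \<beta>_def \<gamma>_def qf_inner A_def[symmetric] by (simp add: distrib_left)
      then show ?thesis
        using \<open>(norm (y + D *\<^sub>R \<mu> y + \<sigma> y *v w))\<^sup>2 = _\<close> by (simp add: A_def)
    qed
    \<comment> \<open>Automatic, since \<open>A * (1 + \<beta>)\<close> is again one plus a squared
      norm.\<close>
    have b1: "-1 \<le> \<beta>"
    proof -
      have "0 \<le> A * (1 + \<beta>)" unfolding eq[symmetric] by simp
      then show ?thesis using A by (simp add: zero_le_mult_iff)
    qed
    have qn: "norm (qf D y) \<le> c2"
    proof -
      have "norm (y + D *\<^sub>R \<mu> y) \<le> norm y + D * norm (\<mu> y)"
        using norm_triangle_ineq[of y "D *\<^sub>R \<mu> y"] D by simp
      also have "\<dots> \<le> s + T * (k * s)"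
        using D ms s k ys by (intro add_mono mult_mono) auto
      finally have "norm (y + D *\<^sub>R \<mu> y) \<le> (1 + T * k) * s" by (simp add: algebra_simps)
      then have "norm (\<sigma> y) * norm (y + D *\<^sub>R \<mu> y) \<le> (k * s) * ((1 + T * k) * s)"
        using ms s k by (intro mult_mono) auto
      also have "\<dots> = c2 / 2 * A" unfolding s(2)[symmetric] by (simp add: c2_def power2_eq_square)
      finally have "norm (transpose (\<sigma> y) *v (y + D *\<^sub>R \<mu> y)) \<le> c2 / 2 * A"
        using norm_matrix_vector_mult_le[of "transpose (\<sigma> y)" "y + D *\<^sub>R \<mu> y"] unfolding norm_transpose by linarith
      then have "2 / A * norm (transpose (\<sigma> y) *v (y + D *\<^sub>R \<mu> y)) \<le> 2 / A * (c2 / 2 * A)"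
        using A by (intro mult_left_mono) auto
      then show ?thesis unfolding qf_def A_def[symmetric] using A by simp
    qed
    have g: "\<bar>\<gamma>\<bar> \<le> c1 * (D + (norm w)\<^sup>2)"
    proof -
      have m2: "(norm (\<mu> y))\<^sup>2 \<le> k\<^sup>2 * A"
        using power_mono[OF ms(1), of 2] s by (simp add: power_mult_distrib)
      have "norm (\<sigma> y *v w) \<le> k * s * norm w"
        using norm_matrix_vector_mult_le[of "\<sigma> y" w] mult_right_mono[OF ms(2), of "norm w"] by simp
      then have s2: "(norm (\<sigma> y *v w))\<^sup>2 \<le> k\<^sup>2 * A * (norm w)\<^sup>2"
        using power_mono[of _ _ 2] s by (fastforce simp: power_mult_distrib)
      have "\<bar>y \<bullet> \<mu> y\<bar> \<le> norm y * norm (\<mu> y)" by (rule Cauchy_Schwarz_ineq2)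
      also have "\<dots> \<le> s * (k * s)" using ys ms s by (intro mult_mono) auto
      finally have ym: "\<bar>y \<bullet> \<mu> y\<bar> \<le> k * A" unfolding s(2)[symmetric] by (simp add: power2_eq_square mult.left_commute)
      have "\<bar>2 * D * (y \<bullet> \<mu> y) + D\<^sup>2 * (norm (\<mu> y))\<^sup>2 + (norm (\<sigma> y *v w))\<^sup>2\<bar> \<le>
          2 * D * \<bar>y \<bullet> \<mu> y\<bar> + D\<^sup>2 * (norm (\<mu> y))\<^sup>2 + (norm (\<sigma> y *v w))\<^sup>2"
        using D by (simp add: abs_mult order_trans[OF abs_triangle_ineq])
      also have "\<dots> \<le> 2 * D * (k * A) + (D * T) * (k\<^sup>2 * A) + k\<^sup>2 * A * (norm w)\<^sup>2"
        using D ym m2 s2 T by (intro add_mono mult_mono) (auto simp: power2_eq_square mult_left_mono)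
      also have "\<dots> = ((2 * k + T * k\<^sup>2) * D + k\<^sup>2 * (norm w)\<^sup>2) * A" by (simp add: algebra_simps)
      also have "\<dots> \<le> (c1 * D + c1 * (norm w)\<^sup>2) * A"
        using k T A D by (intro mult_right_mono add_mono) (auto simp: c1_def)
      finally show ?thesis using A by (simp add: \<gamma>_def G_def abs_div_pos[symmetric] pos_divide_le_eq distrib_left)
    qed
    define v where "v = norm w"
    have v: "0 \<le> v" by (simp add: v_def)
    have qv: "\<bar>qf D y \<bullet> w\<bar> \<le> c2 * v"
      using order_trans[OF Cauchy_Schwarz_ineq2 mult_right_mono[OF qn norm_ge_zero]] by (simp add: v_def)
    have ab: "\<bar>\<beta>\<bar> \<le> c2 * v + c1 * (D + v\<^sup>2)"
      unfolding \<beta>_def using qv g by (simp add: v_def)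
    have Dv: "D + v\<^sup>2 \<le> (1 + T) * (1 + v)\<^sup>2"
    proof -
      have "D + v\<^sup>2 \<le> T * (1 + v)\<^sup>2 + (1 + v)\<^sup>2"
      proof (intro add_mono)
        have "1 \<le> (1 + v)\<^sup>2" using v by (intro one_le_power) auto
        then have "T * 1 \<le> T * (1 + v)\<^sup>2" using T by (intro mult_left_mono)
        then show "D \<le> T * (1 + v)\<^sup>2" using D by simp
      qed (use v in \<open>auto intro: power_mono\<close>)
      then show ?thesis by (simp add: algebra_simps)
    qed
    have b2: "\<beta>\<^sup>2 \<le> c3 * ((D + v\<^sup>2) * (1 + v)\<^sup>2)"
    proof -
      have "\<bar>\<beta>\<bar>\<^sup>2 \<le> (c2 * v + c1 * (D + v\<^sup>2))\<^sup>2" using ab by (intro power_mono) auto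
      also have "\<dots> \<le> 2 * (c2 * v)\<^sup>2 + 2 * (c1 * (D + v\<^sup>2))\<^sup>2"
        using sum_squares_bound[of "c2 * v" "c1 * (D + v\<^sup>2)"] by (simp add: power2_sum)
      also have "\<dots> = 2 * c2\<^sup>2 * (v\<^sup>2 * 1) + 2 * c1\<^sup>2 * ((D + v\<^sup>2) * (D + v\<^sup>2))"
        by (simp add: power_mult_distrib power2_eq_square)
      also have "\<dots> \<le> 2 * c2\<^sup>2 * ((D + v\<^sup>2) * (1 + v)\<^sup>2) + 2 * c1\<^sup>2 * ((D + v\<^sup>2) * ((1 + T) * (1 + v)\<^sup>2))"
        using D v Dv by (intro add_mono mult_left_mono mult_mono one_le_power) auto
      also have "\<dots> = c3 * ((D + v\<^sup>2) * (1 + v)\<^sup>2)" by (simp add: c3_def algebra_simps)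
      finally show ?thesis by simp
    qed
    have b4: "1 + \<bar>\<beta>\<bar> \<le> c4 * (1 + v)\<^sup>2"
    proof -
      have o: "1 \<le> (1 + v)\<^sup>2" using v by (intro one_le_power) auto
      have "v \<le> (1 + v)\<^sup>2" using v by (simp add: power2_sum)
      then have "1 + \<bar>\<beta>\<bar> \<le> (1 + v)\<^sup>2 + c2 * (1 + v)\<^sup>2 + c1 * ((1 + T) * (1 + v)\<^sup>2)"
        using o c(1,2) mult_left_mono[OF Dv c(1)] mult_left_mono[of v "(1 + v)\<^sup>2" c2] ab by linarith
      then show ?thesis by (simp add: c4_def algebra_simps)
    qed
    have "(1 + \<bar>\<beta>\<bar>) ^ p \<le> (c4 * (1 + v)\<^sup>2) ^ p" using b4 by (intro power_mono) auto
    then have "\<beta>\<^sup>2 * (1 + \<bar>\<beta>\<bar>) ^ p \<le> (c3 * ((D + v\<^sup>2) * (1 + v)\<^sup>2)) * (c4 * (1 + v)\<^sup>2) ^ p"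
      using c D v b2 by (intro mult_mono) auto
    also have "\<dots> = c3 * c4 ^ p * ((D + v\<^sup>2) * (1 + v) ^ (2 * p + 2))"
    proof -
      have "(c4 * x\<^sup>2) ^ p = c4 ^ p * x ^ (2 * p)" for x :: real
        by (simp add: power_mult_distrib power_mult)
      then show ?thesis by (simp only: power_add mult_ac)
    qed
    finally have bb: "\<beta>\<^sup>2 * (1 + \<bar>\<beta>\<bar>) ^ p \<le> c3 * c4 ^ p * ((D + v\<^sup>2) * (1 + v) ^ (2 * p + 2))" .
    have gg: "\<gamma> \<le> c1 * ((D + v\<^sup>2) * (1 + v) ^ (2 * p + 2))"
    proof -
      have "1 \<le> (1 + v) ^ (2 * p + 2)" using v by (intro one_le_power) auto
      then have "(D + v\<^sup>2) * 1 \<le> (D + v\<^sup>2) * (1 + v) ^ (2 * p + 2)" using D by (intro mult_left_mono) auto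
      then have "c1 * (D + v\<^sup>2) \<le> c1 * ((D + v\<^sup>2) * (1 + v) ^ (2 * p + 2))" using c by (intro mult_left_mono) auto
      then show ?thesis using g by (simp add: v_def)
    qed
    have "(1 + \<beta>) ^ p \<le> 1 + real p * (qf D y \<bullet> w + \<gamma>) + (real p)\<^sup>2 * (\<beta>\<^sup>2 * (1 + \<bar>\<beta>\<bar>) ^ p)"
      using power_one_plus_le[OF b1, of p] by (simp add: \<beta>_def mult.assoc)
    also have "\<dots> \<le> 1 + real p * (qf D y \<bullet> w + c1 * ((D + v\<^sup>2) * (1 + v) ^ (2 * p + 2)))
       + (real p)\<^sup>2 * (c3 * c4 ^ p * ((D + v\<^sup>2) * (1 + v) ^ (2 * p + 2)))"
      using gg bb by (intro add_mono mult_left_mono) auto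
    also have "\<dots> = 1 + real p * (qf D y \<bullet> w) + C * ((D + v\<^sup>2) * (1 + v) ^ (2 * p + 2))"
      by (simp add: C_def algebra_simps)
    finally have "A ^ p * (1 + \<beta>) ^ p \<le> A ^ p * (1 + real p * (qf D y \<bullet> w) + C * ((D + v\<^sup>2) * (1 + v) ^ (2 * p + 2)))"
      using A by (intro mult_left_mono) auto
    then show ?thesis using qn unfolding eq power_mult_distrib A_def[symmetric] v_def by simp
  qed
  note * = this
  show ?thesis
  proof (intro exI[of _ "C + c2"] conjI allI impI)
    fix y w D assume D: "0 \<le> D \<and> D \<le> T"
    have "(1 + (norm y)\<^sup>2) ^ p * (1 + real p * (qf D y \<bullet> w) + C * ((D + (norm w)\<^sup>2) * (1 + norm w) ^ (2 * p + 2)))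
      \<le> (1 + (norm y)\<^sup>2) ^ p * (1 + real p * (qf D y \<bullet> w) + (C + c2) * ((D + (norm w)\<^sup>2) ^ 1 * (1 + norm w) ^ (2 * p + 2)))"
      using c D by (intro mult_left_mono add_left_mono) (auto intro!: mult_right_mono)
    with * D show "(1 + (norm (y + D *\<^sub>R \<mu> y + \<sigma> y *v w))\<^sup>2) ^ p \<le> (1 + (norm y)\<^sup>2) ^ p *
      (1 + real p * (qf D y \<bullet> w) + (C + c2) * ((D + (norm w)\<^sup>2) ^ 1 * (1 + norm w) ^ (2 * p + 2)))"
      by (meson order_trans)
    show "norm (qf D y) \<le> C + c2" using *[of D y 0] D C by auto
  qed (use C c in auto)
qed

text \<open>The linear term of \<open>euler_step_pointwise\<close> has mean zero and the remainder
  is independent of the current position. Each step therefore multiplies the moment by at most 1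
  plus a constant times \<open>dt n\<close>; boundedness of \<xi> starts the induction.\<close>

lemma euler_moment:
  assumes \<xi>: "\<And>\<omega>. \<omega> \<in> space M \<Longrightarrow> norm (\<xi> \<omega>) \<le> B"
  shows "\<exists>C\<ge>0. \<forall>n. \<forall>i\<le>2 ^ n. integrable M (\<lambda>\<omega>. (1 + norm (euler n i \<omega>)) ^ p) \<and>
    expectation (\<lambda>\<omega>. (1 + norm (euler n i \<omega>)) ^ p) \<le> C"
proof -
  obtain C where C: "C \<ge> 0" and
    step: "\<And>y w D. 0 \<le> D \<Longrightarrow> D \<le> T \<Longrightarrow>
    (1 + (norm (y + D *\<^sub>R \<mu> y + \<sigma> y *v w))\<^sup>2) ^ p \<le> (1 + (norm y)\<^sup>2) ^ p *
      (1 + real p * (qf D y \<bullet> w) + C * ((D + (norm w)\<^sup>2) ^ 1 * (1 + norm w) ^ (2 * p + 2)))"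
    and qn: "\<And>y D. 0 \<le> D \<Longrightarrow> D \<le> T \<Longrightarrow> norm (qf D y) \<le> C"
    using euler_step_pointwise[of p] by blast
  define Rw where "Rw D w = (D + (norm w)\<^sup>2) ^ 1 * (1 + norm w) ^ (2 * p + 2)" for D :: real and w :: "real^'m"
  from increment_poly_moment[of 1 "2 * p + 2"] obtain K' where K': "K' \<ge> 0"
    and Ri: "\<And>s t. 0 \<le> s \<Longrightarrow> s \<le> t \<Longrightarrow> t \<le> T \<Longrightarrow> integrable M (\<lambda>\<omega>. Rw (t - s) (W t \<omega> - W s \<omega>))"
    and RE: "\<And>s t. 0 \<le> s \<Longrightarrow> s \<le> t \<Longrightarrow> t \<le> T \<Longrightarrow> expectation (\<lambda>\<omega>. Rw (t - s) (W t \<omega> - W s \<omega>)) \<le> K' * (t - s) ^ 1"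
    unfolding Rw_def by blast
  have [measurable]: "qf D \<in> borel_measurable borel" for D
    unfolding qf_def[abs_def] by measurable
  have B: "0 \<le> B" using \<xi> not_empty norm_ge_zero order_trans by blast
  define E0 where "E0 = (1 + B\<^sup>2) ^ p"
  have E0: "0 \<le> E0" by (simp add: E0_def)
  have main: "integrable M (\<lambda>\<omega>. (1 + (norm (euler n i \<omega>))\<^sup>2) ^ p) \<and>
    expectation (\<lambda>\<omega>. (1 + (norm (euler n i \<omega>))\<^sup>2) ^ p) \<le> (1 + C * K' * dt n) ^ i * E0" if "i \<le> 2 ^ n" for n i
    using that
  proof (induction i)
    case 0
    have [measurable]: "\<xi> \<in> borel_measurable M"
      using F_meas_M[of 0 \<xi> borel] \<xi>_meas T_pos by simp
    have le: "(1 + (norm (\<xi> \<omega>))\<^sup>2) ^ p \<le> E0" if "\<omega> \<in> space M" for \<omega>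
      unfolding E0_def using \<xi>[OF that] by (intro power_mono add_left_mono) auto
    have int: "integrable M (\<lambda>\<omega>. (1 + (norm (\<xi> \<omega>))\<^sup>2) ^ p)"
      by (rule integrable_const_bound[where B=E0]) (auto intro!: AE_I2 le)
    then have "expectation (\<lambda>\<omega>. (1 + (norm (\<xi> \<omega>))\<^sup>2) ^ p) \<le> expectation (\<lambda>_. E0)"
      by (intro integral_mono le) auto
    then show ?case using int by (simp add: prob_space)
  next
    case (Suc i)
    then have i: "i < 2 ^ n" "i \<le> 2 ^ n" and IH: "integrable M (\<lambda>\<omega>. (1 + (norm (euler n i \<omega>))\<^sup>2) ^ p)"
      "expectation (\<lambda>\<omega>. (1 + (norm (euler n i \<omega>))\<^sup>2) ^ p) \<le> (1 + C * K' * dt n) ^ i * E0" by auto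
    have st: "0 \<le> dy n i" "dy n i \<le> dy n (Suc i)" "dy n (Suc i) \<le> T"
      using dy_nonneg dy_le dy_le_T Suc.prems by auto
    have D: "0 \<le> dt n" "dt n \<le> T" using dt_pos[of n] dt_le_T[of n] by auto
    define A where "A \<omega> = (1 + (norm (euler n i \<omega>))\<^sup>2) ^ p" for \<omega>
    define R where "R = Rw (dt n)"
    have [measurable]: "R \<in> borel_measurable borel" unfolding R_def Rw_def[abs_def] by measurable
    have A0: "0 \<le> A \<omega>" for \<omega> by (simp add: A_def)
    have eF[measurable]: "euler n i \<in> borel_measurable (F (dy n i))" by (rule euler_adapted[OF i(2)])
    have [measurable]: "euler n (Suc i) \<in> borel_measurable M"
      by (rule measurable_dy_M[OF Suc.prems euler_adapted[OF Suc.prems]])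
    have AF[measurable]: "A \<in> borel_measurable (F (dy n i))" unfolding A_def[abs_def] by measurable
    have Aint: "integrable M A" using IH(1) unfolding A_def[abs_def] .
    have Rint: "integrable M (\<lambda>\<omega>. R (inc n i \<omega>))" and RE': "expectation (\<lambda>\<omega>. R (inc n i \<omega>)) \<le> K' * dt n"
      using Ri[OF st] RE[OF st] unfolding R_def dy_Suc_dt inc_def by auto
    define v where "v \<omega> = A \<omega> *\<^sub>R qf (dt n) (euler n i \<omega>)" for \<omega>
    have vF: "v \<in> borel_measurable (F (dy n i))" unfolding v_def[abs_def] by measurable
    have vM[measurable]: "v \<in> borel_measurable M" by (rule measurable_dy_M[OF i(2) vF])
    have vint: "integrable M (\<lambda>\<omega>. v \<omega> $ k)" for k
    proof (rule Bochner_Integration.integrable_bound[OF integrable_mult_right[OF Aint, of C]])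
      show "AE \<omega> in M. norm (v \<omega> $ k) \<le> norm (C * A \<omega>)"
      proof (rule AE_I2)
        fix \<omega>
        have "\<bar>v \<omega> $ k\<bar> \<le> norm (v \<omega>)" by (rule component_le_norm_cart)
        also have "\<dots> \<le> A \<omega> * C" using qn[OF D] A0[of \<omega>] by (simp add: v_def mult_left_mono)
        finally show "norm (v \<omega> $ k) \<le> norm (C * A \<omega>)" using A0[of \<omega>] C by (simp add: mult.commute)
      qed
    qed simp
    have lin: "has_bochner_integral M (\<lambda>\<omega>. v \<omega> \<bullet> inc n i \<omega>) 0"
      unfolding inc_def by (rule has_integral_linear_increment[OF st vF vint])
    have ARint: "integrable M (\<lambda>\<omega>. A \<omega> * R (inc n i \<omega>))"
      and ARE: "expectation (\<lambda>\<omega>. A \<omega> * R (inc n i \<omega>)) = expectation A * expectation (\<lambda>\<omega>. R (inc n i \<omega>))"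
      using integrable_mult_increment[OF st AF Aint, of R] expectation_mult_increment[OF st AF Aint, of R] Rint
      unfolding inc_def by auto
    let ?U = "\<lambda>\<omega>. A \<omega> + real p * (v \<omega> \<bullet> inc n i \<omega>) + C * (A \<omega> * R (inc n i \<omega>))"
    have le: "(1 + (norm (euler n (Suc i) \<omega>))\<^sup>2) ^ p \<le> ?U \<omega>" for \<omega>
      using step[OF D, of "euler n i \<omega>" "inc n i \<omega>"]
      by (simp add: A_def v_def R_def Rw_def algebra_simps)
    have Uint: "integrable M ?U" using Aint ARint lin by (auto simp: has_bochner_integral_iff)
    have int: "integrable M (\<lambda>\<omega>. (1 + (norm (euler n (Suc i) \<omega>))\<^sup>2) ^ p)"
      by (rule Bochner_Integration.integrable_bound[OF Uint])
         (auto intro!: AE_I2 order_trans[OF le] simp del: euler.simps)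
    have "expectation (\<lambda>\<omega>. (1 + (norm (euler n (Suc i) \<omega>))\<^sup>2) ^ p) \<le> expectation ?U"
      by (intro integral_mono int Uint le)
    also have "\<dots> = expectation A + C * (expectation A * expectation (\<lambda>\<omega>. R (inc n i \<omega>)))"
      using Aint ARint lin ARE by (simp add: has_bochner_integral_iff)
    also have "\<dots> \<le> expectation A + C * (expectation A * (K' * dt n))"
      using RE' C A0 by (intro add_left_mono mult_left_mono integral_nonneg) auto
    also have "\<dots> = (1 + C * K' * dt n) * expectation A" by (simp add: algebra_simps)
    also have "\<dots> \<le> (1 + C * K' * dt n) * ((1 + C * K' * dt n) ^ i * E0)"
      using IH(2) C K' D unfolding A_def[abs_def] by (intro mult_left_mono) auto
    finally show ?case using int by (simp add: mult.assoc del: euler.simps)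
  qed
  have ex: "(1 + C * K' * dt n) ^ i \<le> exp (C * K' * T)" if "i \<le> 2 ^ n" for n i
  proof -
    have "(1 + C * K' * dt n) ^ i \<le> exp (C * K' * dt n) ^ i"
      using C K' dt_pos[of n] by (intro power_mono exp_ge_add_one_self) auto
    also have "\<dots> = exp (real i * (C * K' * dt n))" by (rule exp_of_nat_mult[symmetric])
    also have "\<dots> \<le> exp (C * K' * T)"
    proof -
      have "real i * dt n = dy n i" by (simp add: dt_def dy_def)
      then have "real i * (C * K' * dt n) = C * K' * dy n i" by (simp add: mult.left_commute)
      also have "\<dots> \<le> C * K' * T" using C K' dy_le_T[OF that] by (intro mult_left_mono) auto
      finally show ?thesis by simp
    qed
    finally show ?thesis .
  qed
  have cmp: "(1 + norm y) ^ p \<le> 2 ^ p * (1 + (norm y)\<^sup>2) ^ p" for y :: "real^'d"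
  proof -
    have "1 + z \<le> 2 * (1 + z\<^sup>2)" for z :: real
    proof -
      have "0 \<le> (z - 1)\<^sup>2" "0 \<le> z\<^sup>2" by simp_all
      moreover have "(z - 1)\<^sup>2 = z\<^sup>2 - 2 * z + 1" by (simp add: power2_diff)
      ultimately show ?thesis by argo
    qed
    note this[of "norm y"]
    then have "(1 + norm y) ^ p \<le> (2 * (1 + (norm y)\<^sup>2)) ^ p" by (intro power_mono) auto
    then show ?thesis by (simp only: power_mult_distrib)
  qed
  show ?thesis
  proof (intro exI[of _ "2 ^ p * (exp (C * K' * T) * E0)"] conjI allI impI)
    show "0 \<le> 2 ^ p * (exp (C * K' * T) * E0)" using E0 by simp
    fix n i assume i: "i \<le> (2::nat) ^ n"
    have [measurable]: "euler n i \<in> borel_measurable M" by (rule measurable_dy_M[OF i euler_adapted[OF i]])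
    have int: "integrable M (\<lambda>\<omega>. 2 ^ p * (1 + (norm (euler n i \<omega>))\<^sup>2) ^ p)" using main[OF i] by simp
    show int1: "integrable M (\<lambda>\<omega>. (1 + norm (euler n i \<omega>)) ^ p)"
      by (rule Bochner_Integration.integrable_bound[OF int]) (auto intro!: AE_I2 order_trans[OF cmp])
    have "expectation (\<lambda>\<omega>. (1 + norm (euler n i \<omega>)) ^ p) \<le> expectation (\<lambda>\<omega>. 2 ^ p * (1 + (norm (euler n i \<omega>))\<^sup>2) ^ p)"
      by (intro integral_mono int int1 cmp)
    also have "\<dots> \<le> 2 ^ p * ((1 + C * K' * dt n) ^ i * E0)" using main[OF i] by simp
    also have "\<dots> \<le> 2 ^ p * (exp (C * K' * T) * E0)"
      using ex[OF i] E0 by (intro mult_left_mono mult_right_mono) auto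
    finally show "expectation (\<lambda>\<omega>. (1 + norm (euler n i \<omega>)) ^ p) \<le> 2 ^ p * (exp (C * K' * T) * E0)" .
  qed
qed

end

section \<open>Taylor expansion with polynomially growing remainder\<close>

lemma has_derivative_grad:
  assumes "f differentiable (at x)"
  shows "(f has_derivative (\<lambda>h. grad f x \<bullet> h)) (at x)"
proof -
  let ?f' = "frechet_derivative f (at x)"
  have d: "(f has_derivative ?f') (at x)" using assms by (simp add: frechet_derivative_works)
  then have lin: "linear ?f'" by (rule has_derivative_linear)
  have "?f' h = grad f x \<bullet> h" for h
  proof -
    have "?f' h = ?f' (\<Sum>i\<in>UNIV. (h $ i) *s axis i 1)" by (simp only: basis_expansion)
    also have "\<dots> = (\<Sum>i\<in>UNIV. h $ i * ?f' (axis i 1))"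
      by (simp add: linear_sum[OF lin] linear_cmul[OF lin] scalar_mult_eq_scaleR)
    also have "\<dots> = grad f x \<bullet> h" by (simp add: grad_def inner_vec_def mult.commute)
    finally show ?thesis .
  qed
  then have "?f' = (\<lambda>h. grad f x \<bullet> h)" by auto
  with d show ?thesis by simp
qed

lemma has_derivative_hess:
  assumes "grad f differentiable (at x)"
  shows "(grad f has_derivative (\<lambda>h. hess f x *v h)) (at x)"
  using assms unfolding hess_def jacobian_works by simp

lemma mean_value_grad:
  assumes "\<And>x. f differentiable (at x)"
  shows "\<exists>z. norm z \<le> norm D \<and> f (y + D) = f y + grad f (y + z) \<bullet> D"
proof -
  have "((\<lambda>s. f (y + s *\<^sub>R D)) has_derivative (\<lambda>h. h * (grad f (y + s *\<^sub>R D) \<bullet> D))) (at s within S)" for s S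
    by (rule has_derivative_eq_rhs[OF has_derivative_compose[OF _ has_derivative_grad[OF assms]]])
       (auto intro!: derivative_eq_intros)
  from mvt_very_simple[of 0 1 "\<lambda>s. f (y + s *\<^sub>R D)", OF _ this]
  obtain s where "s \<in> {0..1}" "f (y + D) - f y = grad f (y + s *\<^sub>R D) \<bullet> D" by auto
  then show ?thesis by (intro exI[of _ "s *\<^sub>R D"]) (auto simp: mult_left_le_one_le)
qed

text \<open>One-dimensional Taylor expansion along the segment from \<open>y\<close> to
  \<open>y + D\<close>.\<close>

lemma taylor_hess:
  assumes f: "\<And>x. f differentiable (at x)" "\<And>x. grad f differentiable (at x)"
  shows "\<exists>z. norm z \<le> norm D \<and> f (y + D) = f y + grad f y \<bullet> D + 1/2 * (D \<bullet> (hess f (y + z) *v D))"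
proof -
  \<comment> \<open>\<open>Taylor_up\<close> takes the derivatives as a family indexed by their
    order; orders 0, 1 and 2 are used, so the last branch may cover everything above 1.\<close>
  define df :: "nat \<Rightarrow> real \<Rightarrow> real" where "df m s = (if m = 0 then f (y + s *\<^sub>R D) else if m = 1 then grad f (y + s *\<^sub>R D) \<bullet> D
    else D \<bullet> (hess f (y + s *\<^sub>R D) *v D))" for m s
  have D0: "DERIV (df 0) s :> df 1 s" for s
  proof -
    have "((\<lambda>s. f (y + s *\<^sub>R D)) has_derivative (\<lambda>h. (grad f (y + s *\<^sub>R D) \<bullet> D) * h)) (at s)"
      by (rule has_derivative_eq_rhs[OF has_derivative_compose[OF _ has_derivative_grad[OF f(1)]]])
         (auto intro!: derivative_eq_intros)
    then show ?thesis unfolding has_field_derivative_def df_def by simp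
  qed
  have D1: "DERIV (df 1) s :> df 2 s" for s
  proof -
    have "((\<lambda>s. grad f (y + s *\<^sub>R D)) has_derivative (\<lambda>h. hess f (y + s *\<^sub>R D) *v (h *\<^sub>R D))) (at s)"
      by (rule has_derivative_compose[OF _ has_derivative_hess[OF f(2)]]) (auto intro!: derivative_eq_intros)
    from has_derivative_inner_left[OF this, of D]
    have "((\<lambda>s. grad f (y + s *\<^sub>R D) \<bullet> D) has_derivative (\<lambda>h. (D \<bullet> (hess f (y + s *\<^sub>R D) *v D)) * h)) (at s)"
      by (simp add: matrix_vector_mult_scaleR mult.commute inner_commute)
    then show ?thesis unfolding has_field_derivative_def df_def by simp
  qed
  have "DERIV (df m) t :> df (Suc m) t" if "m < 2" for m t
  proof -
    have "m = 0 \<or> m = 1" using that by linarith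
    then show ?thesis
    proof
      assume "m = 0"
      then show ?thesis using D0[of t] by simp
    next
      assume "m = 1"
      then show ?thesis using D1[of t] by (simp add: numeral_2_eq_2)
    qed
  qed
  then have "\<forall>m t. m < 2 \<and> 0 \<le> t \<and> t \<le> 1 \<longrightarrow> DERIV (df m) t :> df (Suc m) t" by blast
  moreover have "df 0 = (\<lambda>s. f (y + s *\<^sub>R D))" by (auto simp: df_def)
  ultimately have "\<exists>t. 0 < t \<and> t < 1 \<and> f (y + 1 *\<^sub>R D) =
      (\<Sum>m<2. df m 0 / fact m * (1 - 0) ^ m) + df 2 t / fact 2 * (1 - 0) ^ 2"
    by (intro Taylor_up[of 2 df "\<lambda>s. f (y + s *\<^sub>R D)" 0 1 0]) auto
  then obtain t where t: "0 < t" "t < 1" "f (y + D) = (\<Sum>m<2. df m 0 / fact m) + df 2 t / fact 2"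
    by auto
  have "f (y + D) = f y + grad f y \<bullet> D + 1/2 * (D \<bullet> (hess f (y + t *\<^sub>R D) *v D))"
    unfolding t(3) by (simp add: df_def numeral_2_eq_2)
  then show ?thesis using t by (intro exI[of _ "t *\<^sub>R D"]) (auto simp: mult_left_le_one_le)
qed

lemma mean_value_time:
  assumes d: "\<And>t. t \<in> {0..T} \<Longrightarrow> (\<lambda>s. u s x) differentiable (at t within {0..T})"
    and s: "0 \<le> D" "D \<le> s" "s \<le> T"
  shows "\<exists>t\<in>{s - D..s}. u (s - D) x - u s x = - D * time_deriv T u t x"
proof -
  have "((\<lambda>s. u s x) has_derivative (\<lambda>h. h * time_deriv T u t x)) (at t within {s - D..s})"
    if "s - D \<le> t" "t \<le> s" for t
  proof -
    have "((\<lambda>s. u s x) has_vector_derivative time_deriv T u t x) (at t within {0..T})"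
      using d[of t] that s unfolding time_deriv_def by (simp add: vector_derivative_works)
    then have "((\<lambda>s. u s x) has_derivative (\<lambda>h. h * time_deriv T u t x)) (at t within {0..T})"
      by (simp add: has_vector_derivative_def)
    then show ?thesis by (rule has_derivative_subset) (use s in auto)
  qed
  from mvt_very_simple[of "s - D" s "\<lambda>s. u s x", OF _ this] s
  obtain t where "t \<in> {s - D..s}" "u s x - u (s - D) x = D * time_deriv T u t x" by auto
  then show ?thesis by (intro bexI[of _ t]) auto
qed

text \<open>Three regimes. For large \<open>x\<close> the one extra power of the growth factor beats
  the crude bound; for a large displacement the constant \<open>C\<close> does; in the remaining
  case the points lie in a compact set, where uniform continuity gives \<epsilon>.\<close>

lemma poly_growth_modulus:
  fixes f :: "real \<Rightarrow> 'a::euclidean_space \<Rightarrow> 'e::real_normed_vector"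
  assumes cont: "continuous_on ({0..T} \<times> UNIV) (\<lambda>(t, x). f t x)"
    and bound: "\<And>t x. t \<in> {0..T} \<Longrightarrow> norm (f t x) \<le> c * (1 + norm x) ^ m" and c: "0 < c" and \<epsilon>: "0 < \<epsilon>"
  shows "\<exists>C\<ge>0. \<forall>s\<in>{0..T}. \<forall>s'\<in>{0..T}. \<forall>x z. norm (f s' (x + z) - f s x) \<le>
    (1 + norm x + norm z) ^ Suc m * (\<epsilon> + C * (\<bar>s' - s\<bar> + (norm z)\<^sup>2))"
proof -
  \<comment> \<open>Beyond this radius the crude bound \<open>2 * c\<close> is at most \<epsilon>
    times one growth factor.\<close>
  define R where "R = 2 * c / \<epsilon>"
  have R: "0 < R" using c \<epsilon> by (simp add: R_def)
  have "uniformly_continuous_on ({0..T} \<times> cball 0 (R + 1)) (\<lambda>(t, x). f t x)"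
    by (rule compact_uniformly_continuous[OF continuous_on_subset[OF cont]]) (auto intro: compact_Times)
  then obtain d where d: "0 < d" and
    uc: "\<And>p p'. p \<in> {0..T} \<times> cball 0 (R + 1) \<Longrightarrow> p' \<in> {0..T} \<times> cball 0 (R + 1) \<Longrightarrow> dist p' p < d \<Longrightarrow>
      dist ((\<lambda>(t, x). f t x) p') ((\<lambda>(t, x). f t x) p) < \<epsilon>"
    using \<epsilon> unfolding uniformly_continuous_on_def by meson
  \<comment> \<open>\<open>r \<le> 1\<close> gives \<open>r\<^sup>2 \<le> r\<close> and keeps the
    shifted point in the ball of radius \<open>R + 1\<close>; time and space shifts below
    \<open>r\<close> add up to less than \<open>d\<close>. Then \<open>C\<close> satisfies
    \<open>C * r\<^sup>2 = 2 * c\<close>.\<close>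
  define r where "r = min 1 (d / 2)"
  have r: "0 < r" "r \<le> 1" "2 * r \<le> d" using d by (auto simp: r_def)
  define C where "C = 2 * c / r\<^sup>2"
  have C: "0 \<le> C" using c r by (simp add: C_def)
  have "norm (f s' (x + z) - f s x) \<le> (1 + norm x + norm z) ^ Suc m * (\<epsilon> + C * (\<bar>s' - s\<bar> + (norm z)\<^sup>2))"
    if s: "s \<in> {0..T}" "s' \<in> {0..T}" for s s' x z
  proof -
    define P where "P = 1 + norm x + norm z"
    have P: "1 \<le> P" by (simp add: P_def)
    then have P1: "1 \<le> P ^ Suc m" by (rule one_le_power)
    have h: "0 \<le> \<bar>s' - s\<bar> + (norm z)\<^sup>2" by simp
    have crude: "norm (f s' (x + z) - f s x) \<le> 2 * c * P ^ m"
    proof -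
      have "(1 + norm (x + z)) ^ m \<le> P ^ m"
        using norm_triangle_ineq[of x z] by (intro power_mono) (auto simp: P_def)
      moreover have "(1 + norm x) ^ m \<le> P ^ m" by (intro power_mono) (auto simp: P_def)
      ultimately have "c * (1 + norm (x + z)) ^ m + c * (1 + norm x) ^ m \<le> c * P ^ m + c * P ^ m"
        using c by (intro add_mono mult_left_mono) auto
      then show ?thesis
        using norm_triangle_ineq4[of "f s' (x + z)" "f s x"] bound[OF s(2), of "x + z"] bound[OF s(1), of x] by linarith
    qed
    consider "R < norm x" | "r\<^sup>2 \<le> \<bar>s' - s\<bar> + (norm z)\<^sup>2" | "norm x \<le> R" "\<bar>s' - s\<bar> + (norm z)\<^sup>2 < r\<^sup>2" by linarith
    then have "norm (f s' (x + z) - f s x) \<le> P ^ Suc m * (\<epsilon> + C * (\<bar>s' - s\<bar> + (norm z)\<^sup>2))"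
    proof cases
      case 1
      have "2 * c = R * \<epsilon>" using \<epsilon> by (simp add: R_def)
      also have "R \<le> P" using 1 norm_ge_zero[of z] unfolding P_def by linarith
      then have "R * \<epsilon> \<le> P * \<epsilon>" using \<epsilon> by (intro mult_right_mono) auto
      finally have "2 * c * P ^ m \<le> P * \<epsilon> * P ^ m" using P by (intro mult_right_mono) auto
      also have "\<dots> = P ^ Suc m * \<epsilon>" by simp
      also have "\<dots> \<le> P ^ Suc m * (\<epsilon> + C * (\<bar>s' - s\<bar> + (norm z)\<^sup>2))"
        using P C h by (intro mult_left_mono) auto
      finally show ?thesis using crude by linarith
    next
      case 2
      have "2 * c = C * r\<^sup>2" using r by (simp add: C_def)
      also have "\<dots> \<le> C * (\<bar>s' - s\<bar> + (norm z)\<^sup>2)" using 2 C by (intro mult_left_mono)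
      finally have "2 * c \<le> \<epsilon> + C * (\<bar>s' - s\<bar> + (norm z)\<^sup>2)" using \<epsilon> by linarith
      then have "2 * c * P ^ m \<le> (\<epsilon> + C * (\<bar>s' - s\<bar> + (norm z)\<^sup>2)) * P ^ Suc m"
        using P c by (intro mult_mono power_increasing) auto
      then show ?thesis using crude by (simp add: mult.commute)
    next
      case 3
      have "\<bar>s' - s\<bar> < r\<^sup>2" "(norm z)\<^sup>2 < r\<^sup>2" using 3(2) zero_le_power2[of "norm z"] abs_ge_zero[of "s' - s"] by linarith+
      moreover have "r\<^sup>2 \<le> r" using r by (simp add: power2_eq_square mult_le_cancel_left1)
      ultimately have sm: "\<bar>s' - s\<bar> < r" "norm z < r" using r by (auto intro: power_less_imp_less_base)
      have "dist (s', x + z) (s, x) \<le> \<bar>s' - s\<bar> + norm z"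
        unfolding dist_prod_def using sqrt_sum_squares_le_sum_abs[of "dist s' s" "dist (x + z) x"]
        by (simp add: dist_real_def dist_norm)
      also have "\<dots> < d" using sm r by linarith
      finally have near: "dist (s', x + z) (s, x) < d" .
      have "norm (x + z) \<le> R + 1" using norm_triangle_ineq[of x z] 3(1) sm r by linarith
      then have "(s, x) \<in> {0..T} \<times> cball 0 (R + 1)" "(s', x + z) \<in> {0..T} \<times> cball 0 (R + 1)"
        using s 3(1) by (auto simp: mem_cball_0)
      from uc[OF this near] have "norm (f s' (x + z) - f s x) < \<epsilon>" by (simp add: dist_norm)
      also have "\<epsilon> \<le> 1 * (\<epsilon> + C * (\<bar>s' - s\<bar> + (norm z)\<^sup>2))" using mult_nonneg_nonneg[OF C h] by simp
      also have "\<dots> \<le> P ^ Suc m * (\<epsilon> + C * (\<bar>s' - s\<bar> + (norm z)\<^sup>2))"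
        using P1 \<epsilon> mult_nonneg_nonneg[OF C h] by (intro mult_right_mono) auto
      finally show ?thesis by simp
    qed
    then show ?thesis by (simp add: P_def)
  qed
  then show ?thesis using C by blast
qed

text \<open>The real exponent is rounded up to a natural number, possible since the base is at least
  1, so that integer moments of the Euler scheme suffice.\<close>

lemma poly_growing_partial_derivsE:
  assumes "poly_growing_partial_derivs T u"
  obtains c m where "0 < c"
    "\<And>t x. t \<in> {0..T} \<Longrightarrow> \<bar>time_deriv T u t x\<bar> \<le> c * (1 + norm x) ^ m"
    "\<And>t x. t \<in> {0..T} \<Longrightarrow> norm (grad (u t) x) \<le> c * (1 + norm x) ^ m"
    "\<And>t x. t \<in> {0..T} \<Longrightarrow> norm (hess (u t) x) \<le> c * (1 + norm x) ^ m"
proof -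
  from assms obtain c where c: "1 \<le> c" and
    b: "\<And>t x. t \<in> {0..T} \<Longrightarrow> \<bar>time_deriv T u t x\<bar> \<le> c * (1 + norm x) powr c"
    "\<And>t x. t \<in> {0..T} \<Longrightarrow> norm (grad (u t) x) \<le> c * (1 + norm x) powr c"
    "\<And>t x. t \<in> {0..T} \<Longrightarrow> norm (hess (u t) x) \<le> c * (1 + norm x) powr c"
    unfolding poly_growing_partial_derivs_def by blast
  define m where "m = nat \<lceil>c\<rceil>"
  have p: "c * (1 + norm x) powr c \<le> c * (1 + norm x) ^ m" for x :: "real^'a"
  proof -
    have "(1 + norm x) powr c \<le> (1 + norm x) powr real m"
      by (intro powr_mono) (auto simp: m_def real_nat_ceiling_ge)
    also have "\<dots> = (1 + norm x) ^ m" by (intro powr_realpow) (simp add: add_pos_nonneg)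
    finally show ?thesis using c by (intro mult_left_mono) auto
  qed
  show ?thesis
    by (rule that[of c m]) (use c in linarith, (rule order_trans[OF b(1) p] order_trans[OF b(2) p] order_trans[OF b(3) p]; assumption)+)
qed

text \<open>The step is split into a time step at the shifted point and a space step at time
  \<open>s\<close>, so that no mixed derivatives appear. Replacing intermediate points by
  \<open>(s, y)\<close> costs the modulus of \<open>poly_growth_modulus\<close>. The exponent
  \<open>q\<close> does not depend on \<epsilon>, so one moment bound serves all \<epsilon>.\<close>

lemma C12_taylor:
  assumes u: "C12 T u" and g: "poly_growing_partial_derivs T u"
  shows "\<exists>q. \<forall>\<epsilon>>0. \<exists>C\<ge>0. \<forall>s D y z. 0 \<le> D \<and> D \<le> s \<and> s \<le> T \<longrightarrow>
    \<bar>u (s - D) (y + z) - u s y - (- D * time_deriv T u s y + grad (u s) y \<bullet> z + 1/2 * (z \<bullet> (hess (u s) y *v z)))\<bar>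
    \<le> (D + (norm z)\<^sup>2) * (1 + norm y + norm z) ^ q * (\<epsilon> + C * (D + (norm z)\<^sup>2))"
proof -
  obtain c m where c: "0 < c" and
    b: "\<And>t x. t \<in> {0..T} \<Longrightarrow> \<bar>time_deriv T u t x\<bar> \<le> c * (1 + norm x) ^ m"
    "\<And>t x. t \<in> {0..T} \<Longrightarrow> norm (grad (u t) x) \<le> c * (1 + norm x) ^ m"
    "\<And>t x. t \<in> {0..T} \<Longrightarrow> norm (hess (u t) x) \<le> c * (1 + norm x) ^ m"
    using g by (rule poly_growing_partial_derivsE) blast
  from u have ct: "continuous_on ({0..T} \<times> UNIV) (\<lambda>(t, x). time_deriv T u t x)"
    and ch: "continuous_on ({0..T} \<times> UNIV) (\<lambda>(t, x). hess (u t) x)"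
    and d: "\<And>t x. t \<in> {0..T} \<Longrightarrow> (\<lambda>s. u s x) differentiable (at t within {0..T})"
      "\<And>t x. t \<in> {0..T} \<Longrightarrow> u t differentiable (at x)" "\<And>t x. t \<in> {0..T} \<Longrightarrow> grad (u t) differentiable (at x)"
    unfolding C12_def by auto
  have "\<exists>C\<ge>0. \<forall>s D y z. 0 \<le> D \<and> D \<le> s \<and> s \<le> T \<longrightarrow>
    \<bar>u (s - D) (y + z) - u s y - (- D * time_deriv T u s y + grad (u s) y \<bullet> z + 1/2 * (z \<bullet> (hess (u s) y *v z)))\<bar>
    \<le> (D + (norm z)\<^sup>2) * (1 + norm y + norm z) ^ Suc m * (\<epsilon> + C * (D + (norm z)\<^sup>2))" if \<epsilon>: "0 < \<epsilon>" for \<epsilon>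
  proof -
    obtain C1 where C1: "0 \<le> C1" "\<And>s s' x z. s \<in> {0..T} \<Longrightarrow> s' \<in> {0..T} \<Longrightarrow>
      norm (time_deriv T u s' (x + z) - time_deriv T u s x) \<le>
      (1 + norm x + norm z) ^ Suc m * (\<epsilon> + C1 * (\<bar>s' - s\<bar> + (norm z)\<^sup>2))"
      using poly_growth_modulus[OF ct _ c \<epsilon>, of m] b(1) by auto
    obtain C2 where C2: "0 \<le> C2" "\<And>s s' x z. s \<in> {0..T} \<Longrightarrow> s' \<in> {0..T} \<Longrightarrow>
      norm (hess (u s') (x + z) - hess (u s) x) \<le>
      (1 + norm x + norm z) ^ Suc m * (\<epsilon> + C2 * (\<bar>s' - s\<bar> + (norm z)\<^sup>2))"
      using poly_growth_modulus[of T "\<lambda>t. hess (u t)", OF ch _ c \<epsilon>, of m] b(3) by auto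
    define C where "C = C1 + C2"
    have C: "0 \<le> C" "C1 \<le> C" "C2 \<le> C" using C1 C2 by (auto simp: C_def)
    have "\<bar>u (s - D) (y + z) - u s y - (- D * time_deriv T u s y + grad (u s) y \<bullet> z + 1/2 * (z \<bullet> (hess (u s) y *v z)))\<bar>
      \<le> (D + (norm z)\<^sup>2) * (1 + norm y + norm z) ^ Suc m * (\<epsilon> + C * (D + (norm z)\<^sup>2))"
      if s: "0 \<le> D" "D \<le> s" "s \<le> T" for s D y z
    proof -
      have sT: "s \<in> {0..T}" using s by auto
      define B where "B = (1 + norm y + norm z) ^ Suc m * (\<epsilon> + C * (D + (norm z)\<^sup>2))"
      have mono: "(1 + norm y + norm z') ^ Suc m * (\<epsilon> + C' * (D' + (norm z')\<^sup>2)) \<le> B"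
        if "norm z' \<le> norm z" "0 \<le> D'" "D' \<le> D" "0 \<le> C'" "C' \<le> C" for z' :: "real^'a" and D' C'
      proof -
        have "C' * (D' + (norm z')\<^sup>2) \<le> C * (D + (norm z)\<^sup>2)"
          using that by (intro mult_mono add_mono power_mono) auto
        moreover have "0 \<le> C' * (D' + (norm z')\<^sup>2)" using that by simp
        ultimately show ?thesis unfolding B_def
          using that \<epsilon> by (intro mult_mono power_mono add_mono) auto
      qed
      obtain t where t: "t \<in> {s - D..s}" "u (s - D) (y + z) - u s (y + z) = - D * time_deriv T u t (y + z)"
        using mean_value_time[of T u "y + z", OF d(1) s] by blast
      have tT: "t \<in> {0..T}" using t s by auto
      obtain z' where z': "norm z' \<le> norm z"
        "u s (y + z) = u s y + grad (u s) y \<bullet> z + 1/2 * (z \<bullet> (hess (u s) (y + z') *v z))"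
        using taylor_hess[OF d(2)[OF sT] d(3)[OF sT]] by blast
      have e1: "\<bar>time_deriv T u t (y + z) - time_deriv T u s y\<bar> \<le> B"
        using C1(2)[OF sT tT, of y z] mono[of z "\<bar>t - s\<bar>" C1] t C1(1) C(2) by auto
      have "norm (hess (u s) (y + z') - hess (u s) y) \<le> B"
        using C2(2)[OF sT sT, of y z'] mono[of z' "\<bar>s - s\<bar>" C2] z'(1) C2(1) C(3) s by auto
      then have "norm ((hess (u s) (y + z') - hess (u s) y) *v z) \<le> B * norm z"
        by (meson mult_right_mono norm_ge_zero norm_matrix_vector_mult_le order_trans)
      then have "norm z * norm ((hess (u s) (y + z') - hess (u s) y) *v z) \<le> norm z * (B * norm z)"
        by (intro mult_left_mono) auto
      then have e2: "\<bar>z \<bullet> ((hess (u s) (y + z') - hess (u s) y) *v z)\<bar> \<le> B * (norm z)\<^sup>2"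
        using Cauchy_Schwarz_ineq2[of z "(hess (u s) (y + z') - hess (u s) y) *v z"]
        by (simp add: power2_eq_square mult_ac)
      have "u (s - D) (y + z) - u s y - (- D * time_deriv T u s y + grad (u s) y \<bullet> z + 1/2 * (z \<bullet> (hess (u s) y *v z)))
        = - D * (time_deriv T u t (y + z) - time_deriv T u s y)
          + 1/2 * (z \<bullet> ((hess (u s) (y + z') - hess (u s) y) *v z))"
        using t(2) z'(2) by (simp add: algebra_simps matrix_vector_mult_diff_rdistrib inner_diff_right)
      also have "\<bar>\<dots>\<bar> \<le> D * \<bar>time_deriv T u t (y + z) - time_deriv T u s y\<bar>
          + 1/2 * \<bar>z \<bullet> ((hess (u s) (y + z') - hess (u s) y) *v z)\<bar>"
        using s(1) by (intro order_trans[OF abs_triangle_ineq]) (simp add: abs_mult)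
      also have "\<dots> \<le> D * B + 1/2 * (B * (norm z)\<^sup>2)"
        using e1 e2 s(1) by (intro add_mono mult_left_mono) auto
      also have "\<dots> \<le> (D + (norm z)\<^sup>2) * B"
      proof -
        have "0 \<le> B" using e1 abs_ge_zero order_trans by blast
        then have "0 \<le> B * (norm z)\<^sup>2" by simp
        then show ?thesis by (simp add: algebra_simps)
      qed
      finally show ?thesis unfolding B_def by (simp add: mult.assoc)
    qed
    then show ?thesis using C(1) by blast
  qed
  then show ?thesis by blast
qed

text \<open>The growth hypothesis concerns derivatives only. The mean value theorem from the origin
  bounds \<open>u t\<close>, with \<open>u t 0\<close> bounded by continuity on the compact time
  interval.\<close>

lemma C12_poly_bound:
  assumes u: "C12 T u" and g: "poly_growing_partial_derivs T u"
  shows "\<exists>c m. 0 < c \<and> (\<forall>t\<in>{0..T}. \<forall>x. \<bar>u t x\<bar> \<le> c * (1 + norm x) ^ m)"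
proof -
  obtain c m where c: "0 < c" and
    "\<And>t x. t \<in> {0..T} \<Longrightarrow> \<bar>time_deriv T u t x\<bar> \<le> c * (1 + norm x) ^ m" and
    b: "\<And>t x. t \<in> {0..T} \<Longrightarrow> norm (grad (u t) x) \<le> c * (1 + norm x) ^ m" and
    "\<And>t x. t \<in> {0..T} \<Longrightarrow> norm (hess (u t) x) \<le> c * (1 + norm x) ^ m"
    using g by (rule poly_growing_partial_derivsE) blast
  have cu: "continuous_on ({0..T} \<times> UNIV) (\<lambda>(t, x). u t x)" using u unfolding C12_def by blast
  have "continuous_on {0..T} (\<lambda>t. (t, 0::real^'a))" by (intro continuous_intros)
  from continuous_on_compose2[OF cu this] have "continuous_on {0..T} (\<lambda>t. u t 0)" by auto
  then have "bounded ((\<lambda>t. u t 0) ` {0..T})"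
    by (simp add: compact_continuous_image compact_imp_bounded)
  then obtain B where "0 < B" and B: "\<forall>y\<in>(\<lambda>t. u t 0) ` {0..T}. norm y \<le> B" unfolding bounded_pos by blast
  have "\<bar>u t x\<bar> \<le> (B + c) * (1 + norm x) ^ Suc m" if t: "t \<in> {0..T}" for t x
  proof -
    have d: "u t differentiable (at x)" for x using u t unfolding C12_def by blast
    obtain z where z: "norm z \<le> norm x" "u t (0 + x) = u t 0 + grad (u t) (0 + z) \<bullet> x"
      using mean_value_grad[OF d] by blast
    have "c * (1 + norm z) ^ m \<le> c * (1 + norm x) ^ m"
      using z(1) c by (intro mult_left_mono power_mono) auto
    then have "norm (grad (u t) z) \<le> c * (1 + norm x) ^ m" using b[OF t, of z] by linarith
    then have "norm (grad (u t) z) * norm x \<le> (c * (1 + norm x) ^ m) * (1 + norm x)"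
      using c by (intro mult_mono) auto
    then have "\<bar>grad (u t) z \<bullet> x\<bar> \<le> c * (1 + norm x) ^ Suc m"
      using Cauchy_Schwarz_ineq2[of "grad (u t) z" x] by (simp add: mult_ac)
    moreover have "\<bar>u t 0\<bar> \<le> B * (1 + norm x) ^ Suc m"
    proof -
      have "1 \<le> (1 + norm x) ^ Suc m" by (rule one_le_power) simp
      then have "B * 1 \<le> B * (1 + norm x) ^ Suc m" using \<open>0 < B\<close> by (intro mult_left_mono) auto
      moreover have "\<bar>u t 0\<bar> \<le> B" using B t by simp
      ultimately show ?thesis by linarith
    qed
    ultimately show ?thesis using z(2) abs_triangle_ineq[of "u t 0" "grad (u t) z \<bullet> x"]
      unfolding distrib_right by simp
  qed
  then show ?thesis using \<open>0 < B\<close> c by (intro exI[of _ "B + c"] exI[of _ "Suc m"]) auto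
qed

section \<open>Weak convergence of the Euler scheme\<close>

lemma C12_slices:
  assumes "C12 T u" and t: "t \<in> {0..T}"
  shows "continuous_on UNIV (u t)" "continuous_on UNIV (grad (u t))" "continuous_on UNIV (hess (u t))"
    "continuous_on UNIV (time_deriv T u t)"
proof -
  have *: "continuous_on UNIV (f t)" if f: "continuous_on ({0..T} \<times> UNIV) (\<lambda>(t, x). f t x)"
    for f :: "real \<Rightarrow> real^'a \<Rightarrow> 'e::real_normed_vector"
  proof -
    have c: "continuous_on UNIV (\<lambda>x::real^'a. (t, x))" by (intro continuous_intros)
    have "range (\<lambda>x::real^'a. (t, x)) \<subseteq> {0..T} \<times> UNIV" using t by auto
    from continuous_on_compose2[OF f c this] show ?thesis by simp
  qed
  show "continuous_on UNIV (u t)" "continuous_on UNIV (grad (u t))" "continuous_on UNIV (hess (u t))"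
    "continuous_on UNIV (time_deriv T u t)"
    using assms(1) *[of "\<lambda>t. u t"] *[of "\<lambda>t. grad (u t)"] *[of "\<lambda>t. hess (u t)"] *[of "\<lambda>t. time_deriv T u t"]
    unfolding C12_def by auto
qed

text \<open>The second order Taylor polynomial of \<open>u\<close> along one Euler step: the backward equation
  cancels all terms of order \<open>D\<close> in mean, since \<open>E (w \<bullet> Q w) = D tr Q\<close> for an increment \<open>w\<close>
  over a time interval of length \<open>D\<close>.\<close>

lemma generator_identity:
  fixes S :: "real^'m^'d" and H :: "real^'d^'d" and b g :: "real^'d"
  assumes td: "td = 1/2 * trace (S ** transpose S ** H) + b \<bullet> g"
  shows "- D * td + g \<bullet> (D *\<^sub>R b + S *v w) + 1/2 * ((D *\<^sub>R b + S *v w) \<bullet> (H *v (D *\<^sub>R b + S *v w))) =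
    1/2 * D\<^sup>2 * (b \<bullet> (H *v b))
    + (transpose S *v g + (D / 2) *\<^sub>R (transpose S *v (transpose H *v b + H *v b))) \<bullet> w
    + (w \<bullet> (((1/2) *\<^sub>R (transpose S ** H ** S)) *v w) - D * trace ((1/2) *\<^sub>R (transpose S ** H ** S)))"
proof -
  have tr: "trace ((1/2) *\<^sub>R (transpose S ** H ** S)) = 1/2 * trace (S ** transpose S ** H)"
  proof -
    have "trace (transpose S ** H ** S) = trace (S ** (transpose S ** H))" by (rule trace_mul_sym)
    moreover have "trace ((1/2) *\<^sub>R B) = 1/2 * trace B" for B :: "real^'m^'m"
      by (simp add: trace_def sum_divide_distrib)
    ultimately show ?thesis by (simp only: matrix_mul_assoc)
  qed
  have ts: "(transpose S *v x) \<bullet> w = x \<bullet> (S *v w)" for x by (simp add: dot_lmul_matrix[symmetric])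
  have th: "(transpose H *v x) \<bullet> y = x \<bullet> (H *v y)" for x y by (simp add: dot_lmul_matrix[symmetric])
  have q: "w \<bullet> (((1/2) *\<^sub>R (transpose S ** H ** S)) *v w) = 1/2 * ((S *v w) \<bullet> (H *v (S *v w)))"
  proof -
    have "w \<bullet> ((transpose S ** H ** S) *v w) = (transpose S *v (H *v (S *v w))) \<bullet> w"
      by (simp add: matrix_vector_mul_assoc matrix_mul_assoc inner_commute)
    then show ?thesis unfolding ts by (simp add: scaleR_matrix_vector_assoc[symmetric] inner_commute)
  qed
  show ?thesis
    unfolding tr q td inner_add_left inner_scaleR_left ts th
    by (simp add: inner_add_left inner_add_right matrix_vector_right_distrib matrix_vector_mult_scaleR
        inner_commute[of b g] inner_commute[of "S *v w" "H *v b"] power2_eq_square algebra_simps)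
qed

context sde
begin

text \<open>Bounds the Taylor remainder of an Euler step by position times increment. By linear
  growth each of the two factors D + |z|^2 costs (1 + |y|)^2, hence the exponent
  \<open>q + 4\<close>; the separated form allows factoring the expectation.\<close>

lemma remainder_pointwise:
  "\<exists>c\<ge>0. \<forall>y w D \<epsilon> C. 0 \<le> D \<and> D \<le> T \<and> 0 \<le> \<epsilon> \<and> 0 \<le> C \<longrightarrow>
    (D + (norm (D *\<^sub>R \<mu> y + \<sigma> y *v w))\<^sup>2) * (1 + norm y + norm (D *\<^sub>R \<mu> y + \<sigma> y *v w)) ^ q *
      (\<epsilon> + C * (D + (norm (D *\<^sub>R \<mu> y + \<sigma> y *v w))\<^sup>2))
    \<le> c * (1 + norm y) ^ (q + 4) * (\<epsilon> * ((D + (norm w)\<^sup>2) ^ 1 * (1 + norm w) ^ q)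
        + C * ((D + (norm w)\<^sup>2) ^ 2 * (1 + norm w) ^ q))"
proof -
  define c5 where "c5 = 1 + 2 * growth_const\<^sup>2 * (T + 1)"
  define c6 where "c6 = 1 + growth_const * (1 + T)"
  have T: "0 \<le> T" using T_pos by simp
  have c: "1 \<le> c5" "0 \<le> c6" using T growth_const_nonneg by (auto simp: c5_def c6_def)
  have "(D + (norm (D *\<^sub>R \<mu> y + \<sigma> y *v w))\<^sup>2) * (1 + norm y + norm (D *\<^sub>R \<mu> y + \<sigma> y *v w)) ^ q *
      (\<epsilon> + C * (D + (norm (D *\<^sub>R \<mu> y + \<sigma> y *v w))\<^sup>2))
    \<le> (c5 * c6 ^ q * c5) * (1 + norm y) ^ (q + 4) * (\<epsilon> * ((D + (norm w)\<^sup>2) ^ 1 * (1 + norm w) ^ q)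
        + C * ((D + (norm w)\<^sup>2) ^ 2 * (1 + norm w) ^ q))"
    if h: "0 \<le> D" "D \<le> T" "0 \<le> \<epsilon>" "0 \<le> C" for y w D \<epsilon> C
  proof -
    define z where "z = norm (D *\<^sub>R \<mu> y + \<sigma> y *v w)"
    define P where "P = 1 + norm y"
    define v where "v = norm w"
    define d where "d = D + v\<^sup>2"
    have P: "1 \<le> P" and v: "0 \<le> v" and z0: "0 \<le> z" and d: "0 \<le> d"
      using h by (auto simp: P_def v_def z_def d_def)
    have "z \<le> D * norm (\<mu> y) + norm (\<sigma> y) * v"
      unfolding z_def v_def using norm_triangle_ineq[of "D *\<^sub>R \<mu> y" "\<sigma> y *v w"] h(1)
        norm_matrix_vector_mult_le[of "\<sigma> y" w] by simp
    also have "\<dots> \<le> D * (growth_const * P) + (growth_const * P) * v"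
      using growth[of y] h v by (intro add_mono mult_left_mono mult_right_mono) (auto simp: P_def)
    finally have z: "z \<le> growth_const * P * (D + v)" by (simp add: algebra_simps)
    have P2: "1 \<le> P\<^sup>2" using P by simp
    have z2: "D + z\<^sup>2 \<le> c5 * (P\<^sup>2 * d)"
    proof -
      have "z\<^sup>2 \<le> (growth_const * P * (D + v))\<^sup>2" using z z0 by (intro power_mono) auto
      also have "\<dots> = growth_const\<^sup>2 * P\<^sup>2 * (D + v)\<^sup>2" by (simp add: power_mult_distrib)
      also have "\<dots> \<le> growth_const\<^sup>2 * P\<^sup>2 * (2 * ((T + 1) * d))"
      proof (intro mult_left_mono)
        have "(D + v)\<^sup>2 \<le> 2 * (D\<^sup>2 + v\<^sup>2)" using sum_squares_bound[of D v] by (simp add: power2_sum)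
        also have "2 * (D\<^sup>2 + v\<^sup>2) \<le> 2 * ((T + 1) * d)"
        proof -
        have "D\<^sup>2 \<le> T * D" using h by (simp add: power2_eq_square mult_right_mono)
        moreover have "0 \<le> T * v\<^sup>2" using T by simp
        moreover have "(T + 1) * d = T * D + T * v\<^sup>2 + D + v\<^sup>2" by (simp add: d_def algebra_simps)
        ultimately show ?thesis using h(1) by argo
        qed
        finally show "(D + v)\<^sup>2 \<le> 2 * ((T + 1) * d)" .
      qed simp
      also have "\<dots> = 2 * growth_const\<^sup>2 * (T + 1) * (P\<^sup>2 * d)" by simp
      finally have "z\<^sup>2 \<le> 2 * growth_const\<^sup>2 * (T + 1) * (P\<^sup>2 * d)" .
      moreover have "D \<le> P\<^sup>2 * d"
      proof -
        have "D \<le> d" by (simp add: d_def)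
        also have "d = 1 * d" by simp
        also have "\<dots> \<le> P\<^sup>2 * d" using P2 d by (intro mult_right_mono)
        finally show ?thesis .
      qed
      ultimately show ?thesis by (simp add: c5_def algebra_simps)
    qed
    have z1: "1 + norm y + z \<le> c6 * (P * (1 + v))"
    proof -
      have "(1 + T) * (1 + v) = 1 + T + v + T * v" by (simp add: algebra_simps)
      then have "D + v \<le> (1 + T) * (1 + v)" using h(2) mult_nonneg_nonneg[OF T v] by linarith
      then have "growth_const * P * (D + v) \<le> growth_const * P * ((1 + T) * (1 + v))"
        using growth_const_nonneg P by (intro mult_left_mono) auto
      moreover have "P \<le> P * (1 + v)" using P v by (simp add: algebra_simps)
      ultimately show ?thesis using z by (simp add: P_def[symmetric] c6_def algebra_simps)
    qed
    have "(D + z\<^sup>2) * (1 + norm y + z) ^ q * (\<epsilon> + C * (D + z\<^sup>2)) \<le>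
      (c5 * (P\<^sup>2 * d)) * (c6 * (P * (1 + v))) ^ q * (\<epsilon> * (c5 * P\<^sup>2) + C * (c5 * (P\<^sup>2 * d)))"
    proof (intro mult_mono z2 add_mono power_mono z1 mult_left_mono)
      have "\<epsilon> * 1 \<le> \<epsilon> * (c5 * P\<^sup>2)" using h c P2 mult_mono[of 1 c5 1 "P\<^sup>2"] by (intro mult_left_mono) auto
      then show "\<epsilon> \<le> \<epsilon> * (c5 * P\<^sup>2)" by simp
    qed (use h c P v d z0 in auto)
    also have "\<dots> = (c5 * c6 ^ q * c5) * P ^ (q + 4) * (\<epsilon> * (d ^ 1 * (1 + v) ^ q) + C * (d\<^sup>2 * (1 + v) ^ q))"
    proof -
      have "P ^ (q + 4) = P ^ q * P\<^sup>2 * P\<^sup>2" by (simp add: power_add power2_eq_square numeral_eq_Suc)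
      moreover have "(c6 * (P * (1 + v))) ^ q = c6 ^ q * (P ^ q * (1 + v) ^ q)" by (simp add: power_mult_distrib)
      ultimately show ?thesis by (simp only: power2_eq_square power_one_right distrib_left distrib_right) (simp add: mult_ac)
    qed
    finally show ?thesis unfolding z_def P_def v_def d_def .
  qed
  then show ?thesis using c by (intro exI[of _ "c5 * c6 ^ q * c5"]) auto
qed

text \<open>\<open>A\<close> is fixed before \<epsilon>, so over all steps the part of the error not
  vanishing with \<open>dt n\<close> is at most \<open>T * \<epsilon> * A\<close>. \<open>G\<close>
  is known at time 0, hence at every grid time, and can be absorbed into the coefficients of the
  mean-zero terms.\<close>

lemma euler_weak_step:
  fixes G :: "'w \<Rightarrow> real"
  assumes \<xi>: "\<And>\<omega>. \<omega> \<in> space M \<Longrightarrow> norm (\<xi> \<omega>) \<le> B"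
    and u: "C12 T u" "poly_growing_partial_derivs T u"
    and pde: "\<And>t x. t \<in> {0..T} \<Longrightarrow> time_deriv T u t x =
       1/2 * trace (\<sigma> x ** transpose (\<sigma> x) ** hess (u t) x) + \<mu> x \<bullet> grad (u t) x"
    and G: "G \<in> borel_measurable (F 0)" and Gb: "\<And>\<omega>. \<bar>G \<omega>\<bar> \<le> b"
  shows "\<exists>A\<ge>0. \<forall>\<epsilon>>0. \<exists>C\<ge>0. \<forall>n. \<forall>i<2 ^ n.
    \<bar>expectation (\<lambda>\<omega>. G \<omega> * u (T - dy n (Suc i)) (euler n (Suc i) \<omega>)) -
      expectation (\<lambda>\<omega>. G \<omega> * u (T - dy n i) (euler n i \<omega>))\<bar> \<le> dt n * (\<epsilon> * A + C * dt n)"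
proof -
  have b: "0 \<le> b" using Gb abs_ge_zero order_trans by blast
  obtain q where q: "\<And>\<epsilon>. 0 < \<epsilon> \<Longrightarrow> \<exists>C\<ge>0. \<forall>s D y z. 0 \<le> D \<and> D \<le> s \<and> s \<le> T \<longrightarrow>
    \<bar>u (s - D) (y + z) - u s y - (- D * time_deriv T u s y + grad (u s) y \<bullet> z + 1/2 * (z \<bullet> (hess (u s) y *v z)))\<bar>
    \<le> (D + (norm z)\<^sup>2) * (1 + norm y + norm z) ^ q * (\<epsilon> + C * (D + (norm z)\<^sup>2))"
    using C12_taylor[OF u] by blast
  obtain c where c: "0 \<le> c" and rem: "\<And>y w D \<epsilon> C. 0 \<le> D \<Longrightarrow> D \<le> T \<Longrightarrow> 0 \<le> \<epsilon> \<Longrightarrow> 0 \<le> C \<Longrightarrow>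
    (D + (norm (D *\<^sub>R \<mu> y + \<sigma> y *v w))\<^sup>2) * (1 + norm y + norm (D *\<^sub>R \<mu> y + \<sigma> y *v w)) ^ q *
      (\<epsilon> + C * (D + (norm (D *\<^sub>R \<mu> y + \<sigma> y *v w))\<^sup>2))
    \<le> c * (1 + norm y) ^ (q + 4) * (\<epsilon> * ((D + (norm w)\<^sup>2) ^ 1 * (1 + norm w) ^ q)
        + C * ((D + (norm w)\<^sup>2) ^ 2 * (1 + norm w) ^ q))"
    using remainder_pointwise[of q] by blast
  obtain cg m where cg: "0 < cg" and
    "\<And>t x. t \<in> {0..T} \<Longrightarrow> \<bar>time_deriv T u t x\<bar> \<le> cg * (1 + norm x) ^ m" and
    gb: "\<And>t x. t \<in> {0..T} \<Longrightarrow> norm (grad (u t) x) \<le> cg * (1 + norm x) ^ m" and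
    hb: "\<And>t x. t \<in> {0..T} \<Longrightarrow> norm (hess (u t) x) \<le> cg * (1 + norm x) ^ m"
    using u(2) by (rule poly_growing_partial_derivsE) blast
  obtain cu mu where ub: "\<And>t x. t \<in> {0..T} \<Longrightarrow> \<bar>u t x\<bar> \<le> cu * (1 + norm x) ^ mu"
    using C12_poly_bound[OF u] by blast
  define Rw where "Rw r D w = (D + (norm w)\<^sup>2) ^ r * (1 + norm w) ^ q" for r and D :: real and w :: "real^'m"
  obtain K1 where K1: "K1 \<ge> 0"
    "\<And>s t. 0 \<le> s \<Longrightarrow> s \<le> t \<Longrightarrow> t \<le> T \<Longrightarrow> integrable M (\<lambda>\<omega>. Rw 1 (t - s) (W t \<omega> - W s \<omega>))"
    "\<And>s t. 0 \<le> s \<Longrightarrow> s \<le> t \<Longrightarrow> t \<le> T \<Longrightarrow> expectation (\<lambda>\<omega>. Rw 1 (t - s) (W t \<omega> - W s \<omega>)) \<le> K1 * (t - s) ^ 1"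
    using increment_poly_moment[of 1 q] unfolding Rw_def by blast
  obtain K2 where K2: "K2 \<ge> 0"
    "\<And>s t. 0 \<le> s \<Longrightarrow> s \<le> t \<Longrightarrow> t \<le> T \<Longrightarrow> integrable M (\<lambda>\<omega>. Rw 2 (t - s) (W t \<omega> - W s \<omega>))"
    "\<And>s t. 0 \<le> s \<Longrightarrow> s \<le> t \<Longrightarrow> t \<le> T \<Longrightarrow> expectation (\<lambda>\<omega>. Rw 2 (t - s) (W t \<omega> - W s \<omega>)) \<le> K2 * (t - s) ^ 2"
    using increment_poly_moment[of 2 q] unfolding Rw_def by blast
  have mom: "\<exists>C\<ge>0. \<forall>n. \<forall>i\<le>2 ^ n. integrable M (\<lambda>\<omega>. (1 + norm (euler n i \<omega>)) ^ p) \<and>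
    expectation (\<lambda>\<omega>. (1 + norm (euler n i \<omega>)) ^ p) \<le> C" for p by (rule euler_moment[OF \<xi>])
  obtain Mq where Mq: "0 \<le> Mq" "\<And>n i. i \<le> 2 ^ n \<Longrightarrow> expectation (\<lambda>\<omega>. (1 + norm (euler n i \<omega>)) ^ (q + 4)) \<le> Mq"
    using mom[of "q + 4"] by blast
  obtain Mm where Mm: "0 \<le> Mm" "\<And>n i. i \<le> 2 ^ n \<Longrightarrow> expectation (\<lambda>\<omega>. (1 + norm (euler n i \<omega>)) ^ (m + 2)) \<le> Mm"
    using mom[of "m + 2"] by blast
  have mint: "integrable M (\<lambda>\<omega>. (1 + norm (euler n i \<omega>)) ^ p)" if "i \<le> 2 ^ n" for n i p
    using mom[of p] that by blast
  have GF: "G \<in> borel_measurable (F (dy n i))" if "i \<le> 2 ^ n" for n i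
    using measurable_dy_mono[of 0 i n G borel] G that by (simp add: dy_0)
  have GM: "G \<in> borel_measurable M" using F_meas_M[of 0 G borel] G T_pos by simp
  have pint: "integrable M (\<lambda>\<omega>. G \<omega> * f (euler n i \<omega>))"
    if i: "i \<le> 2 ^ n" and f: "f \<in> borel_measurable borel" "\<And>y. \<bar>f y\<bar> \<le> k * (1 + norm y) ^ p" for f k p n i
  proof (rule Bochner_Integration.integrable_bound[OF integrable_mult_right[OF mint[OF i, of p], of "b * k"]])
    note [measurable] = GM measurable_dy_M[OF i euler_adapted[OF i]] f(1)
    show "(\<lambda>\<omega>. G \<omega> * f (euler n i \<omega>)) \<in> borel_measurable M" by measurable
    show "AE \<omega> in M. norm (G \<omega> * f (euler n i \<omega>)) \<le> norm (b * k * (1 + norm (euler n i \<omega>)) ^ p)"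
    proof (rule AE_I2)
      fix \<omega>
      have "\<bar>G \<omega>\<bar> * \<bar>f (euler n i \<omega>)\<bar> \<le> b * (k * (1 + norm (euler n i \<omega>)) ^ p)"
        using Gb f(2) b by (intro mult_mono) auto
      also have "\<dots> \<le> \<bar>b * (k * (1 + norm (euler n i \<omega>)) ^ p)\<bar>" by (rule abs_ge_self)
      finally show "norm (G \<omega> * f (euler n i \<omega>)) \<le> norm (b * k * (1 + norm (euler n i \<omega>)) ^ p)"
        by (simp only: real_norm_def abs_mult[symmetric] mult.assoc)
    qed
  qed
  \<comment> \<open>Collects what multiplies \<epsilon>: the bound on \<open>G\<close>, the constant
    of \<open>remainder_pointwise\<close>, a moment of the Euler scheme, and the first order
    increment moment.\<close>
  define A where "A = b * c * Mq * K1"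
  have A: "0 \<le> A" using b c Mq(1) K1(1) by (simp add: A_def)
  have "\<exists>C\<ge>0. \<forall>n. \<forall>i<2 ^ n.
    \<bar>expectation (\<lambda>\<omega>. G \<omega> * u (T - dy n (Suc i)) (euler n (Suc i) \<omega>)) -
      expectation (\<lambda>\<omega>. G \<omega> * u (T - dy n i) (euler n i \<omega>))\<bar> \<le> dt n * (\<epsilon> * A + C * dt n)" if \<epsilon>: "0 < \<epsilon>" for \<epsilon>
  proof -
    obtain C0 where C0: "0 \<le> C0" and tay: "\<And>s D y z. 0 \<le> D \<Longrightarrow> D \<le> s \<Longrightarrow> s \<le> T \<Longrightarrow>
    \<bar>u (s - D) (y + z) - u s y - (- D * time_deriv T u s y + grad (u s) y \<bullet> z + 1/2 * (z \<bullet> (hess (u s) y *v z)))\<bar>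
    \<le> (D + (norm z)\<^sup>2) * (1 + norm y + norm z) ^ q * (\<epsilon> + C0 * (D + (norm z)\<^sup>2))"
      using q[OF \<epsilon>] by blast
    \<comment> \<open>Two second order contributions: the \<open>C0\<close> part of the Taylor
      remainder, and the square of the drift step against the Hessian.\<close>
    define C where "C = b * c * Mq * C0 * K2 + 1/2 * (b * (growth_const\<^sup>2 * cg) * Mm)"
    have C: "0 \<le> C" using b c Mq(1) C0 K2(1) Mm(1) cg by (simp add: C_def)
    have "\<bar>expectation (\<lambda>\<omega>. G \<omega> * u (T - dy n (Suc i)) (euler n (Suc i) \<omega>)) -
      expectation (\<lambda>\<omega>. G \<omega> * u (T - dy n i) (euler n i \<omega>))\<bar> \<le> dt n * (\<epsilon> * A + C * dt n)" if i: "i < 2 ^ n" for n i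
    proof -
      have i': "i \<le> 2 ^ n" "Suc i \<le> 2 ^ n" using i by auto
      \<comment> \<open>Time is reversed: \<open>u\<close> carries its data \<phi> at time 0, so the
        remaining time decreases along the scheme.\<close>
      define s where "s = T - dy n i"
      define D where "D = dt n"
      define Y where "Y = euler n i"
      define w where "w = inc n i"
      have sD: "T - dy n (Suc i) = s - D" using dy_Suc_dt[of n i] by (simp add: s_def D_def)
      have D: "0 \<le> D" "D \<le> T" "D \<le> s" "s \<le> T"
        using dt_pos[of n] dt_le_T[of n] dy_nonneg[of n i] dy_le_T[OF i'(2)] sD by (auto simp: D_def s_def)
      have sT: "s \<in> {0..T}" "s - D \<in> {0..T}" using D by auto
      have st: "0 \<le> dy n i" "dy n i \<le> dy n (Suc i)" "dy n (Suc i) \<le> T"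
        using dy_nonneg dy_le dy_le_T i'(2) by auto
      have [measurable]: "u s \<in> borel_measurable borel" "u (s - D) \<in> borel_measurable borel"
        "grad (u s) \<in> borel_measurable borel" "hess (u s) \<in> borel_measurable borel"
        using C12_slices[OF u(1) sT(1)] C12_slices[OF u(1) sT(2)] by (auto intro: borel_measurable_continuous_onI)
      have YF[measurable]: "Y \<in> borel_measurable (F (dy n i))" unfolding Y_def by (rule euler_adapted[OF i'(1)])
      have GFi[measurable]: "G \<in> borel_measurable (F (dy n i))" by (rule GF[OF i'(1)])
      note [measurable] = GM measurable_dy_M[OF i'(1) YF]
      have wM[measurable]: "w \<in> borel_measurable M" unfolding w_def by (rule measurable_dy_M[OF i'(2) inc_adapted[OF i]])
      define hmu where "hmu y = \<mu> y \<bullet> (hess (u s) y *v \<mu> y)" for y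
      define p where "p y = transpose (\<sigma> y) *v grad (u s) y + (D / 2) *\<^sub>R (transpose (\<sigma> y) *v (transpose (hess (u s) y) *v \<mu> y + hess (u s) y *v \<mu> y))" for y
      define Q where "Q y = (1/2) *\<^sub>R (transpose (\<sigma> y) ** hess (u s) y ** \<sigma> y)" for y
      have [measurable]: "hmu \<in> borel_measurable borel" "p \<in> borel_measurable borel" "Q \<in> borel_measurable borel"
        unfolding hmu_def[abs_def] p_def[abs_def] Q_def[abs_def] by measurable
      have gr: "norm (\<mu> y) \<le> growth_const * (1 + norm y)" "norm (transpose (\<sigma> y)) \<le> growth_const * (1 + norm y)"
        "norm (\<sigma> y) \<le> growth_const * (1 + norm y)" for y
        using growth[of y] by (auto simp: norm_transpose)
      have hbs: "norm (hess (u s) y *v x) \<le> cg * (1 + norm y) ^ m * norm x"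
        "norm (transpose (hess (u s) y) *v x) \<le> cg * (1 + norm y) ^ m * norm x" for x y
        using order_trans[OF norm_matrix_vector_mult_le mult_right_mono[OF hb[OF sT(1), of y] norm_ge_zero]]
          order_trans[OF norm_matrix_vector_mult_le[of "transpose (hess (u s) y)"], of x "cg * (1 + norm y) ^ m * norm x"]
          mult_right_mono[OF hb[OF sT(1), of y] norm_ge_zero[of x]] by (auto simp: norm_transpose)
      have hmu_b: "\<bar>hmu y\<bar> \<le> growth_const\<^sup>2 * cg * (1 + norm y) ^ (m + 2)" for y
      proof -
        have "\<bar>hmu y\<bar> \<le> norm (\<mu> y) * norm (hess (u s) y *v \<mu> y)" unfolding hmu_def by (rule Cauchy_Schwarz_ineq2)
        also have "\<dots> \<le> (growth_const * (1 + norm y)) * (cg * (1 + norm y) ^ m * (growth_const * (1 + norm y)))"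
          using order_trans[OF hbs(1)[of y "\<mu> y"] mult_left_mono[OF gr(1)[of y], of "cg * (1 + norm y) ^ m"]] gr(1)[of y] cg growth_const_nonneg
          by (intro mult_mono) auto
        also have "\<dots> = growth_const\<^sup>2 * cg * (1 + norm y) ^ (m + 2)" by (simp add: power2_eq_square mult_ac)
        finally show ?thesis .
      qed
      have p_b: "\<bar>p y $ k\<bar> \<le> (growth_const * cg + D * growth_const\<^sup>2 * cg) * (1 + norm y) ^ (m + 2)" for y k
      proof -
        let ?P = "1 + norm y"
        have P: "1 \<le> ?P" by simp
        have t1: "norm (transpose (\<sigma> y) *v grad (u s) y) \<le> (growth_const * ?P) * (cg * ?P ^ m)"
          using norm_matrix_vector_mult_le[of "transpose (\<sigma> y)" "grad (u s) y"]
            mult_mono[OF gr(2)[of y] gb[OF sT(1), of y]] growth_const_nonneg by simp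
        have t2: "norm (transpose (hess (u s) y) *v \<mu> y + hess (u s) y *v \<mu> y) \<le> 2 * (cg * ?P ^ m * (growth_const * ?P))"
        proof -
          have "cg * ?P ^ m * norm (\<mu> y) \<le> cg * ?P ^ m * (growth_const * ?P)"
            using gr(1)[of y] cg by (intro mult_left_mono) auto
          then show ?thesis
            using norm_triangle_ineq[of "transpose (hess (u s) y) *v \<mu> y" "hess (u s) y *v \<mu> y"] hbs[of y "\<mu> y"] by linarith
        qed
        have t3: "norm (transpose (\<sigma> y) *v (transpose (hess (u s) y) *v \<mu> y + hess (u s) y *v \<mu> y)) \<le> (growth_const * ?P) * (2 * (cg * ?P ^ m * (growth_const * ?P)))"
          using order_trans[OF norm_matrix_vector_mult_le mult_mono[OF gr(2)[of y] t2]] growth_const_nonneg by simp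
        have "\<bar>p y $ k\<bar> \<le> norm (p y)" by (rule component_le_norm_cart)
        also have "\<dots> \<le> norm (transpose (\<sigma> y) *v grad (u s) y)
           + (D / 2) * norm (transpose (\<sigma> y) *v (transpose (hess (u s) y) *v \<mu> y + hess (u s) y *v \<mu> y))"
          unfolding p_def using D(1) by (intro order_trans[OF norm_triangle_ineq]) simp
        also have "\<dots> \<le> (growth_const * ?P) * (cg * ?P ^ m) + (D / 2) * ((growth_const * ?P) * (2 * (cg * ?P ^ m * (growth_const * ?P))))"
          using D(1) by (intro add_mono t1 mult_left_mono t3) auto
        also have "\<dots> = growth_const * cg * ?P ^ (m + 1) + D * growth_const\<^sup>2 * cg * ?P ^ (m + 2)"
          by (simp add: power2_eq_square mult_ac)
        also have "\<dots> \<le> growth_const * cg * ?P ^ (m + 2) + D * growth_const\<^sup>2 * cg * ?P ^ (m + 2)"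
          using growth_const_nonneg cg P by (intro add_right_mono mult_left_mono power_increasing) auto
        finally show ?thesis by (simp add: algebra_simps)
      qed
      have Q_b: "\<bar>Q y $ k $ l\<bar> \<le> (1/2 * growth_const\<^sup>2 * cg) * (1 + norm y) ^ (m + 2)" for y k l
      proof -
        let ?P = "1 + norm y"
        have "\<bar>Q y $ k $ l\<bar> \<le> norm (Q y)" by (rule abs_nth_le_norm)
        also have "\<dots> = 1/2 * norm (transpose (\<sigma> y) ** hess (u s) y ** \<sigma> y)" by (simp add: Q_def)
        also have "norm (transpose (\<sigma> y) ** hess (u s) y ** \<sigma> y) \<le> norm (transpose (\<sigma> y) ** hess (u s) y) * norm (\<sigma> y)"
          by (rule norm_matrix_matrix_mult_le)
        also have "\<dots> \<le> (norm (transpose (\<sigma> y)) * norm (hess (u s) y)) * norm (\<sigma> y)"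
          by (intro mult_right_mono norm_matrix_matrix_mult_le) auto
        also have "\<dots> \<le> ((growth_const * ?P) * (cg * ?P ^ m)) * (growth_const * ?P)"
          using growth_const_nonneg cg by (intro mult_mono gr hb[OF sT(1)]) auto
        also have "1/2 * (((growth_const * ?P) * (cg * ?P ^ m)) * (growth_const * ?P)) = (1/2 * growth_const\<^sup>2 * cg) * ?P ^ (m + 2)"
          by (simp add: power2_eq_square mult_ac)
        finally show ?thesis by simp
      qed
      \<comment> \<open>The polynomial subtracted is the Taylor polynomial in the form given by
        \<open>generator_identity\<close>: an explicit term with \<open>D\<^sup>2\<close>, a linear
        term, and a centred quadratic form.\<close>
      define R where "R \<omega> = u (s - D) (euler n (Suc i) \<omega>) - u s (Y \<omega>)
        - (1/2 * D\<^sup>2 * hmu (Y \<omega>) + p (Y \<omega>) \<bullet> w \<omega> + (w \<omega> \<bullet> (Q (Y \<omega>) *v w \<omega>) - D * trace (Q (Y \<omega>))))" for \<omega>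
      have Yn: "euler n (Suc i) \<omega> = Y \<omega> + (D *\<^sub>R \<mu> (Y \<omega>) + \<sigma> (Y \<omega>) *v w \<omega>)" for \<omega>
        by (simp add: Y_def w_def D_def)
      define Z where "Z \<omega> = c * (1 + norm (Y \<omega>)) ^ (q + 4) * (\<epsilon> * Rw 1 D (w \<omega>) + C0 * Rw 2 D (w \<omega>))" for \<omega>
      have RZ: "\<bar>R \<omega>\<bar> \<le> Z \<omega>" for \<omega>
      proof -
        let ?z = "D *\<^sub>R \<mu> (Y \<omega>) + \<sigma> (Y \<omega>) *v w \<omega>"
        have "R \<omega> = u (s - D) (Y \<omega> + ?z) - u s (Y \<omega>) - (- D * time_deriv T u s (Y \<omega>) + grad (u s) (Y \<omega>) \<bullet> ?z
            + 1/2 * (?z \<bullet> (hess (u s) (Y \<omega>) *v ?z)))"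
          unfolding R_def Yn hmu_def p_def Q_def generator_identity[OF pde[OF sT(1)]] ..
        then have "\<bar>R \<omega>\<bar> \<le> (D + (norm ?z)\<^sup>2) * (1 + norm (Y \<omega>) + norm ?z) ^ q * (\<epsilon> + C0 * (D + (norm ?z)\<^sup>2))"
          using tay[OF D(1,3,4)] by simp
        also have "\<dots> \<le> Z \<omega>" unfolding Z_def Rw_def by (rule rem[OF D(1,2) less_imp_le[OF \<epsilon>] C0])
        finally show ?thesis .
      qed
      have Ri: "integrable M (\<lambda>\<omega>. Rw 1 D (w \<omega>))" "expectation (\<lambda>\<omega>. Rw 1 D (w \<omega>)) \<le> K1 * D"
        "integrable M (\<lambda>\<omega>. Rw 2 D (w \<omega>))" "expectation (\<lambda>\<omega>. Rw 2 D (w \<omega>)) \<le> K2 * D\<^sup>2"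
        using K1(2,3)[OF st] K2(2,3)[OF st] unfolding D_def w_def dy_Suc_dt inc_def by auto
      define E where "E w = \<epsilon> * Rw 1 D w + C0 * Rw 2 D w" for w
      have Em[measurable]: "E \<in> borel_measurable borel" unfolding E_def[abs_def] Rw_def[abs_def] by measurable
      have Ei: "integrable M (\<lambda>\<omega>. E (w \<omega>))" unfolding E_def using Ri by simp
      have EE: "expectation (\<lambda>\<omega>. E (w \<omega>)) \<le> \<epsilon> * (K1 * D) + C0 * (K2 * D\<^sup>2)"
        unfolding E_def using Ri \<epsilon> C0 by (simp add: add_mono mult_left_mono)
      have E0: "0 \<le> E x" for x unfolding E_def Rw_def using \<epsilon> C0 D by simp
      have PF: "(\<lambda>\<omega>. (1 + norm (Y \<omega>)) ^ (q + 4)) \<in> borel_measurable (F (dy n i))" by measurable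
      have Pi: "integrable M (\<lambda>\<omega>. (1 + norm (Y \<omega>)) ^ (q + 4))" unfolding Y_def by (rule mint[OF i'(1)])
      \<comment> \<open>The position is known at \<open>dy n i\<close> and the increment is
        independent of it, so the expectation of the product factors.\<close>
      have PEi: "integrable M (\<lambda>\<omega>. (1 + norm (Y \<omega>)) ^ (q + 4) * E (w \<omega>))"
        "expectation (\<lambda>\<omega>. (1 + norm (Y \<omega>)) ^ (q + 4) * E (w \<omega>)) =
          expectation (\<lambda>\<omega>. (1 + norm (Y \<omega>)) ^ (q + 4)) * expectation (\<lambda>\<omega>. E (w \<omega>))"
        using integrable_mult_increment[OF st PF Pi Em] expectation_mult_increment[OF st PF Pi Em] Ei
        unfolding w_def inc_def by auto
      have Zeq: "Z = (\<lambda>\<omega>. c * ((1 + norm (Y \<omega>)) ^ (q + 4) * E (w \<omega>)))" by (auto simp: Z_def E_def)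
      have Zi: "integrable M Z" unfolding Zeq using PEi by simp
      have ZE: "expectation Z \<le> c * (Mq * (\<epsilon> * (K1 * D) + C0 * (K2 * D\<^sup>2)))"
        unfolding Zeq using PEi EE Mq(2)[OF i'(1)] c E0 Mq(1)
        by (auto simp: Y_def intro!: mult_left_mono mult_mono integral_nonneg)
      have uR: "integrable M (\<lambda>\<omega>. G \<omega> * u s (Y \<omega>))"
        unfolding Y_def by (rule pint[OF i'(1) _ ub[OF sT(1)]]) measurable
      have uR': "integrable M (\<lambda>\<omega>. G \<omega> * u (s - D) (euler n (Suc i) \<omega>))"
        by (rule pint[OF i'(2) _ ub[OF sT(2)]]) measurable
      have hi: "integrable M (\<lambda>\<omega>. G \<omega> * hmu (Y \<omega>))"
        unfolding Y_def by (rule pint[OF i'(1) _ hmu_b]) measurable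
      have Qi: "integrable M (\<lambda>\<omega>. (G \<omega> *\<^sub>R Q (Y \<omega>)) $ k $ l)" for k l
        using pint[OF i'(1) _ Q_b[of _ k l]] by (simp add: Y_def)
      have lin: "has_bochner_integral M (\<lambda>\<omega>. (G \<omega> *\<^sub>R p (Y \<omega>)) \<bullet> w \<omega>) 0"
        unfolding w_def inc_def
      proof (rule has_integral_linear_increment[OF st])
        show "integrable M (\<lambda>\<omega>. (G \<omega> *\<^sub>R p (Y \<omega>)) $ k)" for k
          using pint[OF i'(1) _ p_b[of _ k]] by (simp add: Y_def)
      qed measurable
      have quad: "has_bochner_integral M (\<lambda>\<omega>. w \<omega> \<bullet> ((G \<omega> *\<^sub>R Q (Y \<omega>)) *v w \<omega>))
          (D * expectation (\<lambda>\<omega>. trace (G \<omega> *\<^sub>R Q (Y \<omega>))))"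
        unfolding w_def inc_def D_def dy_Suc_dt[symmetric, of n i]
        by (rule has_integral_quadratic_increment[OF st _ Qi]) measurable
      have tri: "integrable M (\<lambda>\<omega>. trace (G \<omega> *\<^sub>R Q (Y \<omega>)))"
        unfolding trace_def by (rule Bochner_Integration.integrable_sum) (rule Qi)
      \<comment> \<open>Subtracting the trace centres the quadratic form; this trace is the one
        supplied by the equation in \<open>generator_identity\<close>.\<close>
      have quad0: "has_bochner_integral M (\<lambda>\<omega>. G \<omega> * (w \<omega> \<bullet> (Q (Y \<omega>) *v w \<omega>) - D * trace (Q (Y \<omega>)))) 0"
      proof -
        have "has_bochner_integral M (\<lambda>\<omega>. w \<omega> \<bullet> ((G \<omega> *\<^sub>R Q (Y \<omega>)) *v w \<omega>) - D * trace (G \<omega> *\<^sub>R Q (Y \<omega>)))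
          (D * expectation (\<lambda>\<omega>. trace (G \<omega> *\<^sub>R Q (Y \<omega>))) - D * expectation (\<lambda>\<omega>. trace (G \<omega> *\<^sub>R Q (Y \<omega>))))"
          using tri by (intro has_bochner_integral_diff quad has_bochner_integral_mult_right)
            (auto simp: has_bochner_integral_iff)
        moreover have "trace (G \<omega> *\<^sub>R Q (Y \<omega>)) = G \<omega> * trace (Q (Y \<omega>))" for \<omega>
          by (simp add: trace_def sum_distrib_left)
        ultimately show ?thesis
          by (simp add: scaleR_matrix_vector_assoc[symmetric] algebra_simps)
      qed
      have lin0: "has_bochner_integral M (\<lambda>\<omega>. G \<omega> * (p (Y \<omega>) \<bullet> w \<omega>)) 0" using lin by simp
      have GRi: "integrable M (\<lambda>\<omega>. G \<omega> * R \<omega>)"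
      proof (rule Bochner_Integration.integrable_bound[OF integrable_mult_right[OF Zi, of b]])
        have [measurable]: "euler n (Suc i) \<in> borel_measurable M"
          by (rule measurable_dy_M[OF i'(2) euler_adapted[OF i'(2)]])
        show "(\<lambda>\<omega>. G \<omega> * R \<omega>) \<in> borel_measurable M" unfolding R_def trace_def by measurable
        show "AE \<omega> in M. norm (G \<omega> * R \<omega>) \<le> norm (b * Z \<omega>)"
        proof (rule AE_I2)
          fix \<omega>
          have "\<bar>G \<omega>\<bar> * \<bar>R \<omega>\<bar> \<le> b * Z \<omega>" using Gb RZ b by (intro mult_mono) auto
          then show "norm (G \<omega> * R \<omega>) \<le> norm (b * Z \<omega>)"
            using b order_trans[OF abs_ge_zero RZ[of \<omega>]] by (simp add: abs_mult)
        qed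
      qed
      have dec: "G \<omega> * u (s - D) (euler n (Suc i) \<omega>) - G \<omega> * u s (Y \<omega>) =
          G \<omega> * R \<omega> + 1/2 * D\<^sup>2 * (G \<omega> * hmu (Y \<omega>)) + G \<omega> * (p (Y \<omega>) \<bullet> w \<omega>)
          + G \<omega> * (w \<omega> \<bullet> (Q (Y \<omega>) *v w \<omega>) - D * trace (Q (Y \<omega>)))" for \<omega>
        unfolding R_def by (simp add: algebra_simps)
      have "expectation (\<lambda>\<omega>. G \<omega> * u (s - D) (euler n (Suc i) \<omega>)) - expectation (\<lambda>\<omega>. G \<omega> * u s (Y \<omega>))
        = expectation (\<lambda>\<omega>. G \<omega> * R \<omega>) + 1/2 * D\<^sup>2 * expectation (\<lambda>\<omega>. G \<omega> * hmu (Y \<omega>))"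
        unfolding Bochner_Integration.integral_diff[OF uR' uR, symmetric] dec
        using GRi hi lin0 quad0 by (simp add: has_bochner_integral_iff)
      also have "\<bar>\<dots>\<bar> \<le> b * expectation Z + 1/2 * D\<^sup>2 * (b * (growth_const\<^sup>2 * cg) * Mm)"
      proof -
        have "\<bar>expectation (\<lambda>\<omega>. G \<omega> * R \<omega>)\<bar> \<le> expectation (\<lambda>\<omega>. b * Z \<omega>)"
        proof (rule order_trans[OF integral_abs_bound integral_mono])
          show "\<bar>G \<omega> * R \<omega>\<bar> \<le> b * Z \<omega>" for \<omega>
            unfolding abs_mult using Gb RZ b by (intro mult_mono) auto
        qed (use GRi Zi in auto)
        moreover have "\<bar>expectation (\<lambda>\<omega>. G \<omega> * hmu (Y \<omega>))\<bar> \<le> b * (growth_const\<^sup>2 * cg) * Mm"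
        proof -
          have "\<bar>expectation (\<lambda>\<omega>. G \<omega> * hmu (Y \<omega>))\<bar> \<le> expectation (\<lambda>\<omega>. b * (growth_const\<^sup>2 * cg) * (1 + norm (Y \<omega>)) ^ (m + 2))"
          proof (rule order_trans[OF integral_abs_bound integral_mono])
            show "integrable M (\<lambda>\<omega>. b * (growth_const\<^sup>2 * cg) * (1 + norm (Y \<omega>)) ^ (m + 2))"
              unfolding Y_def by (rule integrable_mult_right[OF mint[OF i'(1)]])
            show "\<bar>G \<omega> * hmu (Y \<omega>)\<bar> \<le> b * (growth_const\<^sup>2 * cg) * (1 + norm (Y \<omega>)) ^ (m + 2)" for \<omega>
              unfolding abs_mult mult.assoc[of b] using Gb hmu_b b by (intro mult_mono) auto
          qed (use hi in auto)
          also have "\<dots> = b * (growth_const\<^sup>2 * cg) * expectation (\<lambda>\<omega>. (1 + norm (Y \<omega>)) ^ (m + 2))" by simp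
          also have "\<dots> \<le> b * (growth_const\<^sup>2 * cg) * Mm"
            using Mm(2)[OF i'(1)] b cg unfolding Y_def by (intro mult_left_mono) auto
          finally show ?thesis .
        qed
        then have "1/2 * D\<^sup>2 * \<bar>expectation (\<lambda>\<omega>. G \<omega> * hmu (Y \<omega>))\<bar> \<le> 1/2 * D\<^sup>2 * (b * (growth_const\<^sup>2 * cg) * Mm)"
          by (intro mult_left_mono) auto
        ultimately show ?thesis
          using abs_triangle_ineq[of "expectation (\<lambda>\<omega>. G \<omega> * R \<omega>)" "1/2 * D\<^sup>2 * expectation (\<lambda>\<omega>. G \<omega> * hmu (Y \<omega>))"]
          by (simp add: abs_mult)
      qed
      also have "\<dots> \<le> b * (c * (Mq * (\<epsilon> * (K1 * D) + C0 * (K2 * D\<^sup>2)))) + 1/2 * D\<^sup>2 * (b * (growth_const\<^sup>2 * cg) * Mm)"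
        using ZE b by (intro add_right_mono mult_left_mono) auto
      also have "\<dots> = D * (\<epsilon> * A + C * D)"
        by (simp add: A_def C_def power2_eq_square algebra_simps)
      finally show ?thesis unfolding sD s_def[symmetric] D_def[symmetric] Y_def[symmetric] .
    qed
    then show ?thesis using C by blast
  qed
  then show ?thesis using A by blast
qed

text \<open>The grid has \<open>2 ^ n\<close> steps of length \<open>dt n\<close>, so the one-step
  errors sum to \<open>T * (\<epsilon> * A + C * dt n)\<close>: first \<epsilon> is chosen, then
  \<open>n\<close>.\<close>

lemma euler_weak_limit:
  fixes G :: "'w \<Rightarrow> real"
  assumes \<xi>: "\<And>\<omega>. \<omega> \<in> space M \<Longrightarrow> norm (\<xi> \<omega>) \<le> B"
    and u: "C12 T u" "poly_growing_partial_derivs T u"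
    and pde: "\<And>t x. t \<in> {0..T} \<Longrightarrow> time_deriv T u t x =
       1/2 * trace (\<sigma> x ** transpose (\<sigma> x) ** hess (u t) x) + \<mu> x \<bullet> grad (u t) x"
    and G: "G \<in> borel_measurable (F 0)" and Gb: "\<And>\<omega>. \<bar>G \<omega>\<bar> \<le> b"
  shows "(\<lambda>n. expectation (\<lambda>\<omega>. G \<omega> * u 0 (euler n (2 ^ n) \<omega>))) \<longlonglongrightarrow> expectation (\<lambda>\<omega>. G \<omega> * u T (\<xi> \<omega>))"
proof (rule LIMSEQ_I)
  fix r :: real assume r: "0 < r"
  obtain A where A: "0 \<le> A" and step: "\<And>\<epsilon>. 0 < \<epsilon> \<Longrightarrow> \<exists>C\<ge>0. \<forall>n. \<forall>i<2 ^ n.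
    \<bar>expectation (\<lambda>\<omega>. G \<omega> * u (T - dy n (Suc i)) (euler n (Suc i) \<omega>)) -
      expectation (\<lambda>\<omega>. G \<omega> * u (T - dy n i) (euler n i \<omega>))\<bar> \<le> dt n * (\<epsilon> * A + C * dt n)"
    using euler_weak_step[OF \<xi> u pde G Gb] by blast
  \<comment> \<open>\<open>A + 1\<close> avoids division by zero and makes the inequality
    \<open>eA\<close> strict.\<close>
  define \<epsilon> where "\<epsilon> = r / (2 * T * (A + 1))"
  have \<epsilon>: "0 < \<epsilon>" using r A T_pos by (simp add: \<epsilon>_def)
  obtain C where C: "0 \<le> C" and st: "\<And>n i. i < 2 ^ n \<Longrightarrow>
    \<bar>expectation (\<lambda>\<omega>. G \<omega> * u (T - dy n (Suc i)) (euler n (Suc i) \<omega>)) -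
      expectation (\<lambda>\<omega>. G \<omega> * u (T - dy n i) (euler n i \<omega>))\<bar> \<le> dt n * (\<epsilon> * A + C * dt n)"
    using step[OF \<epsilon>] by blast
  have eA: "T * (\<epsilon> * A) < r / 2"
  proof -
    have "T * (\<epsilon> * A) < T * (\<epsilon> * (A + 1))" using \<epsilon> T_pos by simp
    also have "\<dots> = r / 2" using A T_pos by (simp add: \<epsilon>_def)
    finally show ?thesis .
  qed
  have "(\<lambda>n. T * (C * dt n)) \<longlonglongrightarrow> T * (C * 0)"
    unfolding dt_def by (intro tendsto_mult_left LIMSEQ_divide_realpow_zero) auto
  then have "\<forall>\<^sub>F n in sequentially. T * (C * dt n) < r / 2" by (rule order_tendstoD(2)) (use r in simp)
  then obtain N where N: "\<And>n. n \<ge> N \<Longrightarrow> T * (C * dt n) < r / 2" unfolding eventually_sequentially by blast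
  have "norm (expectation (\<lambda>\<omega>. G \<omega> * u 0 (euler n (2 ^ n) \<omega>)) - expectation (\<lambda>\<omega>. G \<omega> * u T (\<xi> \<omega>))) < r"
    if n: "n \<ge> N" for n
  proof -
    define a where "a i = expectation (\<lambda>\<omega>. G \<omega> * u (T - dy n i) (euler n i \<omega>))" for i
    have "a (2 ^ n) - a 0 = (\<Sum>i<2 ^ n. a (Suc i) - a i)" by (rule sum_lessThan_telescope[symmetric])
    also have "\<bar>\<dots>\<bar> \<le> (\<Sum>i<2 ^ n. \<bar>a (Suc i) - a i\<bar>)" by (rule sum_abs)
    also have "\<dots> \<le> (\<Sum>i<(2::nat) ^ n. dt n * (\<epsilon> * A + C * dt n))"
      unfolding a_def by (intro sum_mono st) auto
    also have "\<dots> = T * (\<epsilon> * A) + T * (C * dt n)" by (simp add: dt_def distrib_left)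
    also have "\<dots> < r" using eA N[OF n] by linarith
    finally show ?thesis unfolding a_def by (simp add: dy_0 dy_last)
  qed
  then show "\<exists>no. \<forall>n\<ge>no. norm (expectation (\<lambda>\<omega>. G \<omega> * u 0 (euler n (2 ^ n) \<omega>)) - expectation (\<lambda>\<omega>. G \<omega> * u T (\<xi> \<omega>))) < r"
    by blast
qed

end

section \<open>Passage to the solution\<close>

text \<open>Fatou bounds the limit in the square mean. For convergence in mean both sides are
  clipped at level \<open>k\<close>: the clipped parts converge by dominated convergence, and the
  discarded parts are at most \<open>z\<^sup>2 / k\<close>, uniformly small by the second
  moments.\<close>

lemma (in prob_space) AE_convergent_L2_bounded:
  fixes Z :: "nat \<Rightarrow> 'a \<Rightarrow> real"
  assumes lim: "AE \<omega> in M. (\<lambda>n. Z n \<omega>) \<longlonglongrightarrow> Y \<omega>"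
    and Zm: "\<And>n. Z n \<in> borel_measurable M" and Ym: "Y \<in> borel_measurable M"
    and Zi: "\<And>n. integrable M (\<lambda>\<omega>. (Z n \<omega>)\<^sup>2)"
    and ZC: "\<And>n. expectation (\<lambda>\<omega>. (Z n \<omega>)\<^sup>2) \<le> C"
  shows "integrable M (\<lambda>\<omega>. (Y \<omega>)\<^sup>2)" "(\<lambda>n. expectation (\<lambda>\<omega>. \<bar>Z n \<omega> - Y \<omega>\<bar>)) \<longlonglongrightarrow> 0"
proof -
  note [measurable] = Zm Ym
  have C: "0 \<le> C" by (rule order_trans[OF integral_nonneg_AE ZC[of 0]]) simp
  have "(\<integral>\<^sup>+\<omega>. ennreal ((Y \<omega>)\<^sup>2) \<partial>M) = (\<integral>\<^sup>+\<omega>. liminf (\<lambda>n. ennreal ((Z n \<omega>)\<^sup>2)) \<partial>M)"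
  proof (rule nn_integral_cong_AE)
    show "AE \<omega> in M. ennreal ((Y \<omega>)\<^sup>2) = liminf (\<lambda>n. ennreal ((Z n \<omega>)\<^sup>2))"
      using lim
    proof eventually_elim
      case (elim \<omega>)
      have "(\<lambda>n. ennreal ((Z n \<omega>)\<^sup>2)) \<longlonglongrightarrow> ennreal ((Y \<omega>)\<^sup>2)"
        by (intro tendsto_ennrealI tendsto_power elim)
      from lim_imp_Liminf[OF sequentially_bot this] show ?case by simp
    qed
  qed
  also have "\<dots> \<le> liminf (\<lambda>n. \<integral>\<^sup>+\<omega>. ennreal ((Z n \<omega>)\<^sup>2) \<partial>M)"
    by (rule nn_integral_liminf) measurable
  also have "\<dots> \<le> liminf (\<lambda>n. ennreal C)"
    using ZC Zi by (intro Liminf_mono always_eventually allI) (simp add: nn_integral_eq_integral ennreal_leI)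
  also have "\<dots> = ennreal C" by (simp add: Liminf_const)
  finally have YC: "(\<integral>\<^sup>+\<omega>. ennreal ((Y \<omega>)\<^sup>2) \<partial>M) \<le> ennreal C" .
  show Yi: "integrable M (\<lambda>\<omega>. (Y \<omega>)\<^sup>2)"
  proof (rule integrableI_bounded)
    have "(\<integral>\<^sup>+\<omega>. ennreal (norm ((Y \<omega>)\<^sup>2)) \<partial>M) \<le> ennreal C" using YC by simp
    also have "\<dots> < \<infinity>" by simp
    finally show "(\<integral>\<^sup>+\<omega>. ennreal (norm ((Y \<omega>)\<^sup>2)) \<partial>M) < \<infinity>" .
  qed measurable
  have YE: "expectation (\<lambda>\<omega>. (Y \<omega>)\<^sup>2) \<le> C"
    using YC C by (simp add: nn_integral_eq_integral[OF Yi] ennreal_le_iff)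
  have int1: "integrable M f" if "f \<in> borel_measurable M" "integrable M (\<lambda>\<omega>. (f \<omega>)\<^sup>2)" for f :: "'a \<Rightarrow> real"
    using that by (rule square_integrable_imp_integrable)
  have Z1: "integrable M (Z n)" for n by (rule int1[OF Zm Zi])
  have Y1: "integrable M Y" by (rule int1[OF Ym Yi])
  define clip where "clip k z = max (- k) (min k z)" for k z :: real
  have clip: "\<bar>z - clip k z\<bar> \<le> z\<^sup>2 / k" "\<bar>clip k z\<bar> \<le> k" if k: "0 < k" for k z
  proof -
    show "\<bar>clip k z\<bar> \<le> k" using k by (auto simp: clip_def)
    show "\<bar>z - clip k z\<bar> \<le> z\<^sup>2 / k"
    proof (cases "\<bar>z\<bar> \<le> k")
      case True
      then show ?thesis using k by (auto simp: clip_def max_def min_def)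
    next
      case False
      then have "\<bar>z - clip k z\<bar> \<le> \<bar>z\<bar>" using k by (auto simp: clip_def max_def min_def)
      also have "\<dots> * k \<le> \<bar>z\<bar> * \<bar>z\<bar>" using False by (intro mult_left_mono) auto
      then have "\<bar>z\<bar> \<le> z\<^sup>2 / k" using k by (simp add: pos_le_divide_eq power2_eq_square)
      finally show ?thesis .
    qed
  qed
  have [measurable]: "clip k \<in> borel_measurable borel" for k unfolding clip_def by measurable
  have clip_cont: "isCont (clip k) z" for k z unfolding clip_def by (intro continuous_intros)
  have clim: "(\<lambda>n. expectation (\<lambda>\<omega>. \<bar>clip k (Z n \<omega>) - clip k (Y \<omega>)\<bar>)) \<longlonglongrightarrow> 0" if k: "0 < k" for k
  proof -
    have "(\<lambda>n. expectation (\<lambda>\<omega>. \<bar>clip k (Z n \<omega>) - clip k (Y \<omega>)\<bar>)) \<longlonglongrightarrow> expectation (\<lambda>\<omega>. 0)"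
    proof (rule integral_dominated_convergence[where w="\<lambda>_. 2 * k"])
      show "AE \<omega> in M. (\<lambda>n. \<bar>clip k (Z n \<omega>) - clip k (Y \<omega>)\<bar>) \<longlonglongrightarrow> 0"
        using lim
      proof eventually_elim
        case (elim \<omega>)
        have "(\<lambda>n. clip k (Z n \<omega>)) \<longlonglongrightarrow> clip k (Y \<omega>)" by (rule isCont_tendsto_compose[OF clip_cont elim])
        then show ?case by (intro tendsto_rabs_zero) (simp add: LIM_zero)
      qed
      show "AE \<omega> in M. norm \<bar>clip k (Z n \<omega>) - clip k (Y \<omega>)\<bar> \<le> 2 * k" for n
      proof (rule AE_I2)
        fix \<omega>
        show "norm \<bar>clip k (Z n \<omega>) - clip k (Y \<omega>)\<bar> \<le> 2 * k"
          using clip(2)[OF k, of "Z n \<omega>"] clip(2)[OF k, of "Y \<omega>"] by auto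
      qed
    qed auto
    then show ?thesis by simp
  qed
  have ci: "integrable M (\<lambda>\<omega>. \<bar>clip k (Z n \<omega>) - clip k (Y \<omega>)\<bar>)" if k: "0 < k" for k n
  proof (rule integrable_const_bound[where B="2 * k"])
    show "AE \<omega> in M. norm \<bar>clip k (Z n \<omega>) - clip k (Y \<omega>)\<bar> \<le> 2 * k"
    proof (rule AE_I2)
      fix \<omega>
      show "norm \<bar>clip k (Z n \<omega>) - clip k (Y \<omega>)\<bar> \<le> 2 * k"
        using clip(2)[OF k, of "Z n \<omega>"] clip(2)[OF k, of "Y \<omega>"] by auto
    qed
  qed measurable
  have bnd: "expectation (\<lambda>\<omega>. \<bar>Z n \<omega> - Y \<omega>\<bar>) \<le> expectation (\<lambda>\<omega>. \<bar>clip k (Z n \<omega>) - clip k (Y \<omega>)\<bar>) + 2 * C / k"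
    if k: "0 < k" for k n
  proof -
    have "expectation (\<lambda>\<omega>. \<bar>Z n \<omega> - Y \<omega>\<bar>) \<le>
        expectation (\<lambda>\<omega>. \<bar>clip k (Z n \<omega>) - clip k (Y \<omega>)\<bar> + (Z n \<omega>)\<^sup>2 / k + (Y \<omega>)\<^sup>2 / k)"
    proof (rule integral_mono)
      show "\<bar>Z n \<omega> - Y \<omega>\<bar> \<le> \<bar>clip k (Z n \<omega>) - clip k (Y \<omega>)\<bar> + (Z n \<omega>)\<^sup>2 / k + (Y \<omega>)\<^sup>2 / k" for \<omega>
        using clip(1)[OF k, of "Z n \<omega>"] clip(1)[OF k, of "Y \<omega>"] by linarith
      show "integrable M (\<lambda>\<omega>. \<bar>clip k (Z n \<omega>) - clip k (Y \<omega>)\<bar> + (Z n \<omega>)\<^sup>2 / k + (Y \<omega>)\<^sup>2 / k)"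
        using ci[OF k] Zi Yi by simp
    qed (use Z1 Y1 in simp)
    also have "\<dots> = expectation (\<lambda>\<omega>. \<bar>clip k (Z n \<omega>) - clip k (Y \<omega>)\<bar>)
        + expectation (\<lambda>\<omega>. (Z n \<omega>)\<^sup>2) / k + expectation (\<lambda>\<omega>. (Y \<omega>)\<^sup>2) / k"
      using ci[OF k] Zi Yi by simp
    also have "\<dots> \<le> expectation (\<lambda>\<omega>. \<bar>clip k (Z n \<omega>) - clip k (Y \<omega>)\<bar>) + C / k + C / k"
      using ZC[of n] YE k by (intro add_mono divide_right_mono) auto
    finally show ?thesis by simp
  qed
  show "(\<lambda>n. expectation (\<lambda>\<omega>. \<bar>Z n \<omega> - Y \<omega>\<bar>)) \<longlonglongrightarrow> 0"
  proof (rule LIMSEQ_I)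
    fix r :: real assume r: "0 < r"
    \<comment> \<open>Makes the clipping error \<open>2 * C / k\<close> smaller than
      \<open>r\<close>; \<open>C + 1\<close> keeps \<open>k\<close> positive.\<close>
    define k where "k = 4 * (C + 1) / r"
    have k: "0 < k" using r C by (simp add: k_def)
    have "2 * C / k = r * (C / (2 * (C + 1)))" using r C by (simp add: k_def field_simps)
    also have "\<dots> < r * 1" using r C by (intro mult_strict_left_mono) (auto simp: field_simps)
    finally have "0 < r - 2 * C / k" by simp
    from LIMSEQ_D[OF clim[OF k] this] obtain N where
      N: "\<And>n. n \<ge> N \<Longrightarrow> norm (expectation (\<lambda>\<omega>. \<bar>clip k (Z n \<omega>) - clip k (Y \<omega>)\<bar>) - 0) < r - 2 * C / k" by blast
    have "norm (expectation (\<lambda>\<omega>. \<bar>Z n \<omega> - Y \<omega>\<bar>) - 0) < r" if "n \<ge> N" for n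
    proof -
      have "0 \<le> expectation (\<lambda>\<omega>. \<bar>Z n \<omega> - Y \<omega>\<bar>)" by simp
      then show ?thesis using N[OF that] bnd[OF k, of n] by simp
    qed
    then show "\<exists>no. \<forall>n\<ge>no. norm (expectation (\<lambda>\<omega>. \<bar>Z n \<omega> - Y \<omega>\<bar>) - 0) < r" by blast
  qed
qed

text \<open>The distance cut at 1 is bounded, so convergence in probability gives convergence in
  mean and hence an almost surely convergent subsequence. The cut is inactive once the distance is
  below 1.\<close>

lemma (in prob_space) tendsto_prob_imp_AE_subseq:
  fixes Z :: "nat \<Rightarrow> 'a \<Rightarrow> 'e::euclidean_space"
  assumes Zm: "\<And>n. Z n \<in> borel_measurable M" and Ym: "Y \<in> borel_measurable M"
    and lim: "\<And>\<epsilon>. 0 < \<epsilon> \<Longrightarrow> (\<lambda>n. prob {\<omega>\<in>space M. \<epsilon> \<le> norm (Z n \<omega> - Y \<omega>)}) \<longlonglongrightarrow> 0"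
  shows "\<exists>r. strict_mono r \<and> (AE \<omega> in M. (\<lambda>n. Z (r n) \<omega>) \<longlonglongrightarrow> Y \<omega>)"
proof -
  note [measurable] = Zm Ym
  define f where "f n \<omega> = min 1 (norm (Z n \<omega> - Y \<omega>))" for n \<omega>
  have [measurable]: "f n \<in> borel_measurable M" for n unfolding f_def[abs_def] by measurable
  have fi: "integrable M (f n)" for n
    by (rule integrable_const_bound[where B=1]) (auto simp: f_def)
  have f0: "0 \<le> f n \<omega>" for n \<omega> by (simp add: f_def)
  have "(\<lambda>n. expectation (\<lambda>\<omega>. norm (f n \<omega>))) \<longlonglongrightarrow> 0"
  proof (rule LIMSEQ_I)
    fix r :: real assume r: "0 < r"
    have r2: "0 < r / 2" using r by simp
    from LIMSEQ_D[OF lim[OF r2] r2] obtain N where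
      N: "\<And>n. n \<ge> N \<Longrightarrow> norm (prob {\<omega>\<in>space M. r / 2 \<le> norm (Z n \<omega> - Y \<omega>)} - 0) < r / 2" by blast
    have "norm (expectation (\<lambda>\<omega>. norm (f n \<omega>)) - 0) < r" if n: "n \<ge> N" for n
    proof -
      let ?E = "{\<omega>\<in>space M. r / 2 \<le> norm (Z n \<omega> - Y \<omega>)}"
      have "expectation (\<lambda>\<omega>. norm (f n \<omega>)) \<le> expectation (\<lambda>\<omega>. r / 2 + indicator ?E \<omega>)"
      proof (rule integral_mono)
        show "integrable M (\<lambda>\<omega>. norm (f n \<omega>))" using fi by simp
        show "integrable M (\<lambda>\<omega>. r / 2 + indicator ?E \<omega>)"
          by (intro Bochner_Integration.integrable_add integrable_real_indicator) (auto simp: emeasure_eq_measure)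
        show "norm (f n \<omega>) \<le> r / 2 + indicator ?E \<omega>" if "\<omega> \<in> space M" for \<omega>
          using that r f0[of n \<omega>] by (auto simp: f_def indicator_def min_def not_le)
      qed
      also have "\<dots> = r / 2 + prob ?E"
        by (subst Bochner_Integration.integral_add)
           (auto simp: prob_space emeasure_eq_measure intro!: integrable_real_indicator)
      also have "\<dots> < r" using N[OF n] by simp
      finally show ?thesis by simp
    qed
    then show "\<exists>no. \<forall>n\<ge>no. norm (expectation (\<lambda>\<omega>. norm (f n \<omega>)) - 0) < r" by blast
  qed
  from tendsto_L1_AE_subseq[OF fi this] obtain r where r: "strict_mono r"
    and ae: "AE \<omega> in M. (\<lambda>n. f (r n) \<omega>) \<longlonglongrightarrow> 0" by blast
  have "AE \<omega> in M. (\<lambda>n. Z (r n) \<omega>) \<longlonglongrightarrow> Y \<omega>"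
    using ae
  proof eventually_elim
    case (elim \<omega>)
    have "\<forall>\<^sub>F n in sequentially. f (r n) \<omega> < 1" by (rule order_tendstoD(2)[OF elim]) simp
    then have "\<forall>\<^sub>F n in sequentially. f (r n) \<omega> = norm (Z (r n) \<omega> - Y \<omega>)"
      by eventually_elim (auto simp: f_def min_def split: if_splits)
    from tendsto_cong[OF this] elim have "(\<lambda>n. norm (Z (r n) \<omega> - Y \<omega>)) \<longlonglongrightarrow> 0" by simp
    then have "(\<lambda>n. Z (r n) \<omega> - Y \<omega>) \<longlonglongrightarrow> 0" by (simp add: tendsto_norm_zero_iff)
    then show ?case by (simp add: LIM_zero_iff)
  qed
  with r show ?thesis by blast
qed

context sde_solution
begin

text \<open>Testing against bounded \<open>F 0\<close>-measurable \<open>G\<close> states the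
  conditional expectation without introducing it. A subsequence is enough, because
  \<open>euler_weak_limit\<close> already identifies the limit along the whole sequence.\<close>

lemma feynman_kac:
  assumes \<xi>: "\<And>\<omega>. \<omega> \<in> space M \<Longrightarrow> norm (\<xi> \<omega>) \<le> B"
    and u: "C12 T u" "poly_growing_partial_derivs T u"
    and pde: "\<And>t x. t \<in> {0..T} \<Longrightarrow> time_deriv T u t x =
       1/2 * trace (\<sigma> x ** transpose (\<sigma> x) ** hess (u t) x) + \<mu> x \<bullet> grad (u t) x"
  shows "integrable M (\<lambda>\<omega>. (u 0 (X T \<omega>))\<^sup>2)"
    and "\<And>G b. G \<in> borel_measurable (F 0) \<Longrightarrow> (\<And>\<omega>. \<bar>G \<omega>\<bar> \<le> b) \<Longrightarrow>
      expectation (\<lambda>\<omega>. G \<omega> * u 0 (X T \<omega>)) = expectation (\<lambda>\<omega>. G \<omega> * u T (\<xi> \<omega>))"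
proof -
  have Em: "euler n (2 ^ n) \<in> borel_measurable M" for n
    by (rule measurable_dy_M[OF order_refl euler_adapted[OF order_refl]])
  have XT: "X T \<in> borel_measurable M" using adapted_meas[OF X_adapted, of T] T_pos by simp
  obtain r where r: "strict_mono r" and ae: "AE \<omega> in M. (\<lambda>n. euler (r n) (2 ^ r n) \<omega>) \<longlonglongrightarrow> X T \<omega>"
    using tendsto_prob_imp_AE_subseq[OF Em XT euler_tendsto] by blast
  have T0: "0 \<in> {0..T}" using T_pos by simp
  have u0: "continuous_on UNIV (u 0)" by (rule C12_slices(1)[OF u(1) T0])
  have [measurable]: "u 0 \<in> borel_measurable borel" using u0 by (rule borel_measurable_continuous_onI)
  note [measurable] = Em XT
  define Z where "Z n \<omega> = u 0 (euler (r n) (2 ^ r n) \<omega>)" for n \<omega>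
  define Y where "Y \<omega> = u 0 (X T \<omega>)" for \<omega>
  have Zm[measurable]: "Z n \<in> borel_measurable M" for n unfolding Z_def[abs_def] by measurable
  have Ym[measurable]: "Y \<in> borel_measurable M" unfolding Y_def[abs_def] by measurable
  have lim: "AE \<omega> in M. (\<lambda>n. Z n \<omega>) \<longlonglongrightarrow> Y \<omega>"
    using ae
  proof eventually_elim
    case (elim \<omega>)
    have "isCont (u 0) (X T \<omega>)" using u0 by (simp add: continuous_on_eq_continuous_at)
    then show ?case unfolding Z_def Y_def by (rule isCont_tendsto_compose[OF _ elim])
  qed
  obtain cu mu where cu: "0 < cu" and ub: "\<And>x. \<bar>u 0 x\<bar> \<le> cu * (1 + norm x) ^ mu"
    using C12_poly_bound[OF u] T0 by blast
  obtain C where C: "0 \<le> C" "\<And>n i. i \<le> 2 ^ n \<Longrightarrow> integrable M (\<lambda>\<omega>. (1 + norm (euler n i \<omega>)) ^ (2 * mu))"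
    "\<And>n i. i \<le> 2 ^ n \<Longrightarrow> expectation (\<lambda>\<omega>. (1 + norm (euler n i \<omega>)) ^ (2 * mu)) \<le> C"
    using euler_moment[OF \<xi>, of "2 * mu"] by blast
  have ub2: "(u 0 x)\<^sup>2 \<le> cu\<^sup>2 * (1 + norm x) ^ (2 * mu)" for x
    using power_mono[OF ub[of x], of 2] by (simp add: power_mult_distrib power_mult[symmetric] mult.commute)
  have bi: "integrable M (\<lambda>\<omega>. cu\<^sup>2 * (1 + norm (euler n (2 ^ n) \<omega>)) ^ (2 * mu))" for n
    using C(2) by simp
  have Zi: "integrable M (\<lambda>\<omega>. (Z n \<omega>)\<^sup>2)" for n
    by (rule Bochner_Integration.integrable_bound[OF bi[of "r n"]])
       (auto intro!: AE_I2 order_trans[OF ub2] simp: Z_def)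
  have ZC: "expectation (\<lambda>\<omega>. (Z n \<omega>)\<^sup>2) \<le> cu\<^sup>2 * C" for n
  proof -
    have "expectation (\<lambda>\<omega>. (Z n \<omega>)\<^sup>2) \<le> expectation (\<lambda>\<omega>. cu\<^sup>2 * (1 + norm (euler (r n) (2 ^ r n) \<omega>)) ^ (2 * mu))"
      by (rule integral_mono[OF Zi bi]) (simp add: Z_def ub2)
    also have "\<dots> \<le> cu\<^sup>2 * C" using C(3)[of "2 ^ r n" "r n"] by (simp add: mult_left_mono)
    finally show ?thesis .
  qed
  note L = AE_convergent_L2_bounded[OF lim Zm Ym Zi ZC]
  show "integrable M (\<lambda>\<omega>. (u 0 (X T \<omega>))\<^sup>2)" using L(1) by (simp add: Y_def)
  fix G b assume GF: "G \<in> borel_measurable (F 0)" and Gb: "\<And>\<omega>. \<bar>G \<omega>\<bar> \<le> (b::real)"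
  have Gm[measurable]: "G \<in> borel_measurable M" using F_meas_M[of 0 G borel] GF T_pos by simp
  have Z1: "integrable M (Z n)" for n by (rule square_integrable_imp_integrable[OF Zm Zi])
  have Y1: "integrable M Y" by (rule square_integrable_imp_integrable[OF Ym L(1)])
  have b0: "0 \<le> b" using Gb abs_ge_zero order_trans by blast
  have Gi: "integrable M (\<lambda>\<omega>. G \<omega> * f \<omega>)" if f: "integrable M f" for f
  proof (rule Bochner_Integration.integrable_bound[OF integrable_mult_right[OF f, of b]])
    have [measurable]: "f \<in> borel_measurable M" using f by (rule borel_measurable_integrable)
    show "(\<lambda>\<omega>. G \<omega> * f \<omega>) \<in> borel_measurable M" by measurable
    show "AE \<omega> in M. norm (G \<omega> * f \<omega>) \<le> norm (b * f \<omega>)"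
      using Gb b0 by (auto simp: abs_mult intro!: AE_I2 mult_right_mono)
  qed
  have "(\<lambda>n. expectation (\<lambda>\<omega>. G \<omega> * Z n \<omega>) - expectation (\<lambda>\<omega>. G \<omega> * Y \<omega>)) \<longlonglongrightarrow> 0"
  proof (rule Lim_null_comparison)
    show "\<forall>\<^sub>F n in sequentially. norm (expectation (\<lambda>\<omega>. G \<omega> * Z n \<omega>) - expectation (\<lambda>\<omega>. G \<omega> * Y \<omega>))
        \<le> b * expectation (\<lambda>\<omega>. \<bar>Z n \<omega> - Y \<omega>\<bar>)"
    proof (intro always_eventually allI)
      fix n
      have di: "integrable M (\<lambda>\<omega>. Z n \<omega> - Y \<omega>)" using Z1 Y1 by simp
      have "expectation (\<lambda>\<omega>. G \<omega> * Z n \<omega>) - expectation (\<lambda>\<omega>. G \<omega> * Y \<omega>) = expectation (\<lambda>\<omega>. G \<omega> * (Z n \<omega> - Y \<omega>))"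
        unfolding Bochner_Integration.integral_diff[OF Gi[OF Z1] Gi[OF Y1], symmetric] by (simp add: right_diff_distrib)
      also have "norm \<dots> \<le> expectation (\<lambda>\<omega>. norm (G \<omega> * (Z n \<omega> - Y \<omega>)))" by (rule integral_norm_bound)
      also have "\<dots> \<le> expectation (\<lambda>\<omega>. b * \<bar>Z n \<omega> - Y \<omega>\<bar>)"
      proof (rule integral_mono)
        show "integrable M (\<lambda>\<omega>. norm (G \<omega> * (Z n \<omega> - Y \<omega>)))" by (rule integrable_norm[OF Gi[OF di]])
        show "norm (G \<omega> * (Z n \<omega> - Y \<omega>)) \<le> b * \<bar>Z n \<omega> - Y \<omega>\<bar>" for \<omega>
          using Gb[of \<omega>] by (simp add: abs_mult mult_right_mono)
      qed (use di in simp)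
      finally show "norm (expectation (\<lambda>\<omega>. G \<omega> * Z n \<omega>) - expectation (\<lambda>\<omega>. G \<omega> * Y \<omega>)) \<le> b * expectation (\<lambda>\<omega>. \<bar>Z n \<omega> - Y \<omega>\<bar>)"
        by simp
    qed
    show "(\<lambda>n. b * expectation (\<lambda>\<omega>. \<bar>Z n \<omega> - Y \<omega>\<bar>)) \<longlonglongrightarrow> 0" using tendsto_mult_left[OF L(2), of b] by simp
  qed
  then have l1: "(\<lambda>n. expectation (\<lambda>\<omega>. G \<omega> * Z n \<omega>)) \<longlonglongrightarrow> expectation (\<lambda>\<omega>. G \<omega> * Y \<omega>)"
    by (simp add: LIM_zero_iff)
  have "(\<lambda>n. expectation (\<lambda>\<omega>. G \<omega> * u 0 (euler n (2 ^ n) \<omega>))) \<longlonglongrightarrow> expectation (\<lambda>\<omega>. G \<omega> * u T (\<xi> \<omega>))"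
    by (rule euler_weak_limit[OF \<xi> u pde GF Gb])
  from LIMSEQ_subseq_LIMSEQ[OF this r]
  have "(\<lambda>n. expectation (\<lambda>\<omega>. G \<omega> * Z n \<omega>)) \<longlonglongrightarrow> expectation (\<lambda>\<omega>. G \<omega> * u T (\<xi> \<omega>))"
    by (simp add: o_def Z_def)
  from LIMSEQ_unique[OF l1 this] show "expectation (\<lambda>\<omega>. G \<omega> * u 0 (X T \<omega>)) = expectation (\<lambda>\<omega>. G \<omega> * u T (\<xi> \<omega>))"
    by (simp add: Y_def)
qed

end

text \<open>A nonzero value persists near \<open>x\<close>, so the zero set would miss a nonempty
  open set, which is not negligible.\<close>

lemma continuous_AE_zero_on_cbox:
  fixes g :: "'a::euclidean_space \<Rightarrow> real"
  assumes g: "continuous_on (cbox l r) g" and ae: "AE x in lborel. x \<in> cbox l r \<longrightarrow> g x = 0"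
    and ne: "box l r \<noteq> {}" and x: "x \<in> cbox l r"
  shows "g x = 0"
proof (rule ccontr)
  assume nz: "g x \<noteq> 0"
  have "continuous_on (cbox l r) (\<lambda>y. \<bar>g y\<bar>)" using g by (intro continuous_intros)
  from this[unfolded continuous_on_iff, rule_format, OF x, of "\<bar>g x\<bar>"] nz
  obtain d where d: "0 < d" "\<And>y. y \<in> cbox l r \<Longrightarrow> dist y x < d \<Longrightarrow> dist \<bar>g y\<bar> \<bar>g x\<bar> < \<bar>g x\<bar>" by auto
  define S where "S = ball x d \<inter> box l r"
  have oS: "open S" unfolding S_def by (intro open_Int open_ball open_box)
  \<comment> \<open>A boundary point of the cube has no neighbourhood inside it, but it is a limit
    of interior points; this makes \<open>S\<close> nonempty.\<close>
  have "x \<in> closure (box l r)" using x closure_box[OF ne] by simp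
  then have "S \<noteq> {}" unfolding S_def closure_approachable using d(1)
    by (metis Int_iff emptyE mem_ball dist_commute)
  have "g y \<noteq> 0" if "y \<in> S" for y
  proof -
    have "y \<in> cbox l r" "dist y x < d" using that box_subset_cbox[of l r] by (auto simp: S_def dist_commute)
    from d(2)[OF this] show ?thesis by (auto simp: dist_real_def)
  qed
  then have "AE y in lborel. y \<notin> S"
    using ae box_subset_cbox[of l r] by (auto simp: S_def elim!: eventually_mono)
  then have "S \<in> null_sets lborel" using oS by (subst AE_iff_null_sets) auto
  then have "negligible S" by (simp add: negligible_iff_null_sets null_sets_completionI)
  then show False using open_not_negligible[OF oS \<open>S \<noteq> {}\<close>] by blast
qed

theorem proposition2p7:
  fixes T a b :: real
    and \<mu> :: "real^'d \<Rightarrow> real^'d"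
    and \<sigma> :: "real^'d \<Rightarrow> real^'m^'d"
    and \<phi> :: "real^'d \<Rightarrow> real"
    and u :: "real \<Rightarrow> real^'d \<Rightarrow> real"
    and M :: "'w measure"
    and F :: "real \<Rightarrow> 'w measure"
    and W :: "real \<Rightarrow> 'w \<Rightarrow> real^'m"
    and \<xi> :: "'w \<Rightarrow> real^'d"
    and X :: "real \<Rightarrow> 'w \<Rightarrow> real^'d"
    and B :: "(real^'d) set"
  defines "B \<equiv> cbox (\<chi> i. a) (\<chi> i. b)"
  assumes "0 < T" and "a < b"
    and "\<exists>L. L-lipschitz_on UNIV \<mu>"
    and "\<exists>L. L-lipschitz_on UNIV \<sigma>"
    and "C12 T u" and "poly_growing_partial_derivs T u"
    and "\<And>x. u 0 x = \<phi> x"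
    and "\<And>t x. t \<in> {0..T} \<Longrightarrow>
           time_deriv T u t x =
             1/2 * trace (\<sigma> x ** transpose (\<sigma> x) ** hess (u t) x) + \<mu> x \<bullet> grad (u t) x"
    and "prob_space M"
    and "normal_filtration M T F"
    and "brownian_motion M T F W"
    and "\<xi> \<in> F 0 \<rightarrow>\<^sub>M restrict_space borel B"
    and "distr M borel \<xi> = uniform_measure lborel B"
    and "adapted_process T F X" and "continuous_paths M T X"
    and "solves_SDE M T F W \<mu> \<sigma> \<xi> X"
  shows "C2 \<phi> \<and> poly_growing_derivs \<phi> \<and>
    (\<exists>!U. U \<in> C_fun B \<and>
       mean_sq_error M (\<lambda>\<omega>. \<phi> (X T \<omega>)) \<xi> U =
         (INF v\<in>C_fun B. mean_sq_error M (\<lambda>\<omega>. \<phi> (X T \<omega>)) \<xi> v)) \<and>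
    (\<forall>U. U \<in> C_fun B \<and>
       mean_sq_error M (\<lambda>\<omega>. \<phi> (X T \<omega>)) \<xi> U =
         (INF v\<in>C_fun B. mean_sq_error M (\<lambda>\<omega>. \<phi> (X T \<omega>)) \<xi> v) \<longrightarrow>
       (\<forall>x\<in>B. U x = u T x))"
proof -
  interpret prob_space M by fact
  obtain K\<mu> K\<sigma> where lip: "K\<mu>-lipschitz_on UNIV \<mu>" "K\<sigma>-lipschitz_on UNIV \<sigma>" using assms(4,5) by blast
  note u = \<open>C12 T u\<close> \<open>poly_growing_partial_derivs T u\<close>
  have T: "0 < T" by fact
  have \<phi>: "\<phi> = u 0" using assms(8) by auto
  have spF: "space (F 0) = space M"
    using \<open>normal_filtration M T F\<close> T by (auto simp: normal_filtration_def subalgebra_def)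
  have \<xi>F: "\<xi> \<in> borel_measurable (F 0)" and \<xi>B: "\<And>\<omega>. \<omega> \<in> space M \<Longrightarrow> \<xi> \<omega> \<in> B"
    using \<open>\<xi> \<in> F 0 \<rightarrow>\<^sub>M restrict_space borel B\<close> spF
    by (auto simp: measurable_restrict_space2_iff)
  interpret sde_solution M T F W \<mu> \<sigma> K\<mu> K\<sigma> \<xi> X
    by unfold_locales (use T assms lip \<xi>F in auto)
  have cB: "compact B" unfolding B_def by (rule compact_cbox)
  obtain Bd where "\<forall>x\<in>B. norm x \<le> Bd" using compact_imp_bounded[OF cB] unfolding bounded_iff by blast
  then have \<xi>b: "norm (\<xi> \<omega>) \<le> Bd" if "\<omega> \<in> space M" for \<omega> using \<xi>B[OF that] by blast
  have FK1: "integrable M (\<lambda>\<omega>. (u 0 (X T \<omega>))\<^sup>2)"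
    by (rule feynman_kac(1)[OF \<xi>b u assms(9)])
  have FK2: "expectation (\<lambda>\<omega>. G \<omega> * u 0 (X T \<omega>)) = expectation (\<lambda>\<omega>. G \<omega> * u T (\<xi> \<omega>))"
    if "G \<in> borel_measurable (F 0)" "\<And>\<omega>. \<bar>G \<omega>\<bar> \<le> b" for G b
    by (rule feynman_kac(2)[OF \<xi>b u assms(9) that])
  have T0: "0 \<in> {0..T}" "T \<in> {0..T}" using T by auto
  have [measurable]: "B \<in> sets borel" unfolding B_def by simp
  have \<xi>M[measurable]: "\<xi> \<in> borel_measurable M" using F_meas_M[of 0 \<xi> borel] \<xi>F T by simp
  define P where "P \<omega> = \<phi> (X T \<omega>)" for \<omega>
  have XT[measurable]: "X T \<in> borel_measurable M" using adapted_meas[OF X_adapted, of T] T by simp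
  have [measurable]: "\<phi> \<in> borel_measurable borel"
    unfolding \<phi> using C12_slices(1)[OF u(1) T0(1)] by (rule borel_measurable_continuous_onI)
  have Pm[measurable]: "P \<in> borel_measurable M" unfolding P_def[abs_def] by measurable
  have P2: "integrable M (\<lambda>\<omega>. (P \<omega>)\<^sup>2)" using FK1 by (simp add: P_def \<phi>)
  have P1: "integrable M P" by (rule square_integrable_imp_integrable[OF Pm P2])
  \<comment> \<open>Candidates are controlled only on the compact cube. Cutting off outside gives
    bounded Borel functions on the whole space and changes nothing along \<xi>, which takes values
    in \<open>B\<close>.\<close>
  define ext where "ext g x = indicator B x *\<^sub>R g x" for g :: "real^'d \<Rightarrow> real" and x
  have ext_m: "ext g \<in> borel_measurable borel" if "continuous_on B g" for g
    unfolding ext_def[abs_def] by (rule borel_measurable_continuous_on_indicator[OF _ that]) simp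
  have ext_b: "\<exists>b. \<forall>x. \<bar>ext g x\<bar> \<le> b" if g: "continuous_on B g" for g
  proof -
    have "bounded (g ` B)" using compact_continuous_image[OF g cB] by (rule compact_imp_bounded)
    then obtain b where b: "0 < b" "\<forall>y\<in>g ` B. norm y \<le> b" unfolding bounded_pos by blast
    then show ?thesis by (intro exI[of _ b]) (auto simp: ext_def indicator_def)
  qed
  have bi: "integrable M (\<lambda>\<omega>. ext g (\<xi> \<omega>) * f \<omega>)" if g: "continuous_on B g" and f: "integrable M f" for g f
  proof -
    obtain b where b: "\<And>x. \<bar>ext g x\<bar> \<le> b" using ext_b[OF g] by blast
    note [measurable] = ext_m[OF g] borel_measurable_integrable[OF f]
    show ?thesis
    proof (rule Bochner_Integration.integrable_bound[OF integrable_mult_right[OF f, of b]])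
      show "AE \<omega> in M. norm (ext g (\<xi> \<omega>) * f \<omega>) \<le> norm (b * f \<omega>)"
      proof (rule AE_I2)
        fix \<omega>
        have "\<bar>ext g (\<xi> \<omega>)\<bar> \<le> \<bar>b\<bar>" using b[of "\<xi> \<omega>"] by linarith
        then show "norm (ext g (\<xi> \<omega>) * f \<omega>) \<le> norm (b * f \<omega>)" by (simp add: abs_mult mult_right_mono)
      qed
    qed measurable
  qed
  have uB: "continuous_on B (u T)"
    using C12_slices(1)[OF u(1) T0(2)] by (rule continuous_on_subset) simp
  define V where "V \<omega> = ext (u T) (\<xi> \<omega>)" for \<omega>
  have one: "integrable M (\<lambda>_. 1::real)" by simp
  have extE: "integrable M (\<lambda>\<omega>. ext g (\<xi> \<omega>))" if "continuous_on B g" for g using bi[OF that one] by simp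
  have V1: "integrable M V" unfolding V_def[abs_def] by (rule extE[OF uB])
  have VV: "integrable M (\<lambda>\<omega>. V \<omega> * V \<omega>)" unfolding V_def by (rule bi[OF uB extE[OF uB]])
  have VP: "integrable M (\<lambda>\<omega>. V \<omega> * P \<omega>)" unfolding V_def by (rule bi[OF uB P1])
  have PV: "integrable M (\<lambda>\<omega>. (P \<omega> - V \<omega>)\<^sup>2)"
  proof -
    have "(P \<omega> - V \<omega>)\<^sup>2 = (P \<omega>)\<^sup>2 - 2 * (V \<omega> * P \<omega>) + V \<omega> * V \<omega>" for \<omega>
      by (simp add: power2_eq_square algebra_simps)
    then show ?thesis using P2 VP VV by simp
  qed
  define e where "e = expectation (\<lambda>\<omega>. (P \<omega> - V \<omega>)\<^sup>2)"
  have e0: "0 \<le> e" by (simp add: e_def)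
  define G where "G v \<omega> = ext (\<lambda>x. u T x - v x) (\<xi> \<omega>)" for v \<omega>
  have Gc: "continuous_on B (\<lambda>x. u T x - v x)" if "continuous_on B v" for v
    using uB that by (rule continuous_on_diff)
  have G2: "integrable M (\<lambda>\<omega>. (G v \<omega>)\<^sup>2)" if v: "continuous_on B v" for v
    unfolding G_def power2_eq_square by (rule bi[OF Gc[OF v] extE[OF Gc[OF v]]])
  \<comment> \<open>The cross term vanishes by \<open>FK2\<close> tested with \<open>G v\<close>
    itself, a bounded \<open>F 0\<close>-measurable function because \<xi> is
    \<open>F 0\<close>-measurable.\<close>
  have mse: "mean_sq_error M (\<lambda>\<omega>. \<phi> (X T \<omega>)) \<xi> v = ennreal (e + expectation (\<lambda>\<omega>. (G v \<omega>)\<^sup>2))"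
    if v: "continuous_on B v" for v
  proof -
    obtain b where b: "\<And>x. \<bar>ext (\<lambda>x. u T x - v x) x\<bar> \<le> b" using ext_b[OF Gc[OF v]] by blast
    have GF: "G v \<in> borel_measurable (F 0)"
      unfolding G_def[abs_def] by (rule measurable_compose[OF \<xi>F ext_m[OF Gc[OF v]]])
    have Gb: "\<bar>G v \<omega>\<bar> \<le> b" for \<omega> unfolding G_def by (rule b)
    have "expectation (\<lambda>\<omega>. G v \<omega> * P \<omega>) = expectation (\<lambda>\<omega>. G v \<omega> * u T (\<xi> \<omega>))"
      unfolding P_def \<phi> by (rule FK2[OF GF Gb])
    also have "\<dots> = expectation (\<lambda>\<omega>. G v \<omega> * V \<omega>)"
      using \<xi>B by (intro Bochner_Integration.integral_cong) (auto simp: V_def ext_def)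
    finally have orth: "expectation (\<lambda>\<omega>. G v \<omega> * P \<omega>) = expectation (\<lambda>\<omega>. G v \<omega> * V \<omega>)" .
    have GP: "integrable M (\<lambda>\<omega>. G v \<omega> * P \<omega>)" and GV: "integrable M (\<lambda>\<omega>. G v \<omega> * V \<omega>)"
      unfolding G_def by (rule bi[OF Gc[OF v] P1], rule bi[OF Gc[OF v] V1])
    have eq: "\<bar>\<phi> (X T \<omega>) - v (\<xi> \<omega>)\<bar>\<^sup>2 = (P \<omega> - V \<omega>)\<^sup>2 + 2 * (G v \<omega> * P \<omega>) - 2 * (G v \<omega> * V \<omega>) + (G v \<omega>)\<^sup>2"
      if "\<omega> \<in> space M" for \<omega>
    proof -
      have v_eq: "v (\<xi> \<omega>) = V \<omega> - G v \<omega>" using \<xi>B[OF that] by (simp add: V_def G_def ext_def)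
      show ?thesis unfolding v_eq P_def power2_abs by (simp add: power2_eq_square algebra_simps)
    qed
    let ?R = "\<lambda>\<omega>. (P \<omega> - V \<omega>)\<^sup>2 + 2 * (G v \<omega> * P \<omega>) - 2 * (G v \<omega> * V \<omega>) + (G v \<omega>)\<^sup>2"
    have Ri: "integrable M ?R" using PV GP GV G2[OF v] by simp
    have "mean_sq_error M (\<lambda>\<omega>. \<phi> (X T \<omega>)) \<xi> v = (\<integral>\<^sup>+\<omega>. ennreal (?R \<omega>) \<partial>M)"
      unfolding mean_sq_error_def by (intro nn_integral_cong) (simp only: eq)
    also have "\<dots> = ennreal (expectation ?R)"
    proof (rule nn_integral_eq_integral[OF Ri], rule AE_I2)
      fix \<omega> assume "\<omega> \<in> space M"
      from eq[OF this, symmetric] show "0 \<le> ?R \<omega>" by simp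
    qed
    also have "expectation ?R = e + expectation (\<lambda>\<omega>. (G v \<omega>)\<^sup>2)"
      using PV GP GV G2[OF v] orth by (simp add: e_def)
    finally show ?thesis .
  qed
  define U0 where "U0 = restrict (u T) B"
  have U0: "U0 \<in> C_fun B"
    using uB unfolding C_fun_def U0_def by (auto cong: continuous_on_cong)
  have cont: "continuous_on B v" if "v \<in> C_fun B" for v using that by (simp add: C_fun_def)
  have "G U0 \<omega> = 0" for \<omega> by (simp add: G_def ext_def U0_def)
  then have mse0: "mean_sq_error M (\<lambda>\<omega>. \<phi> (X T \<omega>)) \<xi> U0 = ennreal e" using mse[OF cont[OF U0]] by simp
  have inf: "(INF v\<in>C_fun B. mean_sq_error M (\<lambda>\<omega>. \<phi> (X T \<omega>)) \<xi> v) = ennreal e"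
  proof (rule antisym)
    show "(INF v\<in>C_fun B. mean_sq_error M (\<lambda>\<omega>. \<phi> (X T \<omega>)) \<xi> v) \<le> ennreal e"
      using INF_lower[OF U0, of "mean_sq_error M (\<lambda>\<omega>. \<phi> (X T \<omega>)) \<xi>"] mse0 by simp
    show "ennreal e \<le> (INF v\<in>C_fun B. mean_sq_error M (\<lambda>\<omega>. \<phi> (X T \<omega>)) \<xi> v)"
      by (intro INF_greatest) (simp add: mse cont ennreal_leI)
  qed
  have l: "(\<chi> i. a) \<bullet> k = a" "(\<chi> i. b) \<bullet> k = b" if "k \<in> Basis" for k :: "real^'d"
    using that by (auto simp: Basis_vec_def inner_axis)
  have ne: "box (\<chi> i. a) (\<chi> i. b) \<noteq> ({} :: (real^'d) set)"
    unfolding box_ne_empty using l \<open>a < b\<close> by auto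
  have emB: "emeasure lborel B = ennreal (\<Prod>k\<in>(Basis::(real^'d) set). b - a)"
    using \<open>a < b\<close> l unfolding B_def emeasure_lborel_cbox_eq by (auto simp: inner_diff_left intro!: prod.cong)
  have emB0: "emeasure lborel B \<noteq> 0" and emBi: "emeasure lborel B < \<infinity>"
    unfolding emB using \<open>a < b\<close> by (auto simp: prod_constant)
  have uniq: "U x = u T x" if U: "U \<in> C_fun B" and opt: "mean_sq_error M (\<lambda>\<omega>. \<phi> (X T \<omega>)) \<xi> U =
         (INF v\<in>C_fun B. mean_sq_error M (\<lambda>\<omega>. \<phi> (X T \<omega>)) \<xi> v)" and x: "x \<in> B" for U x
  proof -
    note [measurable] = ext_m[OF Gc[OF cont[OF U]]]
    have "0 \<le> expectation (\<lambda>\<omega>. (G U \<omega>)\<^sup>2)" by simp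
    moreover have "ennreal (e + expectation (\<lambda>\<omega>. (G U \<omega>)\<^sup>2)) = ennreal e"
      using opt unfolding inf mse[OF cont[OF U]] .
    ultimately have "expectation (\<lambda>\<omega>. (G U \<omega>)\<^sup>2) = 0" using e0 by simp
    then have "AE \<omega> in M. (G U \<omega>)\<^sup>2 = 0"
      using integral_nonneg_eq_0_iff_AE[OF G2[OF cont[OF U]]] by simp
    then have "AE \<omega> in M. ext (\<lambda>x. u T x - U x) (\<xi> \<omega>) = 0" by (simp add: G_def)
    \<comment> \<open>The law of \<xi> is normalized Lebesgue measure on a cube of positive finite
      volume, so an almost sure identity at \<xi> becomes an identity almost everywhere on
      \<open>B\<close>; continuity extends it to every point of \<open>B\<close>.\<close>
    then have "AE x in distr M borel \<xi>. ext (\<lambda>x. u T x - U x) x = 0"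
      by (subst AE_distr_iff) auto
    then have "AE x in lborel. x \<in> B \<longrightarrow> ext (\<lambda>x. u T x - U x) x = 0"
      unfolding \<open>distr M borel \<xi> = uniform_measure lborel B\<close>
      by (subst (asm) AE_uniform_measure) (use emB0 emBi in auto)
    then have "AE x in lborel. x \<in> B \<longrightarrow> u T x - U x = 0"
      by (auto simp: ext_def elim!: eventually_mono)
    then have "u T x - U x = 0"
      using continuous_AE_zero_on_cbox[OF _ _ ne, of "\<lambda>x. u T x - U x" x] Gc[OF cont[OF U]] x
      unfolding B_def by blast
    then show ?thesis by simp
  qed
  \<comment> \<open>Smoothness and growth of \<phi> are the slice at time 0 of the hypotheses on
    \<open>u\<close>.\<close>
  have C2: "C2 \<phi>"
    unfolding C2_def \<phi> using C12_slices(1,2,3)[OF u(1) T0(1)] u(1) T0(1) unfolding C12_def by blast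
  have pg: "poly_growing_derivs \<phi>"
    unfolding poly_growing_derivs_def \<phi> using u(2) T0(1) unfolding poly_growing_partial_derivs_def by blast
  have ex1: "\<exists>!U. U \<in> C_fun B \<and> mean_sq_error M (\<lambda>\<omega>. \<phi> (X T \<omega>)) \<xi> U =
         (INF v\<in>C_fun B. mean_sq_error M (\<lambda>\<omega>. \<phi> (X T \<omega>)) \<xi> v)"
  proof (rule ex1I[of _ U0])
    show "U0 \<in> C_fun B \<and> mean_sq_error M (\<lambda>\<omega>. \<phi> (X T \<omega>)) \<xi> U0 =
         (INF v\<in>C_fun B. mean_sq_error M (\<lambda>\<omega>. \<phi> (X T \<omega>)) \<xi> v)"
      using U0 mse0 inf by simp
    fix U assume U: "U \<in> C_fun B \<and> mean_sq_error M (\<lambda>\<omega>. \<phi> (X T \<omega>)) \<xi> U =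
         (INF v\<in>C_fun B. mean_sq_error M (\<lambda>\<omega>. \<phi> (X T \<omega>)) \<xi> v)"
    show "U = U0"
    proof (rule extensionalityI[of _ B])
      show "U \<in> extensional B" "U0 \<in> extensional B" using U U0 by (auto simp: C_fun_def)
      show "U x = U0 x" if "x \<in> B" for x using uniq[of U x] U that by (simp add: U0_def)
    qed
  qed
  show ?thesis using C2 pg ex1 uniq by blast
qed

end
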